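(* Let $\mathbb{H}^2$ be the hyperbolic plane, $u,v\in UT\mathbb{H}^2$ and $\kappa_1<\kappa_2$ in $\mathbb{R}\cup\{\pm\infty\}$. (a) If $(\kappa_1,\kappa_2)\subset[-1,1]$, then at most one of the canonical subspaces of $\mathcal{C}_{\kappa_1}^{\kappa_2}(u,v)$ is nonempty, and this subspace (if there is one) is contractible. Thus $\mathcal{C}_{\kappa_1}^{\kappa_2}(u,v)$ itself is either empty or contractible. (b) If $(\kappa_1,\kappa_2)$ is disjoint from $[-1,1]$, then infinitely many of the canonical subspaces of $\mathcal{C}_{\kappa_1}^{\kappa_2}(u,v)$ are empty, and infinitely many are nonempty. The latter are all contractible.
   Context: $UT\mathbb{H}^2$ is the unit tangent bundle of the oriented hyperbolic plane (curvature $-1$). A curve $\gamma:[0,1]\to\mathbb{H}^2$ is regular if it has a continuous nonvanishing derivative; its unit tangent is $\mathbf{t}_\gamma=\dot\gamma/|\dot\gamma|$ and its unit normal $\mathbf{n}_\gamma$ is the unit vector field along $\gamma$ such that $(\mathbf{t}_\gamma,\mathbf{n}_\gamma)$ is a positively oriented orthonormal basis. If $\gamma$ is $C^2$, its curvature is $\kappa_\gamma=\frac{1}{|\dot\gamma|}\langle \frac{D\mathbf{t}_\gamma}{dt},\mathbf{n}_\gamma\rangle$. For $\kappa_1<\kappa_2$ in $\mathbb{R}\cup\{\pm\infty\}$, $\mathcal{C}_{\kappa_1}^{\kappa_2}(u,v)$ is the set of all $C^r$ regular curves $\gamma:[0,1]\to\mathbb{H}^2$ with $\mathbf{t}_\gamma(0)=u$,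 $\mathbf{t}_\gamma(1)=v$ and $\kappa_1<\kappa_\gamma(t)<\kappa_2$ for all $t\in[0,1]$, with the $C^r$ topology, for a fixed integer $r\ge 2$. Canonical subspaces: let $\mathrm{pr}:\widetilde{UT\mathbb{H}^2}\to UT\mathbb{H}^2$ be the universal cover and fix a lift $\tilde u$ of $u$. Sending $\gamma$ to the endpoint of the lift of $\mathbf{t}_\gamma$ starting at $\tilde u$ gives a locally constant map $\mathcal{C}_{\kappa_1}^{\kappa_2}(u,v)\to \mathrm{pr}^{-1}(v)$. The canonical subspaces are the (possibly empty) preimages of the points of the discrete set $\mathrm{pr}^{-1}(v)$, one for each such point; each is open and closed. *)

theory Defs
  imports "HOL-Analysis.Analysis"
begin

section \<open>The hyperbolic plane\<close>

text \<open>
  The oriented hyperbolic plane is the upper half-plane with the metric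
  $(dx^2 + dy^2)/y^2$ of curvature $-1$ and the orientation of the complex plane.
  Tangent vectors at \<open>z\<close> are complex numbers.
\<close>

definition hyperbolic_plane :: "complex set" where
  "hyperbolic_plane = {z. Im z > 0}"

definition hyp_inner :: "complex \<Rightarrow> complex \<Rightarrow> complex \<Rightarrow> real" where
  "hyp_inner z a b = (a \<bullet> b) / (Im z)\<^sup>2"

definition hyp_norm :: "complex \<Rightarrow> complex \<Rightarrow> real" where
  "hyp_norm z a = sqrt (hyp_inner z a a)"

text \<open>The topology is the one induced from \<open>complex \<times> complex\<close>.\<close>

definition unit_tangent_bundle :: "(complex \<times> complex) set" where
  "unit_tangent_bundle = {(z, a). z \<in> hyperbolic_plane \<and> hyp_norm z a = 1}"

text \<open>
  The Levi-Civita connection in the coordinates $z = x + iy$: the nonzero Christoffel symbols are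
  $\Gamma^x_{xy} = \Gamma^x_{yx} = \Gamma^y_{yy} = -1/y$ and $\Gamma^y_{xx} = 1/y$.
\<close>

definition christoffel :: "complex \<Rightarrow> complex \<Rightarrow> complex \<Rightarrow> complex" where
  "christoffel z a b =
     Complex (- (Re a * Im b + Im a * Re b) / Im z) ((Re a * Re b - Im a * Im b) / Im z)"

section \<open>Curves\<close>

text \<open>The derivative on \<open>[0,1]\<close>, one-sided at the endpoints.\<close>

definition deriv01 :: "(real \<Rightarrow> 'a::real_normed_vector) \<Rightarrow> real \<Rightarrow> 'a" where
  "deriv01 f t = vector_derivative f (at t within {0..1})"

definition cov_deriv :: "(real \<Rightarrow> complex) \<Rightarrow> (real \<Rightarrow> complex) \<Rightarrow> real \<Rightarrow> complex" where
  "cov_deriv \<gamma> V t = deriv01 V t + christoffel (\<gamma> t) (deriv01 \<gamma> t) (V t)"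

definition speed :: "(real \<Rightarrow> complex) \<Rightarrow> real \<Rightarrow> real" where
  "speed \<gamma> t = hyp_norm (\<gamma> t) (deriv01 \<gamma> t)"

definition unit_tangent :: "(real \<Rightarrow> complex) \<Rightarrow> real \<Rightarrow> complex" where
  "unit_tangent \<gamma> t = deriv01 \<gamma> t /\<^sub>R speed \<gamma> t"

text \<open>
  The metric is conformal, so the unit normal is the unit tangent rotated by a right angle;
  see \<open>unit_normal_iff\<close> below.
\<close>

definition unit_normal :: "(real \<Rightarrow> complex) \<Rightarrow> real \<Rightarrow> complex" where
  "unit_normal \<gamma> t = \<i> * unit_tangent \<gamma> t"

definition curvature :: "(real \<Rightarrow> complex) \<Rightarrow> real \<Rightarrow> real" where
  "curvature \<gamma> t =
     hyp_inner (\<gamma> t) (cov_deriv \<gamma> (unit_tangent \<gamma>) t) (unit_normal \<gamma> t) / speed \<gamma> t"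

text \<open>The unit tangent as a curve in the unit tangent bundle, base point included.\<close>

definition tangent_curve :: "(real \<Rightarrow> complex) \<Rightarrow> real \<Rightarrow> complex \<times> complex" where
  "tangent_curve \<gamma> t = (\<gamma> t, unit_tangent \<gamma> t)"

section \<open>Spaces of curves\<close>

text \<open>
  Curves on \<open>[0,1]\<close> are represented by functions on the reals that are \<open>undefined\<close> outside
  \<open>[0,1]\<close>, so that equality of functions is equality of curves.
\<close>

definition Cr_curves :: "nat \<Rightarrow> (real \<Rightarrow> complex) set" where
  "Cr_curves r = {\<gamma> \<in> extensional {0..1}. \<gamma> ` {0..1} \<subseteq> hyperbolic_plane \<and>
     (\<forall>k<r. \<forall>t\<in>{0..1}. (deriv01 ^^ k) \<gamma> differentiable (at t within {0..1})) \<and>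
     continuous_on {0..1} ((deriv01 ^^ r) \<gamma>)}"

text \<open>
  The $C^r$ topology is that of uniform convergence on \<open>[0,1]\<close> of the derivatives of order at most
  \<open>r\<close>. The value 0 off \<open>Cr_curves r\<close> is only there because the locale \<open>Metric_space\<close> asks for
  nonnegativity of the distance at all arguments.
\<close>

definition Cr_dist :: "nat \<Rightarrow> (real \<Rightarrow> complex) \<Rightarrow> (real \<Rightarrow> complex) \<Rightarrow> real" where
  "Cr_dist r \<gamma> \<eta> =
     (if \<gamma> \<in> Cr_curves r \<and> \<eta> \<in> Cr_curves r
      then \<Sum>k\<le>r. SUP t\<in>{0..1}. dist ((deriv01 ^^ k) \<gamma> t) ((deriv01 ^^ k) \<eta> t) else 0)"

definition curve_space ::
  "nat \<Rightarrow> ereal \<Rightarrow> ereal \<Rightarrow> complex \<times> complex \<Rightarrow> complex \<times> complex \<Rightarrow> (real \<Rightarrow> complex) set" where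
  "curve_space r \<kappa>1 \<kappa>2 u v = {\<gamma> \<in> Cr_curves r.
     (\<forall>t\<in>{0..1}. deriv01 \<gamma> t \<noteq> 0) \<and>
     tangent_curve \<gamma> 0 = u \<and> tangent_curve \<gamma> 1 = v \<and>
     (\<forall>t\<in>{0..1}. \<kappa>1 < ereal (curvature \<gamma> t) \<and> ereal (curvature \<gamma> t) < \<kappa>2)}"

definition curve_topology ::
  "nat \<Rightarrow> ereal \<Rightarrow> ereal \<Rightarrow> complex \<times> complex \<Rightarrow> complex \<times> complex \<Rightarrow> (real \<Rightarrow> complex) topology" where
  "curve_topology r \<kappa>1 \<kappa>2 u v = Metric_space.mtopology (curve_space r \<kappa>1 \<kappa>2 u v) (Cr_dist r)"

section \<open>Canonical subspaces\<close>

definition universal_cover ::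
  "'e::real_normed_vector set \<Rightarrow> ('e \<Rightarrow> 'b) \<Rightarrow> 'b::topological_space set \<Rightarrow> bool" where
  "universal_cover E pr S \<longleftrightarrow> covering_space E pr S \<and> simply_connected E"

text \<open>
  Existence and uniqueness of the lift, hence of the endpoint, are \<open>lift_endpoint_in_fibre\<close> and
  \<open>lift_endpoint_eqI\<close> below.
\<close>

definition lift_endpoint ::
  "'e::real_normed_vector set \<Rightarrow> ('e \<Rightarrow> complex \<times> complex) \<Rightarrow> 'e \<Rightarrow> (real \<Rightarrow> complex) \<Rightarrow> 'e" where
  "lift_endpoint E pr e \<gamma> = (THE w. \<exists>g. path g \<and> path_image g \<subseteq> E \<and> pathstart g = e \<and>
     (\<forall>t\<in>{0..1}. pr (g t) = tangent_curve \<gamma> t) \<and> pathfinish g = w)"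

definition canonical_subspace ::
  "nat \<Rightarrow> ereal \<Rightarrow> ereal \<Rightarrow> complex \<times> complex \<Rightarrow> complex \<times> complex \<Rightarrow>
   'e::real_normed_vector set \<Rightarrow> ('e \<Rightarrow> complex \<times> complex) \<Rightarrow> 'e \<Rightarrow> 'e \<Rightarrow> (real \<Rightarrow> complex) set" where
  "canonical_subspace r \<kappa>1 \<kappa>2 u v E pr e w = {\<gamma> \<in> curve_space r \<kappa>1 \<kappa>2 u v. lift_endpoint E pr e \<gamma> = w}"

section \<open>The definitions make sense\<close>

lemma hyp_norm_eq: "Im z > 0 \<Longrightarrow> hyp_norm z a = cmod a / Im z"
  by (simp add: hyp_norm_def hyp_inner_def real_sqrt_divide norm_eq_sqrt_inner)

lemma unit_normal_iff:
  assumes "\<gamma> t \<in> hyperbolic_plane" and "deriv01 \<gamma> t \<noteq> 0"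
  shows "n = unit_normal \<gamma> t \<longleftrightarrow>
    hyp_norm (\<gamma> t) n = 1 \<and> hyp_inner (\<gamma> t) (unit_tangent \<gamma> t) n = 0 \<and>
    Re (unit_tangent \<gamma> t) * Im n - Im (unit_tangent \<gamma> t) * Re n > 0"
    (is "_ \<longleftrightarrow> ?R")
proof -
  define y where "y = Im (\<gamma> t)"
  define a where "a = unit_tangent \<gamma> t"
  have y: "y > 0" using assms by (simp add: y_def hyperbolic_plane_def)
  have a: "cmod a = y"
    using assms y by (simp add: a_def unit_tangent_def speed_def hyp_norm_eq y_def[symmetric])
  have a2: "(Re a)\<^sup>2 + (Im a)\<^sup>2 = y\<^sup>2" using a by (metis cmod_power2)
  have R: "?R \<longleftrightarrow> cmod n = y \<and> Re a * Re n + Im a * Im n = 0 \<and> Re a * Im n - Im a * Re n > 0"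
    using y by (auto simp: hyp_norm_eq hyp_inner_def inner_complex_def a_def y_def)
  show ?thesis
  proof
    assume "n = unit_normal \<gamma> t"
    then have n: "n = \<i> * a" by (simp add: unit_normal_def a_def)
    have "Re a * Re a + Im a * Im a > 0"
      using a2 y by (simp add: power2_eq_square)
    then show ?R
      unfolding R using n a by (simp add: norm_mult)
  next
    assume ?R
    then have h: "cmod n = y" "Re a * Re n + Im a * Im n = 0" "Re a * Im n - Im a * Re n > 0"
      using R by auto
    define d where "d = Re a * Im n - Im a * Re n"
    have n2: "(Re n)\<^sup>2 + (Im n)\<^sup>2 = y\<^sup>2" using h(1) by (metis cmod_power2)
    have "d\<^sup>2 + (Re a * Re n + Im a * Im n)\<^sup>2 = ((Re a)\<^sup>2 + (Im a)\<^sup>2) * ((Re n)\<^sup>2 + (Im n)\<^sup>2)"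
      unfolding d_def by algebra
    then have "d\<^sup>2 = (y\<^sup>2)\<^sup>2" using h(2) a2 n2 by (simp add: power2_eq_square)
    then have d: "d = y\<^sup>2" using h(3) by (metis d_def less_imp_le power2_eq_iff_nonneg zero_le_power2)
    have "Re n * y\<^sup>2 = - Im a * d + Re a * (Re a * Re n + Im a * Im n)"
      unfolding a2[symmetric] d_def by algebra
    then have "Re n * y\<^sup>2 = (- Im a) * y\<^sup>2" using h(2) d by simp
    then have re: "Re n = - Im a" using y by (subst (asm) mult_right_cancel) auto
    have "Im n * y\<^sup>2 = Re a * d + Im a * (Re a * Re n + Im a * Im n)"
      unfolding a2[symmetric] d_def by algebra
    then have "Im n * y\<^sup>2 = Re a * y\<^sup>2" using h(2) d by simp
    then have im: "Im n = Re a" using y by (subst (asm) mult_right_cancel) auto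
    show "n = unit_normal \<gamma> t"
      using re im by (simp add: complex_eq_iff unit_normal_def a_def)
  qed
qed

lemma Cr_curves_continuous:
  assumes "\<gamma> \<in> Cr_curves r" "k \<le> r"
  shows "continuous_on {0..1} ((deriv01 ^^ k) \<gamma>)"
proof (cases "k = r")
  case False
  then have "\<forall>t\<in>{0..1}. (deriv01 ^^ k) \<gamma> differentiable (at t within {0..1})"
    using assms by (auto simp: Cr_curves_def)
  then show ?thesis
    by (simp add: continuous_on_eq_continuous_within differentiable_imp_continuous_within)
qed (use assms in \<open>auto simp: Cr_curves_def\<close>)

lemma bdd_above_Cr_curves:
  assumes "\<gamma> \<in> Cr_curves r" "\<eta> \<in> Cr_curves r" "k \<le> r"
  shows "bdd_above ((\<lambda>t. dist ((deriv01 ^^ k) \<gamma> t) ((deriv01 ^^ k) \<eta> t)) ` {0..1})"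
  by (intro bounded_imp_bdd_above compact_imp_bounded compact_continuous_image continuous_on_dist
      Cr_curves_continuous[OF assms(1,3)] Cr_curves_continuous[OF assms(2,3)] compact_Icc)

lemma Metric_space_Cr_curves: "Metric_space (Cr_curves r) (Cr_dist r)"
proof
  fix f g h :: "real \<Rightarrow> complex"
  let ?d = "\<lambda>k f g t. dist ((deriv01 ^^ k) f t) ((deriv01 ^^ k) g t :: complex)"
  have nonneg: "0 \<le> (SUP t\<in>{0..1}. ?d k f g t)"
    if "f \<in> Cr_curves r" "g \<in> Cr_curves r" "k \<le> r" for k f g
    by (rule order_trans[OF zero_le_dist cSUP_upper[OF _ bdd_above_Cr_curves[OF that], of 0]]) simp
  show "0 \<le> Cr_dist r f g"
    by (auto simp: Cr_dist_def intro!: sum_nonneg nonneg)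
  show "Cr_dist r f g = Cr_dist r g f"
    by (simp add: Cr_dist_def dist_commute)
  assume f: "f \<in> Cr_curves r" and g: "g \<in> Cr_curves r"
  show "Cr_dist r f g = 0 \<longleftrightarrow> f = g"
  proof
    assume "Cr_dist r f g = 0"
    then have "\<forall>k\<in>{..r}. (SUP t\<in>{0..1}. ?d k f g t) = 0"
      using f g by (subst (asm) Cr_dist_def, simp, subst (asm) sum_nonneg_eq_0_iff) (auto intro: nonneg)
    then have "(SUP t\<in>{0..1}. ?d 0 f g t) = 0" by blast
    then have "dist (f t) (g t) \<le> 0" if "t \<in> {0..1}" for t
      using cSUP_upper[OF that bdd_above_Cr_curves[OF f g, of 0]] by simp
    then show "f = g"
      using f g by (intro extensionalityI[of f "{0..1}" g]) (auto simp: Cr_curves_def)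
  qed (simp add: Cr_dist_def)
  assume h: "h \<in> Cr_curves r"
  have "(SUP t\<in>{0..1}. ?d k f h t) \<le> (SUP t\<in>{0..1}. ?d k f g t) + (SUP t\<in>{0..1}. ?d k g h t)"
    if k: "k \<le> r" for k
  proof (rule cSUP_least)
    fix t :: real assume t: "t \<in> {0..1}"
    have "?d k f h t \<le> ?d k f g t + ?d k g h t" by (rule dist_triangle)
    also have "\<dots> \<le> (SUP t\<in>{0..1}. ?d k f g t) + (SUP t\<in>{0..1}. ?d k g h t)"
      by (intro add_mono cSUP_upper t bdd_above_Cr_curves[OF f g k] bdd_above_Cr_curves[OF g h k])
    finally show "?d k f h t \<le> \<dots>" .
  qed simp
  then show "Cr_dist r f h \<le> Cr_dist r f g + Cr_dist r g h"
    using f g h by (auto simp: Cr_dist_def sum.distrib[symmetric] intro!: sum_mono)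
qed

lemma Metric_space_curve_space: "Metric_space (curve_space r \<kappa>1 \<kappa>2 u v) (Cr_dist r)"
  by (rule Metric_space.subspace[OF Metric_space_Cr_curves]) (auto simp: curve_space_def)

lemma topspace_curve_topology [simp]:
  "topspace (curve_topology r \<kappa>1 \<kappa>2 u v) = curve_space r \<kappa>1 \<kappa>2 u v"
  by (simp add: curve_topology_def Metric_space.topspace_mtopology[OF Metric_space_curve_space])

lemma path_tangent_curve:
  assumes \<gamma>: "\<gamma> \<in> curve_space r \<kappa>1 \<kappa>2 u v" and "r \<ge> 1"
  shows "path (tangent_curve \<gamma>)" "path_image (tangent_curve \<gamma>) \<subseteq> unit_tangent_bundle"
proof -
  have C: "\<gamma> \<in> Cr_curves r" and nz: "\<And>t. t \<in> {0..1} \<Longrightarrow> deriv01 \<gamma> t \<noteq> 0"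
    using \<gamma> by (auto simp: curve_space_def)
  have y: "Im (\<gamma> t) > 0" if "t \<in> {0..1}" for t
    using C that unfolding Cr_curves_def hyperbolic_plane_def by blast
  have c0: "continuous_on {0..1} \<gamma>" using Cr_curves_continuous[OF C, of 0] by simp
  have c1: "continuous_on {0..1} (deriv01 \<gamma>)" using Cr_curves_continuous[OF C, of 1] assms by simp
  have eq: "unit_tangent \<gamma> t = (Im (\<gamma> t) / cmod (deriv01 \<gamma> t)) *\<^sub>R deriv01 \<gamma> t"
    if "t \<in> {0..1}" for t
    using y[OF that] by (simp add: unit_tangent_def speed_def hyp_norm_eq)
  have "continuous_on {0..1} (\<lambda>t. (Im (\<gamma> t) / cmod (deriv01 \<gamma> t)) *\<^sub>R deriv01 \<gamma> t)"
    by (intro continuous_intros c0 c1) (use nz in auto)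
  then have "continuous_on {0..1} (unit_tangent \<gamma>)"
    by (subst continuous_on_cong[OF refl eq]) auto
  then show "path (tangent_curve \<gamma>)"
    unfolding path_def tangent_curve_def by (intro continuous_intros c0)
  have "tangent_curve \<gamma> t \<in> unit_tangent_bundle" if "t \<in> {0..1}" for t
    using y[OF that] nz[OF that]
    by (simp add: tangent_curve_def unit_tangent_bundle_def hyperbolic_plane_def hyp_norm_eq eq[OF that])
  then show "path_image (tangent_curve \<gamma>) \<subseteq> unit_tangent_bundle"
    by (auto simp: path_image_def)
qed

lemma lift_endpoint_eqI:
  assumes cov: "covering_space E pr unit_tangent_bundle"
    and \<gamma>: "\<gamma> \<in> curve_space r \<kappa>1 \<kappa>2 u v" and r: "r \<ge> 1"
    and g: "path g" "path_image g \<subseteq> E" "pathstart g = e"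
      "\<And>t. t \<in> {0..1} \<Longrightarrow> pr (g t) = tangent_curve \<gamma> t"
  shows "lift_endpoint E pr e \<gamma> = pathfinish g"
  unfolding lift_endpoint_def
proof (rule the_equality)
  show "\<exists>g'. path g' \<and> path_image g' \<subseteq> E \<and> pathstart g' = e \<and>
     (\<forall>t\<in>{0..1}. pr (g' t) = tangent_curve \<gamma> t) \<and> pathfinish g' = pathfinish g"
    using g by blast
  note T = path_tangent_curve[OF \<gamma> r]
  fix w assume "\<exists>h. path h \<and> path_image h \<subseteq> E \<and> pathstart h = e \<and>
     (\<forall>t\<in>{0..1}. pr (h t) = tangent_curve \<gamma> t) \<and> pathfinish h = w"
  then obtain h where h: "path h" "path_image h \<subseteq> E" "pathstart h = e"
    "\<And>t. t \<in> {0..1} \<Longrightarrow> pr (h t) = tangent_curve \<gamma> t" and w: "pathfinish h = w" by blast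
  have "h 1 = g 1"
    by (rule covering_space_lift_unique[OF cov, where a=0 and T="{0..1}" and f="tangent_curve \<gamma>"])
      (use g h T in \<open>auto simp: path_def path_image_def pathstart_def\<close>)
  then show "w = pathfinish g" using w by (simp add: pathfinish_def)
qed

lemma lift_endpoint_in_fibre:
  assumes cov: "covering_space E pr unit_tangent_bundle" and e: "e \<in> E" "pr e = u"
    and \<gamma>: "\<gamma> \<in> curve_space r \<kappa>1 \<kappa>2 u v" and r: "r \<ge> 1"
  shows "lift_endpoint E pr e \<gamma> \<in> E" "pr (lift_endpoint E pr e \<gamma>) = v"
proof -
  note T = path_tangent_curve[OF \<gamma> r]
  have "pathstart (tangent_curve \<gamma>) = pr e"
    using \<gamma> e by (simp add: curve_space_def pathstart_def)
  then obtain g where g: "path g" "path_image g \<subseteq> E" "pathstart g = e"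
    "\<And>t. t \<in> {0..1} \<Longrightarrow> pr (g t) = tangent_curve \<gamma> t"
    using covering_space_lift_path_strong[OF cov e(1) T] by blast
  have "lift_endpoint E pr e \<gamma> = g 1"
    using lift_endpoint_eqI[OF cov \<gamma> r g] by (simp add: pathfinish_def)
  then show "lift_endpoint E pr e \<gamma> \<in> E" "pr (lift_endpoint E pr e \<gamma>) = v"
    using g(2) g(4)[of 1] \<gamma> by (auto simp: path_image_def curve_space_def)
qed

end

theory Submission
  imports Defs
begin

text \<open>
  In the half-plane a unit tangent vector is a point \<open>z\<close> together with the Euclidean direction
  \<open>\<theta>\<close> of the vector, and \<open>(z, \<theta>)\<close> are coordinates on the universal cover of the unit tangent
  bundle. Hence the canonical subspace of a curve records one real number: the total turning
  \<open>\<Omega>\<close> of its Euclidean direction (\<open>lift_endpoint_turning\<close>). In the same coordinates the curvature is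
  \<open>\<kappa> = cos \<theta> + y d\<theta>/d\<sigma>\<close>, with \<open>\<sigma>\<close> the Euclidean arc length (\<open>curvature_eq\<close>).

  Curvature above 1 (or below -1). Now \<open>\<theta>\<close> is strictly monotone along the curve, so a curve with
  turning \<open>\<Omega>\<close> is determined, up to its timing, by the Euclidean radius of curvature \<open>\<rho>\<close> as a function of
  the direction. The curve depends linearly on \<open>\<rho>\<close>, and \<open>\<kappa> - cos \<theta>\<close> is a quotient \<open>y / \<rho>\<close> of
  two linear quantities; since a mediant of two fractions lies between them, the bounds on the
  curvature cut out a convex set of radius functions (\<open>admissible_convex\<close>), and every nonempty canonical
  subspace is contractible (\<open>contractible_turn_class\<close>). All turnings have the sign of the curvature,
  which leaves infinitely many canonical subspaces empty. Conversely, circles of constant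
  curvature \<open>k\<close> whose centre and radius drift slowly join any two tangent vectors once they are
  allowed enough turns (\<open>exists_admissible\<close>), so infinitely many canonical subspaces are nonempty.

  Curvature between -1 and 1. A hyperbolic isometry moves the final vector to one that points
  upwards (\<open>homeomorphic_invert_curve\<close>); a curve of small curvature that ends upwards points upwards
  all the time (\<open>always_up\<close>), so it is a graph over its height. With \<open>s = 1/y\<close> and the momentum
  \<open>P = cos \<theta> / y\<close>, the conserved quantity of geodesics under horizontal translation, one finds
  \<open>dP = \<kappa> ds\<close>: the condition on the curvature bounds the slope of \<open>P\<close>, the end vectors fix the
  end values of \<open>P\<close>, and what remains of the end conditions is the value of the horizontal displacement,
  an integral that is strictly increasing in \<open>P\<close>. A level set of such a functional within a convex
  set of functions is contractible (\<open>level_contraction\<close>): a segment towards a function near the lower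
  envelope decreases the functional, one towards the upper envelope increases it, and a suitable
  mixture of the two keeps it constant. So the whole space is contractible
  (\<open>contractible_small_curvature\<close>). As the turning is continuous with values in a coset of
  \<open>2 \<pi> \<int>\<close>, it is constant, and at most one canonical subspace is nonempty.

  Both parametrisations, by direction and by height, must be converted back into curves on
  \<open>[0,1]\<close> without losing derivatives. The timing of the curve is therefore kept as a second
  coordinate and is deformed to a standard one along with the shape.
\<close>


section \<open>Convergence in \<open>C\<^sup>k\<close> along a filter\<close>

definition has_deriv01 :: "(real \<Rightarrow> 'a::real_normed_vector) \<Rightarrow> (real \<Rightarrow> 'a) \<Rightarrow> bool" where
  "has_deriv01 f f' \<longleftrightarrow> (\<forall>t\<in>{0..1}. (f has_vector_derivative f' t) (at t within {0..1}))"

definition C0_tendsto ::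
  "'i filter \<Rightarrow> ('i \<Rightarrow> real \<Rightarrow> 'a::real_normed_vector) \<Rightarrow> (real \<Rightarrow> 'a) \<Rightarrow> bool" where
  "C0_tendsto F f g \<longleftrightarrow> (\<forall>\<^sub>F i in F. continuous_on {0..1} (f i)) \<and> continuous_on {0..1} g \<and>
     uniform_limit {0..1} f g F"

text \<open>Continuity of maps between spaces of curves is proved as preservation of limits along arbitrary
  filters. Recursion on \<open>k\<close>, with derivatives given by some functions rather than by an operator,
  turns each closure property into an induction whose step is the corresponding differentiation
  rule. The index \<open>i\<close> may range over anything; taken over a one-point filter, the same
  lemmas say that the operations preserve \<open>C\<^sup>k\<close> functions.\<close>

primrec Ck_tendsto ::
  "nat \<Rightarrow> 'i filter \<Rightarrow> ('i \<Rightarrow> real \<Rightarrow> 'a::real_normed_vector) \<Rightarrow> (real \<Rightarrow> 'a) \<Rightarrow> bool" where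
  "Ck_tendsto 0 F f g \<longleftrightarrow> C0_tendsto F f g"
| "Ck_tendsto (Suc k) F f g \<longleftrightarrow> C0_tendsto F f g \<and>
     (\<exists>f' g'. (\<forall>\<^sub>F i in F. has_deriv01 (f i) (f' i)) \<and> has_deriv01 g g' \<and> Ck_tendsto k F f' g')"

lemma has_deriv01D:
  "has_deriv01 f f' \<Longrightarrow> t \<in> {0..1} \<Longrightarrow> S \<subseteq> {0..1} \<Longrightarrow> (f has_vector_derivative f' t) (at t within S)"
  unfolding has_deriv01_def using has_vector_derivative_within_subset by blast

lemma C0_tendstoD:
  assumes "C0_tendsto F f g" "e > 0" shows "\<forall>\<^sub>F i in F. \<forall>t\<in>{0..1}. dist (f i t) (g t) < e"
  using assms uniform_limitD unfolding C0_tendsto_def by blast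

lemma has_deriv01_cong:
  assumes "has_deriv01 f f'" "\<And>t. t \<in> {0..1} \<Longrightarrow> f t = g t" "\<And>t. t \<in> {0..1} \<Longrightarrow> f' t = g' t"
  shows "has_deriv01 g g'"
  unfolding has_deriv01_def
proof
  fix t :: real assume t: "t \<in> {0..1}"
  have "(f has_vector_derivative g' t) (at t within {0..1})"
    using assms t by (auto simp: has_deriv01_def)
  then show "(g has_vector_derivative g' t) (at t within {0..1})"
    by (rule has_vector_derivative_transform[OF t, rotated]) (use assms in auto)
qed

lemma has_deriv01_imp_deriv01:
  assumes "has_deriv01 f f'" "t \<in> {0..1}"
  shows "deriv01 f t = f' t"
  using assms vector_derivative_within_cbox[of 0 1 t f "f' t"]
  by (auto simp: has_deriv01_def deriv01_def)

lemma has_deriv01_differentiable: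
  "has_deriv01 f f' \<Longrightarrow> t \<in> {0..1} \<Longrightarrow> f differentiable (at t within {0..1})"
  unfolding has_deriv01_def by (blast intro: differentiableI_vector)

lemma differentiable_iff_has_deriv01:
  "(\<forall>t\<in>{0..1}. f differentiable (at t within {0..1})) \<longleftrightarrow> has_deriv01 f (deriv01 f)"
  by (auto simp: has_deriv01_def deriv01_def vector_derivative_works[symmetric])

lemma has_deriv01_continuous: "has_deriv01 f f' \<Longrightarrow> continuous_on {0..1} f"
  by (meson has_deriv01_def has_vector_derivative_continuous continuous_on_eq_continuous_within)

lemma has_deriv01_const: "has_deriv01 (\<lambda>t. c) (\<lambda>t. 0)"
  by (simp add: has_deriv01_def)

lemma has_deriv01_add:
  "has_deriv01 f f' \<Longrightarrow> has_deriv01 g g' \<Longrightarrow> has_deriv01 (\<lambda>t. f t + g t) (\<lambda>t. f' t + g' t)"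
  by (auto simp: has_deriv01_def intro!: has_vector_derivative_add)

lemma (in bounded_linear) has_deriv01:
  "has_deriv01 g g' \<Longrightarrow> has_deriv01 (\<lambda>t. f (g t)) (\<lambda>t. f (g' t))"
  by (auto simp: has_deriv01_def intro!: has_vector_derivative)

lemma (in bounded_bilinear) has_deriv01:
  "has_deriv01 f f' \<Longrightarrow> has_deriv01 g g' \<Longrightarrow>
   has_deriv01 (\<lambda>t. prod (f t) (g t)) (\<lambda>t. prod (f t) (g' t) + prod (f' t) (g t))"
  by (auto simp: has_deriv01_def intro!: has_vector_derivative)

lemma C0_tendsto_cong:
  assumes "C0_tendsto F f g" "\<forall>\<^sub>F i in F. \<forall>t\<in>{0..1}. f i t = f2 i t" "\<And>t. t \<in> {0..1} \<Longrightarrow> g t = g2 t"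
  shows "C0_tendsto F f2 g2"
proof -
  have "\<forall>\<^sub>F i in F. continuous_on {0..1} (f2 i)"
    using assms(1)[unfolded C0_tendsto_def, THEN conjunct1] assms(2)
    by eventually_elim (metis continuous_on_cong)
  moreover have "continuous_on {0..1} g2"
    using assms(1,3) by (metis C0_tendsto_def continuous_on_cong)
  moreover have "uniform_limit {0..1} f2 g2 F"
    using uniform_limit_cong[OF assms(2,3)] assms(1) by (simp add: C0_tendsto_def)
  ultimately show ?thesis by (simp add: C0_tendsto_def)
qed

lemma Ck_tendsto_C0: "Ck_tendsto k F f g \<Longrightarrow> C0_tendsto F f g"
  by (cases k) auto

lemma Ck_tendsto_cong:
  assumes "Ck_tendsto k F f g" "\<forall>\<^sub>F i in F. \<forall>t\<in>{0..1}. f i t = f2 i t"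
    and "\<And>t. t \<in> {0..1} \<Longrightarrow> g t = g2 t"
  shows "Ck_tendsto k F f2 g2"
proof (cases k)
  case 0
  then show ?thesis
    using C0_tendsto_cong[OF _ assms(2,3)] assms(1) by simp
next
  case (Suc l)
  with assms(1) obtain f' g' where d: "\<forall>\<^sub>F i in F. has_deriv01 (f i) (f' i)" "has_deriv01 g g'"
    "Ck_tendsto l F f' g'" by auto
  have "\<forall>\<^sub>F i in F. has_deriv01 (f2 i) (f' i)"
    using d(1) assms(2) by eventually_elim (auto intro: has_deriv01_cong)
  moreover have "has_deriv01 g2 g'" using d(2) assms(3) by (auto intro: has_deriv01_cong)
  ultimately show ?thesis
    using d(3) C0_tendsto_cong[OF Ck_tendsto_C0[OF assms(1)] assms(2,3)] Suc by auto
qed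

lemma Ck_tendsto_Suc_mono: "Ck_tendsto (Suc k) F f g \<Longrightarrow> Ck_tendsto k F f g"
proof (induction k arbitrary: f g)
  case (Suc k)
  obtain f' g' where d: "C0_tendsto F f g" "\<forall>\<^sub>F i in F. has_deriv01 (f i) (f' i)"
    "has_deriv01 g g'" "Ck_tendsto (Suc k) F f' g'"
    using Suc.prems by (subst (asm) Ck_tendsto.simps(2)) blast
  show ?case
    unfolding Ck_tendsto.simps(2) using d Suc.IH[OF d(4)] by blast
qed simp

lemma Ck_tendsto_mono: "Ck_tendsto m F f g \<Longrightarrow> k \<le> m \<Longrightarrow> Ck_tendsto k F f g"
  by (induction m) (auto simp: le_Suc_eq simp del: Ck_tendsto.simps dest: Ck_tendsto_Suc_mono)

lemma C0_tendsto_I: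
  assumes "\<forall>\<^sub>F i in F. has_deriv01 (f i) (f' i)" "has_deriv01 g g'" "uniform_limit {0..1} f g F"
  shows "C0_tendsto F f g"
  using assms by (auto simp: C0_tendsto_def has_deriv01_continuous elim!: eventually_mono)

definition Ck :: "nat \<Rightarrow> (real \<Rightarrow> 'a::real_normed_vector) \<Rightarrow> bool" where
  "Ck k f \<longleftrightarrow> (\<forall>j<k. \<forall>t\<in>{0..1}. (deriv01 ^^ j) f differentiable (at t within {0..1})) \<and>
     continuous_on {0..1} ((deriv01 ^^ k) f)"

lemma Ck_Suc: "Ck (Suc k) f \<longleftrightarrow> has_deriv01 f (deriv01 f) \<and> Ck k (deriv01 f)"
  unfolding Ck_def differentiable_iff_has_deriv01
  by (auto simp: less_Suc_eq_0_disj funpow_swap1 simp del: funpow.simps(2)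
      simp flip: funpow_swap1 simp: funpow_Suc_right)

lemma all_le_Suc: "(\<forall>j\<le>Suc k. P j) \<longleftrightarrow> P 0 \<and> (\<forall>j\<le>k. P (Suc j))"
  by (metis Suc_le_mono le0 not0_implies_Suc)

text \<open>The link to the distance on curves, which is a sum of suprema of iterated derivatives: a
  derivative on \<open>[0,1]\<close> is unique, so the functions chosen in the recursion agree there with
  \<open>deriv01\<close>.\<close>

lemma Ck_tendsto_iff:
  "Ck_tendsto k F f g \<longleftrightarrow> (\<forall>\<^sub>F i in F. Ck k (f i)) \<and> Ck k g \<and>
     (\<forall>j\<le>k. uniform_limit {0..1} (\<lambda>i. (deriv01 ^^ j) (f i)) ((deriv01 ^^ j) g) F)"
proof (induction k arbitrary: f g)
  case 0
  then show ?case by (simp add: C0_tendsto_def Ck_def)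
next
  case (Suc k)
  have 1: "(\<exists>f' g'. (\<forall>\<^sub>F i in F. has_deriv01 (f i) (f' i)) \<and> has_deriv01 g g' \<and> Ck_tendsto k F f' g')
    \<longleftrightarrow> (\<forall>\<^sub>F i in F. has_deriv01 (f i) (deriv01 (f i))) \<and> has_deriv01 g (deriv01 g) \<and>
        Ck_tendsto k F (\<lambda>i. deriv01 (f i)) (deriv01 g)" (is "?L \<longleftrightarrow> ?R")
  proof
    assume ?L
    then obtain f' g' where d: "\<forall>\<^sub>F i in F. has_deriv01 (f i) (f' i)" "has_deriv01 g g'"
      "Ck_tendsto k F f' g'" by auto
    have "\<forall>\<^sub>F i in F. has_deriv01 (f i) (deriv01 (f i))"
      using d(1) by eventually_elim (metis differentiable_iff_has_deriv01 has_deriv01_differentiable)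
    moreover have "has_deriv01 g (deriv01 g)"
      using d(2) by (metis differentiable_iff_has_deriv01 has_deriv01_differentiable)
    moreover have "Ck_tendsto k F (\<lambda>i. deriv01 (f i)) (deriv01 g)"
      using d by (intro Ck_tendsto_cong[OF d(3)])
        (auto simp: has_deriv01_imp_deriv01 elim!: eventually_mono)
    ultimately show ?R by blast
  qed (intro exI)
  show ?case
    unfolding Ck_tendsto.simps 1 unfolding Suc Ck_Suc all_le_Suc C0_tendsto_def eventually_conj_iff
    by (auto simp: funpow_Suc_right has_deriv01_continuous simp del: funpow.simps(2) elim!: eventually_mono)
qed

lemma Ck_iff_tendsto: "Ck k f \<longleftrightarrow> Ck_tendsto k (top :: unit filter) (\<lambda>_. f) f"
  unfolding Ck_tendsto_iff by (auto intro: uniform_limit_const)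

lemma Ck_tendsto_limit: "Ck_tendsto k F f g \<Longrightarrow> Ck k g"
  by (simp add: Ck_tendsto_iff)

lemma Ck_tendsto_const_family: "Ck k f \<Longrightarrow> Ck_tendsto k F (\<lambda>_. f) f"
  unfolding Ck_tendsto_iff by (auto intro: uniform_limit_const)

lemma Ck_mono: "Ck m f \<Longrightarrow> k \<le> m \<Longrightarrow> Ck k f"
  unfolding Ck_iff_tendsto by (rule Ck_tendsto_mono)

lemma Ck_continuous: "Ck k f \<Longrightarrow> continuous_on {0..1} f"
  using Ck_tendsto_C0[of k] unfolding Ck_iff_tendsto C0_tendsto_def by blast

lemma Ck_has_deriv01: "Ck (Suc k) f \<Longrightarrow> has_deriv01 f (deriv01 f)"
  by (simp add: Ck_Suc)

lemma Ck_tendsto_deriv01: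
  "Ck_tendsto (Suc k) F f g \<Longrightarrow> Ck_tendsto k F (\<lambda>i. deriv01 (f i)) (deriv01 g)"
  unfolding Ck_tendsto_iff all_le_Suc Ck_Suc
  by (auto simp: funpow_Suc_right simp del: funpow.simps(2) elim!: eventually_mono)

lemma Ck_tendsto_SucI:
  assumes "\<forall>\<^sub>F i in F. has_deriv01 (f i) (f' i)" "has_deriv01 g g'" "Ck_tendsto k F f' g'"
    "uniform_limit {0..1} f g F"
  shows "Ck_tendsto (Suc k) F f g"
  using assms C0_tendsto_I by auto

lemma compact_image_bounded: "continuous_on {0..1::real} f \<Longrightarrow> bounded (f ` {0..1})"
  by (intro compact_imp_bounded compact_continuous_image) auto

lemma Ck_tendsto_const:
  assumes "(c \<longlongrightarrow> c0) F"
  shows "Ck_tendsto k F (\<lambda>i t. c i) (\<lambda>t. c0)"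
proof -
  have u: "uniform_limit {0..1::real} (\<lambda>i t. c i) (\<lambda>t. c0) F"
    using assms by (auto simp: uniform_limit_iff tendsto_iff elim: eventually_mono)
  have z: "Ck_tendsto k F (\<lambda>i t. 0::'b) (\<lambda>t. 0)" for k
  proof (induction k)
    case (Suc k)
    then show ?case
      using Ck_tendsto_SucI[of "\<lambda>i t. 0::'b" "\<lambda>i t. 0" F "\<lambda>t. 0" "\<lambda>t. 0" k]
      by (simp add: has_deriv01_const uniform_limit_const)
  qed (simp add: C0_tendsto_def uniform_limit_const)
  show ?thesis
  proof (cases k)
    case (Suc l)
    then show ?thesis
      using Ck_tendsto_SucI[of "\<lambda>i t. c i" "\<lambda>i t. 0" F "\<lambda>t. c0" "\<lambda>t. 0" l] u z[of l]
      by (simp add: has_deriv01_const)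
  qed (simp add: C0_tendsto_def u)
qed

lemma Ck_tendsto_add:
  assumes "Ck_tendsto k F f f0" "Ck_tendsto k F g g0"
  shows "Ck_tendsto k F (\<lambda>i t. f i t + g i t) (\<lambda>t. f0 t + g0 t)"
  using assms
proof (induction k arbitrary: f f0 g g0)
  case 0
  then show ?case
    by (auto simp: C0_tendsto_def intro: uniform_limit_add continuous_on_add elim: eventually_elim2)
next
  case (Suc k)
  obtain f' f0' where f: "\<forall>\<^sub>F i in F. has_deriv01 (f i) (f' i)" "has_deriv01 f0 f0'"
    "Ck_tendsto k F f' f0'" using Suc.prems(1) by auto
  obtain g' g0' where g: "\<forall>\<^sub>F i in F. has_deriv01 (g i) (g' i)" "has_deriv01 g0 g0'"
    "Ck_tendsto k F g' g0'" using Suc.prems(2) by auto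
  show ?case
  proof (rule Ck_tendsto_SucI[OF _ _ Suc.IH[OF f(3) g(3)]])
    show "\<forall>\<^sub>F i in F. has_deriv01 (\<lambda>t. f i t + g i t) (\<lambda>t. f' i t + g' i t)"
      using f(1) g(1) by eventually_elim (rule has_deriv01_add)
    show "uniform_limit {0..1} (\<lambda>i t. f i t + g i t) (\<lambda>t. f0 t + g0 t) F"
      using Suc.prems by (auto simp: C0_tendsto_def intro: uniform_limit_add)
  qed (rule has_deriv01_add[OF f(2) g(2)])
qed

lemma (in bounded_linear) Ck_tendsto:
  assumes "Ck_tendsto k F g g0"
  shows "Ck_tendsto k F (\<lambda>i t. f (g i t)) (\<lambda>t. f (g0 t))"
  using assms
proof (induction k arbitrary: g g0)
  case 0
  then show ?case
    by (auto simp: C0_tendsto_def intro!: uniform_limit continuous_on elim!: eventually_mono)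
next
  case (Suc k)
  obtain g' g0' where g: "\<forall>\<^sub>F i in F. has_deriv01 (g i) (g' i)" "has_deriv01 g0 g0'"
    "Ck_tendsto k F g' g0'" using Suc.prems by auto
  show ?case
  proof (rule Ck_tendsto_SucI[OF _ _ Suc.IH[OF g(3)]])
    show "\<forall>\<^sub>F i in F. has_deriv01 (\<lambda>t. f (g i t)) (\<lambda>t. f (g' i t))"
      using g(1) by eventually_elim (rule has_deriv01)
    show "uniform_limit {0..1} (\<lambda>i t. f (g i t)) (\<lambda>t. f (g0 t)) F"
      using Suc.prems by (auto simp: C0_tendsto_def intro: uniform_limit)
  qed (rule has_deriv01[OF g(2)])
qed

lemma (in bounded_bilinear) Ck_tendsto:
  assumes "Ck_tendsto k F f f0" "Ck_tendsto k F g g0"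
  shows "Ck_tendsto k F (\<lambda>i t. prod (f i t) (g i t)) (\<lambda>t. prod (f0 t) (g0 t))"
  using assms
proof (induction k arbitrary: f f0 g g0)
  case 0
  then show ?case
    by (auto simp: C0_tendsto_def intro!: bounded_uniform_limit continuous_on compact_image_bounded
        elim: eventually_elim2)
next
  case (Suc k)
  obtain f' f0' where f: "\<forall>\<^sub>F i in F. has_deriv01 (f i) (f' i)" "has_deriv01 f0 f0'"
    "Ck_tendsto k F f' f0'" using Suc.prems(1) by auto
  obtain g' g0' where g: "\<forall>\<^sub>F i in F. has_deriv01 (g i) (g' i)" "has_deriv01 g0 g0'"
    "Ck_tendsto k F g' g0'" using Suc.prems(2) by auto
  show ?case
  proof (rule Ck_tendsto_SucI)
    show "\<forall>\<^sub>F i in F. has_deriv01 (\<lambda>t. prod (f i t) (g i t))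
        (\<lambda>t. prod (f i t) (g' i t) + prod (f' i t) (g i t))"
      using f(1) g(1) by eventually_elim (rule has_deriv01)
    show "Ck_tendsto k F (\<lambda>i t. prod (f i t) (g' i t) + prod (f' i t) (g i t))
        (\<lambda>t. prod (f0 t) (g0' t) + prod (f0' t) (g0 t))"
      by (intro Ck_tendsto_add Suc.IH Ck_tendsto_Suc_mono[OF Suc.prems(1)]
          Ck_tendsto_Suc_mono[OF Suc.prems(2)] f(3) g(3))
    show "uniform_limit {0..1} (\<lambda>i t. prod (f i t) (g i t)) (\<lambda>t. prod (f0 t) (g0 t)) F"
      using Suc.prems by (auto simp: C0_tendsto_def intro!: bounded_uniform_limit compact_image_bounded)
  qed (rule has_deriv01[OF f(2) g(2)])
qed

lemmas Ck_tendsto_mult = bounded_bilinear.Ck_tendsto[OF bounded_bilinear_mult]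
lemmas Ck_tendsto_scaleR = bounded_bilinear.Ck_tendsto[OF bounded_bilinear_scaleR]
lemmas Ck_tendsto_Re = bounded_linear.Ck_tendsto[OF bounded_linear_Re]
lemmas Ck_tendsto_Im = bounded_linear.Ck_tendsto[OF bounded_linear_Im]
lemmas Ck_tendsto_of_real = bounded_linear.Ck_tendsto[OF bounded_linear_of_real]
lemmas Ck_tendsto_minus = bounded_linear.Ck_tendsto[OF bounded_linear_minus[OF bounded_linear_ident]]

lemma Ck_tendsto_diff:
  assumes "Ck_tendsto k F f f0" "Ck_tendsto k F g g0"
  shows "Ck_tendsto k F (\<lambda>i t. f i t - g i t) (\<lambda>t. f0 t - g0 t)"
  using Ck_tendsto_add[OF assms(1) Ck_tendsto_minus[OF assms(2)]] by simp

lemma continuous_bounded_below: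
  fixes g :: "real \<Rightarrow> real"
  assumes "continuous_on {0..1} g" "\<And>t. t \<in> {0..1} \<Longrightarrow> g t > 0"
  obtains b where "b > 0" "\<And>t. t \<in> {0..1} \<Longrightarrow> b \<le> g t"
proof -
  obtain x where "x \<in> {0..1}" "\<forall>y\<in>{0..1}. g x \<le> g y"
    using continuous_attains_inf[OF compact_Icc[of 0 1] _ assms(1)] by auto
  then show ?thesis using that[of "g x"] assms(2) by blast
qed

lemma C0_tendsto_eventually_pos:
  fixes f :: "'i \<Rightarrow> real \<Rightarrow> real"
  assumes "C0_tendsto F f g" "\<And>t. t \<in> {0..1} \<Longrightarrow> g t > 0"
  shows "\<forall>\<^sub>F i in F. \<forall>t\<in>{0..1}. f i t > 0"
proof -
  obtain b where b: "b > 0" "\<And>t. t \<in> {0..1} \<Longrightarrow> b \<le> g t"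
    using continuous_bounded_below[of g] assms by (auto simp: C0_tendsto_def)
  have "\<forall>\<^sub>F i in F. \<forall>t\<in>{0..1}. dist (f i t) (g t) < b"
    using assms b by (auto simp: C0_tendsto_def uniform_limit_iff)
  then show ?thesis
    by eventually_elim (use b in \<open>force simp: dist_real_def\<close>)
qed

lemma C0_tendsto_norm:
  assumes "C0_tendsto F f g" shows "C0_tendsto F (\<lambda>i t. norm (f i t)) (\<lambda>t. norm (g t))"
  using assms
  by (auto simp: C0_tendsto_def intro!: uniform_limit_norm continuous_on_norm elim!: eventually_mono)

lemma has_deriv01_inverse:
  fixes f :: "real \<Rightarrow> 'a::real_normed_field"
  assumes "has_deriv01 f f'" "\<And>t. t \<in> {0..1} \<Longrightarrow> f t \<noteq> 0"
  shows "has_deriv01 (\<lambda>t. inverse (f t)) (\<lambda>t. - (f' t * (inverse (f t) * inverse (f t))))"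
  using assms unfolding has_deriv01_def has_vector_derivative_def
  by (auto intro!: derivative_eq_intros simp: fun_eq_iff mult_ac scaleR_conv_of_real)

lemma Ck_tendsto_inverse:
  fixes f :: "'i \<Rightarrow> real \<Rightarrow> 'a::real_normed_field"
  assumes "Ck_tendsto k F f g" and nz: "\<And>t. t \<in> {0..1} \<Longrightarrow> g t \<noteq> 0"
  shows "Ck_tendsto k F (\<lambda>i t. inverse (f i t)) (\<lambda>t. inverse (g t))"
proof -
  have C0: "C0_tendsto F f g" using assms Ck_tendsto_C0 by blast
  have ev: "\<forall>\<^sub>F i in F. \<forall>t\<in>{0..1}. f i t \<noteq> 0"
    using C0_tendsto_eventually_pos[OF C0_tendsto_norm[OF C0]] nz by auto
  have "continuous_on {0..1} (\<lambda>t. norm (g t))"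
    using C0 by (auto simp: C0_tendsto_def intro: continuous_on_norm)
  then obtain b where b: "b > 0" "\<And>t. t \<in> {0..1} \<Longrightarrow> b \<le> norm (g t)"
    using continuous_bounded_below[of "\<lambda>t. norm (g t)"] nz by auto
  have ul: "uniform_limit {0..1} (\<lambda>i t. inverse (f i t)) (\<lambda>t. inverse (g t)) F"
    using uniform_lim_inverse[where S="{0..1}" and f=f and l=g and F=F and b=b] C0 b by (auto simp: C0_tendsto_def o_def)
  have co: "\<forall>\<^sub>F i in F. continuous_on {0..1} (\<lambda>t. inverse (f i t))"
    using ev C0[unfolded C0_tendsto_def, THEN conjunct1]
    by eventually_elim (auto intro: continuous_on_inverse)
  have cg: "continuous_on {0..1} (\<lambda>t. inverse (g t))"
    using C0 nz by (auto simp: C0_tendsto_def intro: continuous_on_inverse)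
  show ?thesis using assms(1)
  proof (induction k)
    case 0
    then show ?case using ul co cg by (simp add: C0_tendsto_def)
  next
    case (Suc k)
    obtain f' g' where f: "\<forall>\<^sub>F i in F. has_deriv01 (f i) (f' i)" "has_deriv01 g g'"
      "Ck_tendsto k F f' g'" using Suc.prems(1) by auto
    show ?case
    proof (rule Ck_tendsto_SucI[OF _ _ _ ul])
      show "\<forall>\<^sub>F i in F. has_deriv01 (\<lambda>t. inverse (f i t)) (\<lambda>t. - (f' i t * (inverse (f i t) * inverse (f i t))))"
        using f(1) ev by eventually_elim (auto intro: has_deriv01_inverse)
      show "has_deriv01 (\<lambda>t. inverse (g t)) (\<lambda>t. - (g' t * (inverse (g t) * inverse (g t))))"
        using f(2) nz by (auto intro: has_deriv01_inverse)
      show "Ck_tendsto k F (\<lambda>i t. - (f' i t * (inverse (f i t) * inverse (f i t))))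
          (\<lambda>t. - (g' t * (inverse (g t) * inverse (g t))))"
        by (intro Ck_tendsto_minus Ck_tendsto_mult f(3) Suc.IH Ck_tendsto_Suc_mono[OF Suc.prems])
    qed
  qed
qed

lemma Ck_tendsto_divide:
  fixes f :: "'i \<Rightarrow> real \<Rightarrow> 'a::real_normed_field"
  assumes "Ck_tendsto k F h h0" "Ck_tendsto k F f g" "\<And>t. t \<in> {0..1} \<Longrightarrow> g t \<noteq> 0"
  shows "Ck_tendsto k F (\<lambda>i t. h i t / f i t) (\<lambda>t. h0 t / g t)"
  unfolding divide_inverse by (intro Ck_tendsto_mult Ck_tendsto_inverse assms)

lemma has_deriv01_sqrt:
  assumes "has_deriv01 f f'" "\<And>t. t \<in> {0..1} \<Longrightarrow> f t > 0"
  shows "has_deriv01 (\<lambda>t. sqrt (f t)) (\<lambda>t. f' t / (2 * sqrt (f t)))"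
  unfolding has_deriv01_def has_real_derivative_iff_has_vector_derivative[symmetric]
proof
  fix t :: real assume t: "t \<in> {0..1}"
  have "(f has_real_derivative f' t) (at t within {0..1})"
    using assms(1) t by (auto simp: has_deriv01_def has_real_derivative_iff_has_vector_derivative)
  then show "((\<lambda>t. sqrt (f t)) has_real_derivative f' t / (2 * sqrt (f t))) (at t within {0..1})"
    using assms(2)[OF t] by (auto intro!: derivative_eq_intros simp: field_simps)
qed

lemma Ck_tendsto_sqrt:
  fixes f :: "'i \<Rightarrow> real \<Rightarrow> real"
  assumes "Ck_tendsto k F f g" and nz: "\<And>t. t \<in> {0..1} \<Longrightarrow> g t > 0"
  shows "Ck_tendsto k F (\<lambda>i t. sqrt (f i t)) (\<lambda>t. sqrt (g t))"
proof -
  have C0: "C0_tendsto F f g" using assms Ck_tendsto_C0 by blast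
  have ev: "\<forall>\<^sub>F i in F. \<forall>t\<in>{0..1}. f i t > 0"
    using C0_tendsto_eventually_pos[OF C0] nz by auto
  have ul: "uniform_limit {0..1} (\<lambda>i t. sqrt (f i t)) (\<lambda>t. sqrt (g t)) F"
  proof (rule uniform_limitI)
    fix e :: real assume e: "e > 0"
    have "\<forall>\<^sub>F i in F. \<forall>t\<in>{0..1}. dist (f i t) (g t) < e^2"
      using C0 e by (auto simp: C0_tendsto_def uniform_limit_iff)
    then show "\<forall>\<^sub>F i in F. \<forall>t\<in>{0..1}. dist (sqrt (f i t)) (sqrt (g t)) < e"
      using ev
    proof eventually_elim
      case (elim i)
      show ?case
      proof
        fix t :: real assume t: "t \<in> {0..1}"
        have *: "\<bar>sqrt a - sqrt b\<bar>^2 \<le> \<bar>a - b\<bar>" if "a > 0" "b > 0" for a b :: real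
        proof -
          have "\<bar>sqrt a - sqrt b\<bar>^2 \<le> \<bar>sqrt a - sqrt b\<bar> * (sqrt a + sqrt b)"
            unfolding power2_eq_square using that
            by (intro mult_left_mono) (auto simp: abs_le_iff add_increasing2)
          also have "\<dots> = \<bar>(sqrt a - sqrt b) * (sqrt a + sqrt b)\<bar>"
            using that by (simp add: abs_mult)
          also have "(sqrt a - sqrt b) * (sqrt a + sqrt b) = a - b"
            using that by (simp add: algebra_simps)
          finally show ?thesis .
        qed
        have "\<bar>sqrt (f i t) - sqrt (g t)\<bar>^2 < e^2"
          using *[of "f i t" "g t"] elim t nz[OF t] by (fastforce simp: dist_real_def)
        then show "dist (sqrt (f i t)) (sqrt (g t)) < e"
          using e by (simp add: dist_real_def power2_less_imp_less)
      qed
    qed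
  qed
  have co: "\<forall>\<^sub>F i in F. continuous_on {0..1} (\<lambda>t. sqrt (f i t))"
    using C0[unfolded C0_tendsto_def, THEN conjunct1]
    by eventually_elim (auto intro: continuous_intros)
  have cg: "continuous_on {0..1} (\<lambda>t. sqrt (g t))"
    using C0 by (auto simp: C0_tendsto_def intro: continuous_intros)
  show ?thesis using assms(1)
  proof (induction k)
    case 0
    then show ?case using ul co cg by (simp add: C0_tendsto_def)
  next
    case (Suc k)
    obtain f' g' where f: "\<forall>\<^sub>F i in F. has_deriv01 (f i) (f' i)" "has_deriv01 g g'"
      "Ck_tendsto k F f' g'" using Suc.prems(1) by auto
    show ?case
    proof (rule Ck_tendsto_SucI[OF _ _ _ ul])
      show "\<forall>\<^sub>F i in F. has_deriv01 (\<lambda>t. sqrt (f i t)) (\<lambda>t. f' i t / (2 * sqrt (f i t)))"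
        using f(1) ev by eventually_elim (auto intro: has_deriv01_sqrt)
      show "has_deriv01 (\<lambda>t. sqrt (g t)) (\<lambda>t. g' t / (2 * sqrt (g t)))"
        using f(2) nz by (auto intro: has_deriv01_sqrt)
      show "Ck_tendsto k F (\<lambda>i t. f' i t / (2 * sqrt (f i t))) (\<lambda>t. g' t / (2 * sqrt (g t)))"
        using nz by (intro Ck_tendsto_divide Ck_tendsto_mult f(3) Suc.IH Ck_tendsto_Suc_mono[OF Suc.prems]
            Ck_tendsto_const tendsto_const) force
    qed
  qed
qed

lemma Ck_tendsto_cmod:
  assumes "Ck_tendsto k F f g" and nz: "\<And>t. t \<in> {0..1} \<Longrightarrow> g t \<noteq> 0"
  shows "Ck_tendsto k F (\<lambda>i t. cmod (f i t)) (\<lambda>t. cmod (g t))"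
  unfolding cmod_def power2_eq_square
  by (intro Ck_tendsto_sqrt Ck_tendsto_add Ck_tendsto_mult Ck_tendsto_Re Ck_tendsto_Im assms(1))
    (metis nz complex_neq_0 power2_eq_square)

lemma Ck_tendsto_ident: "Ck_tendsto k F (\<lambda>i t. t) (\<lambda>t. t)"
proof -
  have "has_deriv01 (\<lambda>t. t) (\<lambda>t. 1)" by (simp add: has_deriv01_def)
  then show ?thesis
    by (cases k) (auto simp: C0_tendsto_def intro!: uniform_limit_const
        exI[where x="\<lambda>_ _. 1"] exI[where x="\<lambda>_. 1"] Ck_tendsto_const)
qed

section \<open>Primitives and reparametrisation\<close>

lemma has_deriv01_integral:
  fixes f :: "real \<Rightarrow> 'a::banach"
  shows "continuous_on {0..1} f \<Longrightarrow> has_deriv01 (\<lambda>t. integral {0..t} f) f"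
  by (simp add: has_deriv01_def integral_has_vector_derivative)

lemma integrable_01:
  fixes f :: "real \<Rightarrow> 'a::banach"
  assumes "continuous_on {0..1} f" "t \<in> {0..1}"
  shows "f integrable_on {0..t}"
  by (rule integrable_continuous_real[OF continuous_on_subset[OF assms(1)]]) (use assms in auto)

lemma uniform_limit_integral01:
  fixes f :: "'i \<Rightarrow> real \<Rightarrow> 'a::banach"
  assumes "C0_tendsto F f g"
  shows "uniform_limit {0..1} (\<lambda>i t. integral {0..t} (f i)) (\<lambda>t. integral {0..t} g) F"
proof (rule uniform_limitI)
  fix e :: real assume e: "e > 0"
  have g: "continuous_on {0..1} g" using assms by (simp add: C0_tendsto_def)
  have "\<forall>\<^sub>F i in F. \<forall>t\<in>{0..1}. dist (f i t) (g t) < e/2"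
    using C0_tendstoD[OF assms, of "e/2"] e by simp
  moreover have "\<forall>\<^sub>F i in F. continuous_on {0..1} (f i)"
    using assms by (simp add: C0_tendsto_def)
  ultimately show "\<forall>\<^sub>F i in F. \<forall>t\<in>{0..1}. dist (integral {0..t} (f i)) (integral {0..t} g) < e"
  proof eventually_elim
    case (elim i)
    show ?case
    proof
      fix t :: real assume t: "t \<in> {0..1}"
      have "integral {0..t} (f i) - integral {0..t} g = integral {0..t} (\<lambda>x. f i x - g x)"
        by (rule integral_diff[symmetric]) (auto intro!: integrable_01 t elim g)
      also have "norm \<dots> \<le> e/2 * (t - 0)"
      proof (rule integral_bound)
        show "continuous_on {0..t} (\<lambda>x. f i x - g x)"
          by (rule continuous_on_subset[OF continuous_on_diff[OF elim(2) g]]) (use t in auto)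
        show "\<And>x. x \<in> {0..t} \<Longrightarrow> norm (f i x - g x) \<le> e/2"
          using elim(1) t by (auto simp: dist_norm intro!: less_imp_le)
      qed (use t in auto)
      also have "\<dots> < e" using t e mult_left_le[of t "e/2"] by (auto simp: mult.commute)
      finally show "dist (integral {0..t} (f i)) (integral {0..t} g) < e" by (simp add: dist_norm)
    qed
  qed
qed

lemma Ck_tendsto_integral:
  fixes f :: "'i \<Rightarrow> real \<Rightarrow> 'a::banach"
  assumes "Ck_tendsto k F f g"
  shows "Ck_tendsto (Suc k) F (\<lambda>i t. integral {0..t} (f i)) (\<lambda>t. integral {0..t} g)"
proof (rule Ck_tendsto_SucI[OF _ _ assms])
  have C0: "C0_tendsto F f g" using assms Ck_tendsto_C0 by blast
  show "\<forall>\<^sub>F i in F. has_deriv01 (\<lambda>t. integral {0..t} (f i)) (f i)"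
    using C0 by (auto simp: C0_tendsto_def has_deriv01_integral elim!: eventually_mono)
  show "has_deriv01 (\<lambda>t. integral {0..t} g) g"
    using C0 by (auto simp: C0_tendsto_def has_deriv01_integral)
  show "uniform_limit {0..1} (\<lambda>i t. integral {0..t} (f i)) (\<lambda>t. integral {0..t} g) F"
    by (rule uniform_limit_integral01[OF C0])
qed

lemma C0_tendsto_at:
  assumes "C0_tendsto F f g" "t \<in> {0..1}"
  shows "((\<lambda>i. f i t) \<longlongrightarrow> g t) F"
  by (rule tendsto_uniform_limitI[OF _ assms(2)]) (use assms(1) in \<open>simp add: C0_tendsto_def\<close>)

lemma has_deriv01_unique:
  fixes f g :: "real \<Rightarrow> 'a::banach"
  assumes "has_deriv01 f h" "has_deriv01 g h" "f 0 = g 0" "t \<in> {0..1}"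
  shows "f t = g t"
proof -
  have "((\<lambda>x. f x - g x) has_vector_derivative 0) (at x within {0..1})" if "x \<in> {0..1}" for x
    using has_vector_derivative_diff[of f "h x" "at x within {0..1}" g "h x"] assms(1,2) that
    by (auto simp: has_deriv01_def)
  then obtain c where "\<And>x. x \<in> {0..1} \<Longrightarrow> f x - g x = c"
    using has_vector_derivative_zero_constant[of "{0..1}" "\<lambda>x. f x - g x"] by auto
  from this[of 0] this[of t] assms(3,4) show ?thesis by simp
qed

lemma has_deriv01_has_integral:
  fixes f :: "real \<Rightarrow> 'a::banach"
  assumes "has_deriv01 f f'" "t \<in> {0..1}"
  shows "(f' has_integral (f t - f 0)) {0..t}"
  by (rule fundamental_theorem_of_calculus)
    (use assms in \<open>auto intro!: has_deriv01D[OF assms(1)]\<close>)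

definition diffeo01 :: "(real \<Rightarrow> real) \<Rightarrow> bool" where
  "diffeo01 T \<longleftrightarrow> T 0 = 0 \<and> T 1 = 1 \<and> (\<exists>T'. has_deriv01 T T' \<and> (\<forall>t\<in>{0..1}. T' t > 0))"

definition inv01 :: "(real \<Rightarrow> real) \<Rightarrow> real \<Rightarrow> real" where
  "inv01 T = inv_into {0..1} T"

lemma has_deriv01_pos_strict_mono:
  assumes "has_deriv01 T T'" "\<forall>t\<in>{0..1}. T' t > 0" "0 \<le> s" "s < t" "t \<le> 1"
  shows "T s < (T t :: real)"
proof (rule DERIV_pos_imp_increasing_open[OF assms(4)])
  fix x assume x: "s < x" "x < t"
  then have "(T has_vector_derivative T' x) (at x within {0..1})"
    using assms by (auto simp: has_deriv01_def)
  then have "(T has_real_derivative T' x) (at x)"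
    using x assms by (simp add: has_real_derivative_iff_has_vector_derivative at_within_Icc_at)
  then show "\<exists>y. DERIV T x :> y \<and> 0 < y" using assms x by force
next
  show "continuous_on {s..t} T"
    using has_deriv01_continuous[OF assms(1)] by (rule continuous_on_subset) (use assms in auto)
qed

lemma diffeo01_strict_mono:
  assumes "diffeo01 T" "0 \<le> s" "s < t" "t \<le> 1" shows "T s < T t"
  using assms has_deriv01_pos_strict_mono by (auto simp: diffeo01_def)

lemma diffeo01_mono:
  assumes "diffeo01 T" "0 \<le> s" "s \<le> t" "t \<le> 1" shows "T s \<le> T t"
  using assms diffeo01_strict_mono[of T s t] by (cases "s = t") auto

lemma diffeo01_continuous: "diffeo01 T \<Longrightarrow> continuous_on {0..1} T"
  using has_deriv01_continuous by (auto simp: diffeo01_def)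

lemma diffeo01_in: "diffeo01 T \<Longrightarrow> t \<in> {0..1} \<Longrightarrow> T t \<in> {0..1}"
  using diffeo01_mono[of T 0 t] diffeo01_mono[of T t 1] by (auto simp: diffeo01_def)

lemma diffeo01_inj: "diffeo01 T \<Longrightarrow> inj_on T {0..1}"
  by (rule inj_onI) (metis atLeastAtMost_iff diffeo01_strict_mono less_irrefl linorder_neqE)

lemma diffeo01_image: assumes "diffeo01 T" shows "T ` {0..1} = {0..1}"
proof
  show "T ` {0..1} \<subseteq> {0..1}" using diffeo01_in[OF assms] by auto
  show "{0..1} \<subseteq> T ` {0..1}"
  proof
    fix y :: real assume "y \<in> {0..1}"
    then show "y \<in> T ` {0..1}"
      using IVT'[of T 0 y 1] assms diffeo01_continuous[OF assms] by (force simp: diffeo01_def)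
  qed
qed

lemma inv01_in: "diffeo01 T \<Longrightarrow> t \<in> {0..1} \<Longrightarrow> inv01 T t \<in> {0..1}"
  unfolding inv01_def by (metis diffeo01_image inv_into_into)

lemma inv01_right: "diffeo01 T \<Longrightarrow> t \<in> {0..1} \<Longrightarrow> T (inv01 T t) = t"
  unfolding inv01_def by (metis diffeo01_image f_inv_into_f)

lemma inv01_left: "diffeo01 T \<Longrightarrow> t \<in> {0..1} \<Longrightarrow> inv01 T (T t) = t"
  unfolding inv01_def by (simp add: diffeo01_inj)

lemma inv01_0: "diffeo01 T \<Longrightarrow> inv01 T 0 = 0" and inv01_1: "diffeo01 T \<Longrightarrow> inv01 T 1 = 1"
  using inv01_left[of T 0] inv01_left[of T 1] by (auto simp: diffeo01_def)

lemma inv01_continuous: assumes "diffeo01 T" shows "continuous_on {0..1} (inv01 T)"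
  using continuous_on_inv[of "{0..1}" T "inv01 T"] inv01_left[OF assms] diffeo01_continuous[OF assms]
  by (simp add: diffeo01_image[OF assms])

lemma has_deriv01_inv01:
  assumes T: "diffeo01 T" "has_deriv01 T T'" and pos: "\<And>t. t \<in> {0..1} \<Longrightarrow> T' t > 0"
  shows "has_deriv01 (inv01 T) (\<lambda>t. inverse (T' (inv01 T t)))"
  unfolding has_deriv01_def has_real_derivative_iff_has_vector_derivative[symmetric]
proof
  fix y :: real assume y: "y \<in> {0..1}"
  define x where "x = inv01 T y"
  have x: "x \<in> {0..1}" "T x = y" using y inv01_in[OF T(1)] inv01_right[OF T(1)] by (auto simp: x_def)
  have "(T has_real_derivative T' x) (at x within {0..1})"
    using T(2) x by (auto simp: has_deriv01_def has_real_derivative_iff_has_vector_derivative)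
  then have 1: "((\<lambda>z. (T z - T x) / (z - x)) \<longlongrightarrow> T' x) (at x within {0..1})"
    by (simp add: has_field_derivative_iff)
  have 2: "filterlim (inv01 T) (at x within {0..1}) (at y within {0..1})"
    unfolding filterlim_at
  proof
    show "\<forall>\<^sub>F z in at y within {0..1}. inv01 T z \<in> {0..1} \<and> inv01 T z \<noteq> x"
      unfolding eventually_at_filter
    proof (intro always_eventually allI impI conjI)
      fix z assume z: "z \<noteq> y" "z \<in> {0..1}"
      show "inv01 T z \<in> {0..1}" by (rule inv01_in[OF T(1) z(2)])
      show "inv01 T z \<noteq> x" using inv01_right[OF T(1) z(2)] x(2) z(1) by metis
    qed
    show "(inv01 T \<longlongrightarrow> x) (at y within {0..1})"
      using inv01_continuous[OF T(1)] y by (simp add: continuous_on_def x_def)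
  qed
  have 3: "((\<lambda>z. inverse ((T (inv01 T z) - T x) / (inv01 T z - x))) \<longlongrightarrow> inverse (T' x)) (at y within {0..1})"
    using pos[OF x(1)] by (intro tendsto_inverse filterlim_compose[OF 1 2]) auto
  have "((\<lambda>z. (inv01 T z - inv01 T y) / (z - y)) \<longlongrightarrow> inverse (T' x)) (at y within {0..1})"
    by (rule Lim_transform_eventually[OF 3])
      (auto simp: eventually_at_filter inv01_right[OF T(1)] x x_def[symmetric] intro!: always_eventually)
  then show "(inv01 T has_real_derivative inverse (T' (inv01 T y))) (at y within {0..1})"
    by (simp add: has_field_derivative_iff x_def)
qed

lemma has_deriv01_compose_inv01:
  assumes T: "diffeo01 T" "has_deriv01 T T'" and pos: "\<And>t. t \<in> {0..1} \<Longrightarrow> T' t > 0"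
    and f: "has_deriv01 f f'"
  shows "has_deriv01 (\<lambda>t. f (inv01 T t)) (\<lambda>t. inverse (T' (inv01 T t)) *\<^sub>R f' (inv01 T t))"
  unfolding has_deriv01_def
proof
  fix y :: real assume y: "y \<in> {0..1}"
  have "(f has_vector_derivative f' (inv01 T y)) (at (inv01 T y) within inv01 T ` {0..1})"
    by (rule has_deriv01D[OF f inv01_in[OF T(1) y]]) (use inv01_in[OF T(1)] in blast)
  from vector_diff_chain_within[OF has_deriv01D[OF has_deriv01_inv01[OF T pos] y subset_refl] this]
  show "((\<lambda>t. f (inv01 T t)) has_vector_derivative inverse (T' (inv01 T y)) *\<^sub>R f' (inv01 T y)) (at y within {0..1})"
    by (simp add: o_def)
qed

lemma diffeo01_inv01: assumes "diffeo01 T" shows "diffeo01 (inv01 T)"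
proof -
  obtain T' where T': "has_deriv01 T T'" "\<forall>t\<in>{0..1}. T' t > 0" using assms by (auto simp: diffeo01_def)
  have "has_deriv01 (inv01 T) (\<lambda>t. inverse (T' (inv01 T t)))"
    using has_deriv01_inv01[OF assms] T' by auto
  moreover have "\<forall>t\<in>{0..1}. inverse (T' (inv01 T t)) > 0"
    using T' inv01_in[OF assms] by auto
  ultimately show ?thesis using inv01_0[OF assms] inv01_1[OF assms] by (auto simp: diffeo01_def)
qed

lemma inv01_inv01: assumes "diffeo01 T" "t \<in> {0..1}" shows "inv01 (inv01 T) t = T t"
  using inv01_left[OF diffeo01_inv01[OF assms(1)] diffeo01_in[OF assms]] inv01_left[OF assms] by simp

lemma C0_tendsto_compose_inv01:
  assumes f: "C0_tendsto F f g" and T: "C0_tendsto F T T0" "diffeo01 T0" "\<forall>\<^sub>F i in F. diffeo01 (T i)"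
  shows "C0_tendsto F (\<lambda>i t. f i (inv01 (T i) t)) (\<lambda>t. g (inv01 T0 t))"
  unfolding C0_tendsto_def
proof (intro conjI)
  have cont: "continuous_on {0..1} (\<lambda>t. h (inv01 S t))" if "continuous_on {0..1} h" "diffeo01 S"
    for h :: "real \<Rightarrow> 'b" and S
    using that inv01_in by (intro continuous_on_compose2[OF that(1) inv01_continuous]) auto
  show "\<forall>\<^sub>F i in F. continuous_on {0..1} (\<lambda>t. f i (inv01 (T i) t))"
    using f[unfolded C0_tendsto_def, THEN conjunct1] T(3) by eventually_elim (rule cont)
  show cg: "continuous_on {0..1} (\<lambda>t. g (inv01 T0 t))"
    using f T(2) by (auto simp: C0_tendsto_def intro: cont)
  show "uniform_limit {0..1} (\<lambda>i t. f i (inv01 (T i) t)) (\<lambda>t. g (inv01 T0 t)) F"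
  proof (rule uniform_limitI)
    fix e :: real assume e: "e > 0"
    have "uniformly_continuous_on {0..1} (\<lambda>t. g (inv01 T0 t))"
      using cg by (intro compact_uniformly_continuous) auto
    then obtain d where d: "d > 0" "\<And>x y. x \<in> {0..1} \<Longrightarrow> y \<in> {0..1} \<Longrightarrow> dist y x < d \<Longrightarrow>
        dist (g (inv01 T0 y)) (g (inv01 T0 x)) < e/2"
      unfolding uniformly_continuous_on_def using e by (metis half_gt_zero)
    have "\<forall>\<^sub>F i in F. \<forall>t\<in>{0..1}. dist (f i t) (g t) < e/2"
      "\<forall>\<^sub>F i in F. \<forall>t\<in>{0..1}. dist (T i t) (T0 t) < d"
      using C0_tendstoD[OF f, of "e/2"] C0_tendstoD[OF T(1) d(1)] e by simp_all
    then show "\<forall>\<^sub>F i in F. \<forall>t\<in>{0..1}. dist (f i (inv01 (T i) t)) (g (inv01 T0 t)) < e"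
      using T(3)
    proof eventually_elim
      case (elim i)
      show ?case
      proof
        fix y :: real assume y: "y \<in> {0..1}"
        define x where "x = inv01 (T i) y"
        have x: "x \<in> {0..1}" "T i x = y" using inv01_in inv01_right elim y by (auto simp: x_def)
        have "dist (g (inv01 T0 (T0 x))) (g (inv01 T0 y)) < e/2"
          by (rule d(2)) (use diffeo01_in[OF T(2) x(1)] y elim(2) x in \<open>auto simp: dist_commute\<close>)
        then have "dist (g x) (g (inv01 T0 y)) < e/2" by (simp add: inv01_left[OF T(2) x(1)])
        moreover have "dist (f i x) (g x) < e/2" using elim x by auto
        ultimately show "dist (f i (inv01 (T i) y)) (g (inv01 T0 y)) < e"
          unfolding x_def[symmetric]
          using dist_triangle[of "f i x" "g (inv01 T0 y)" "g x"] by linarith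
      qed
    qed
  qed
qed

text \<open>The derivative of \<open>f \<circ> T\<^sup>-\<^sup>1\<close> is \<open>(f'/T') \<circ> T\<^sup>-\<^sup>1\<close>, again a function composed with
  the same inverse. So one induction over \<open>k\<close> covers composition and inversion at once, without
  a chain rule for higher derivatives.\<close>

lemma Ck_tendsto_compose_inv01:
  assumes f: "Ck_tendsto k F f g" and T: "Ck_tendsto m F T T0" and km: "k \<le> m" "1 \<le> m"
    and d: "diffeo01 T0" "\<forall>\<^sub>F i in F. diffeo01 (T i)"
  shows "Ck_tendsto k F (\<lambda>i t. f i (inv01 (T i) t)) (\<lambda>t. g (inv01 T0 t))"
proof -
  obtain l where l: "m = Suc l" using km by (cases m) auto
  note C0T = Ck_tendsto_C0[OF T]
  obtain T' T0' where T': "\<forall>\<^sub>F i in F. has_deriv01 (T i) (T' i)" "has_deriv01 T0 T0'"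
    "Ck_tendsto l F T' T0'" using T l by auto
  have *: "S' t > 0" if S: "diffeo01 S" "has_deriv01 S S'" and t: "t \<in> {0..1}" for S S' t
  proof -
    obtain S2 where S2: "has_deriv01 S S2" "\<forall>t\<in>{0..1}. S2 t > 0" using S by (auto simp: diffeo01_def)
    then show ?thesis using has_deriv01_imp_deriv01[OF S(2) t] has_deriv01_imp_deriv01[OF S2(1) t] t
      by metis
  qed
  have pos: "\<And>t. t \<in> {0..1} \<Longrightarrow> T0' t > 0" using *[OF d(1) T'(2)] .
  from f km(1) show ?thesis
  proof (induction k arbitrary: f g)
    case 0
    then show ?case using C0_tendsto_compose_inv01[OF _ C0T d] by simp
  next
    case (Suc k)
    obtain f' g' where f': "\<forall>\<^sub>F i in F. has_deriv01 (f i) (f' i)" "has_deriv01 g g'"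
      "Ck_tendsto k F f' g'" using Suc.prems by auto
    show ?case
    proof (rule Ck_tendsto_SucI)
      show "\<forall>\<^sub>F i in F. has_deriv01 (\<lambda>t. f i (inv01 (T i) t))
          (\<lambda>t. inverse (T' i (inv01 (T i) t)) *\<^sub>R f' i (inv01 (T i) t))"
        using f'(1) T'(1) d(2)
        by eventually_elim (rule has_deriv01_compose_inv01, use * in auto)
      show "has_deriv01 (\<lambda>t. g (inv01 T0 t)) (\<lambda>t. inverse (T0' (inv01 T0 t)) *\<^sub>R g' (inv01 T0 t))"
        by (rule has_deriv01_compose_inv01[OF d(1) T'(2) pos f'(2)])
      have "Ck_tendsto k F (\<lambda>i t. inverse (T' i t) *\<^sub>R f' i t) (\<lambda>t. inverse (T0' t) *\<^sub>R g' t)"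
        using pos Suc.prems(2) l
        by (intro Ck_tendsto_scaleR Ck_tendsto_inverse f'(3) Ck_tendsto_mono[OF T'(3)]) force+
      then show "Ck_tendsto k F (\<lambda>i t. inverse (T' i (inv01 (T i) t)) *\<^sub>R f' i (inv01 (T i) t))
          (\<lambda>t. inverse (T0' (inv01 T0 t)) *\<^sub>R g' (inv01 T0 t))"
        using Suc.IH[of "\<lambda>i t. inverse (T' i t) *\<^sub>R f' i t" "\<lambda>t. inverse (T0' t) *\<^sub>R g' t"] Suc.prems by simp
      show "uniform_limit {0..1} (\<lambda>i t. f i (inv01 (T i) t)) (\<lambda>t. g (inv01 T0 t)) F"
        using C0_tendsto_compose_inv01[OF Ck_tendsto_C0[OF Suc.prems(1)] C0T d]
        by (simp add: C0_tendsto_def)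
    qed
  qed
qed

section \<open>Homotopies in spaces of curves\<close>

lemma Cr_curves_Ck: "\<gamma> \<in> Cr_curves r \<Longrightarrow> Ck r \<gamma>"
  by (auto simp: Cr_curves_def Ck_def)

lemma Cr_curves_iff: "\<gamma> \<in> Cr_curves r \<longleftrightarrow>
    \<gamma> \<in> extensional {0..1} \<and> (\<forall>t\<in>{0..1}. Im (\<gamma> t) > 0) \<and> Ck r \<gamma>"
  by (auto simp: Cr_curves_def Ck_def hyperbolic_plane_def image_subset_iff)

lemma limitin_curve_topology:
  "limitin (curve_topology r \<kappa>1 \<kappa>2 u v) f \<gamma> F \<longleftrightarrow> \<gamma> \<in> curve_space r \<kappa>1 \<kappa>2 u v \<and>
     (\<forall>\<^sub>F i in F. f i \<in> curve_space r \<kappa>1 \<kappa>2 u v) \<and> Ck_tendsto r F f \<gamma>" (is "?L \<longleftrightarrow> ?R")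
proof -
  let ?C = "curve_space r \<kappa>1 \<kappa>2 u v"
  interpret Metric_space ?C "Cr_dist r" by (rule Metric_space_curve_space)
  have Cr: "\<And>\<gamma>. \<gamma> \<in> ?C \<Longrightarrow> \<gamma> \<in> Cr_curves r" by (simp add: curve_space_def)
  let ?d = "\<lambda>j f t. dist ((deriv01 ^^ j) f t) ((deriv01 ^^ j) \<gamma> t :: complex)"
  have L: "?L \<longleftrightarrow> \<gamma> \<in> ?C \<and> (\<forall>e>0. \<forall>\<^sub>F i in F. f i \<in> ?C \<and> Cr_dist r (f i) \<gamma> < e)"
    unfolding curve_topology_def limitin_metric ..
  show ?thesis
  proof
    assume ?L
    then have g: "\<gamma> \<in> ?C" and e: "\<And>e. e > 0 \<Longrightarrow> \<forall>\<^sub>F i in F. f i \<in> ?C \<and> Cr_dist r (f i) \<gamma> < e"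
      using L by auto
    have ev: "\<forall>\<^sub>F i in F. f i \<in> ?C" using e[of 1] by (auto elim: eventually_mono)
    have "uniform_limit {0..1} (\<lambda>i. (deriv01 ^^ j) (f i)) ((deriv01 ^^ j) \<gamma>) F" if j: "j \<le> r" for j
    proof (rule uniform_limitI)
      fix d :: real assume "d > 0"
      from e[OF this] show "\<forall>\<^sub>F i in F. \<forall>t\<in>{0..1}. ?d j (f i) t < d"
      proof eventually_elim
        case (elim i)
        have fi: "f i \<in> Cr_curves r" "\<gamma> \<in> Cr_curves r" using elim g Cr by auto
        have nn: "0 \<le> (SUP t\<in>{0..1}. ?d k (f i) t)" if "k \<le> r" for k
          by (rule order_trans[OF zero_le_dist cSUP_upper[OF _ bdd_above_Cr_curves[OF fi that], of 0]]) simp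
        have "(SUP t\<in>{0..1}. ?d j (f i) t) \<le> Cr_dist r (f i) \<gamma>"
          unfolding Cr_dist_def using fi j nn by (auto intro!: member_le_sum[of j "{..r}"])
        then show ?case
          using cSUP_upper[OF _ bdd_above_Cr_curves[OF fi j]] elim by fastforce
      qed
    qed
    then show ?R
      using g ev Cr_curves_Ck[OF Cr] by (auto simp: Ck_tendsto_iff elim!: eventually_mono)
  next
    assume R: ?R
    then have g: "\<gamma> \<in> ?C" and ev: "\<forall>\<^sub>F i in F. f i \<in> ?C" by auto
    have "\<forall>\<^sub>F i in F. f i \<in> ?C \<and> Cr_dist r (f i) \<gamma> < e" if e: "e > 0" for e
    proof -
      define d where "d = e / (2 * (real r + 1))"
      have d: "d > 0" using e by (simp add: d_def)
      have "\<forall>\<^sub>F i in F. \<forall>t\<in>{0..1}. ?d j (f i) t < d" if "j \<in> {..r}" for j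
        using R d that by (auto simp: Ck_tendsto_iff uniform_limit_iff)
      then have "\<forall>\<^sub>F i in F. \<forall>j\<in>{..r}. \<forall>t\<in>{0..1}. ?d j (f i) t < d"
        by (intro eventually_ball_finite) auto
      with ev show ?thesis
      proof eventually_elim
        case (elim i)
        have "Cr_dist r (f i) \<gamma> = (\<Sum>j\<le>r. SUP t\<in>{0..1}. ?d j (f i) t)"
          using elim g Cr by (simp add: Cr_dist_def)
        also have "\<dots> \<le> (\<Sum>j\<le>r. d)"
          by (intro sum_mono cSUP_least) (use elim in \<open>auto intro: less_imp_le\<close>)
        also have "\<dots> = e / 2" by (simp add: d_def field_simps)
        also have "\<dots> < e" using e by simp
        finally show ?case using elim by simp
      qed
    qed
    then show ?L using L g by blast
  qed
qed

text \<open>Every contraction below is verified through this criterion. Continuity on the product of \<open>[0,1]\<close>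
  and the space of curves is stated with a filter on pairs, which avoids neighbourhoods
  in the product topology.\<close>

lemma contractible_curve_subspace:
  fixes H :: "real \<Rightarrow> (real \<Rightarrow> complex) \<Rightarrow> real \<Rightarrow> complex"
  assumes C: "C \<subseteq> curve_space r \<kappa>1 \<kappa>2 u v"
    and H: "\<And>s \<gamma>. s \<in> {0..1} \<Longrightarrow> \<gamma> \<in> C \<Longrightarrow> H s \<gamma> \<in> C"
    and H0: "\<And>\<gamma>. \<gamma> \<in> C \<Longrightarrow> H 0 \<gamma> = \<gamma>"
    and H1: "\<And>\<gamma>. \<gamma> \<in> C \<Longrightarrow> H 1 \<gamma> = \<eta>"
    and cont: "\<And>F s \<gamma>. s \<in> {0..1} \<Longrightarrow> \<gamma> \<in> C \<Longrightarrow> (fst \<longlongrightarrow> s) F \<Longrightarrow>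
      \<forall>\<^sub>F i in F. fst i \<in> {0..1} \<and> snd i \<in> C \<Longrightarrow> Ck_tendsto r F snd \<gamma> \<Longrightarrow>
      Ck_tendsto r F (\<lambda>i. H (fst i) (snd i)) (H s \<gamma>)"
  shows "contractible_space (subtopology (curve_topology r \<kappa>1 \<kappa>2 u v) C)"
proof (cases "C = {}")
  case True
  then show ?thesis by (intro contractible_space_subset_singleton[of _ undefined]) simp
next
  case False
  then obtain \<gamma> where "\<gamma> \<in> C" by blast
  then have \<eta>: "\<eta> \<in> C" using H[of 1 \<gamma>] H1[of \<gamma>] by auto
  let ?X = "curve_topology r \<kappa>1 \<kappa>2 u v"
  let ?Y = "subtopology ?X C"
  let ?P = "prod_topology (top_of_set {0..1::real}) ?Y"
  have top: "topspace ?Y = C" using C by auto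
  have "continuous_map ?P ?Y (\<lambda>i. H (fst i) (snd i))"
    unfolding continuous_map_atin
  proof
    fix x assume x: "x \<in> topspace ?P"
    let ?F = "atin ?P x"
    have x1: "fst x \<in> {0..1}" "snd x \<in> C" using x
      by (simp_all only: topspace_prod_topology top mem_Times_iff topspace_euclidean_subtopology)
    have "limitin (top_of_set {0..1}) fst (fst x) ?F"
      using continuous_map_fst[of "top_of_set {0..1}" ?Y] x unfolding continuous_map_atin by blast
    then have l1: "(fst \<longlongrightarrow> fst x) ?F" "\<forall>\<^sub>F i in ?F. fst i \<in> {0..1}"
      by (auto simp: limitin_subtopology)
    have "limitin ?Y snd (snd x) ?F"
      using continuous_map_snd[of "top_of_set {0..1}" ?Y] x unfolding continuous_map_atin by blast
    then have l2: "limitin ?X snd (snd x) ?F" "\<forall>\<^sub>F i in ?F. snd i \<in> C"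
      by (auto simp: limitin_subtopology)
    have ev: "\<forall>\<^sub>F i in ?F. fst i \<in> {0..1} \<and> snd i \<in> C" using l1(2) l2(2) by eventually_elim blast
    have "Ck_tendsto r ?F (\<lambda>i. H (fst i) (snd i)) (H (fst x) (snd x))"
      using cont[OF x1 l1(1) ev] l2(1) unfolding limitin_curve_topology by blast
    moreover have "\<forall>\<^sub>F i in ?F. H (fst i) (snd i) \<in> C"
      using ev by eventually_elim (use H in blast)
    moreover have "H (fst x) (snd x) \<in> C" using H x1 by blast
    ultimately show "limitin ?Y (\<lambda>i. H (fst i) (snd i)) (H (fst x) (snd x)) ?F"
      using C unfolding limitin_subtopology limitin_curve_topology by (auto elim!: eventually_mono)
  qed
  then have "homotopic_with (\<lambda>x. True) ?Y ?Y id (\<lambda>x. \<eta>)"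
    by (subst homotopic_with)
      (auto intro!: exI[where x="\<lambda>i. H (fst i) (snd i)"] simp only: top H0 H1 fst_conv snd_conv id_apply)
  then show ?thesis unfolding contractible_space_def by blast
qed

section \<open>Curvature and turning\<close>

lemma Ck_divide:
  fixes f g :: "real \<Rightarrow> 'a::real_normed_field"
  shows "Ck k f \<Longrightarrow> Ck k g \<Longrightarrow> (\<And>t. t \<in> {0..1} \<Longrightarrow> g t \<noteq> 0) \<Longrightarrow> Ck k (\<lambda>t. f t / g t)"
  unfolding Ck_iff_tendsto by (rule Ck_tendsto_divide)

lemma unit_tangent_eq:
  assumes "has_deriv01 \<gamma> \<gamma>1" "t \<in> {0..1}" "Im (\<gamma> t) > 0"
  shows "unit_tangent \<gamma> t = (Im (\<gamma> t) / cmod (\<gamma>1 t)) *\<^sub>R \<gamma>1 t"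
  using assms by (simp add: unit_tangent_def speed_def hyp_norm_eq has_deriv01_imp_deriv01)

lemma Im_divide_eq: "a \<noteq> 0 \<Longrightarrow> (b \<bullet> (\<i> * a)) = (cmod a)\<^sup>2 * Im (b / a)"
proof -
  assume "a \<noteq> 0"
  define c where "c = b / a"
  have "b = c * a" using \<open>a \<noteq> 0\<close> by (simp add: c_def)
  then have "b \<bullet> (\<i> * a) = (cmod a)\<^sup>2 * Im c"
    unfolding cmod_power2 by (simp add: inner_complex_def power2_eq_square algebra_simps)
  then show ?thesis by (simp add: c_def)
qed

text \<open>The derivative of the Euclidean direction \<open>arg \<gamma>'\<close>, free of any choice of the argument.\<close>

definition turn_rate :: "(real \<Rightarrow> complex) \<Rightarrow> real \<Rightarrow> real" where
  "turn_rate \<gamma> t = Im (deriv01 (deriv01 \<gamma>) t / deriv01 \<gamma> t)"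

text \<open>The curvature of a curve with position \<open>z\<close>, velocity \<open>a\<close> and acceleration \<open>b\<close>.\<close>

definition half_plane_curvature :: "complex \<Rightarrow> complex \<Rightarrow> complex \<Rightarrow> real" where
  "half_plane_curvature z a b = (Re a + Im z * Im (b / a)) / cmod a"

text \<open>With \<open>\<gamma>' = \<bar>\<gamma>'\<bar> e\<^sup>i\<^sup>\<theta>\<close> the right-hand side is \<open>cos \<theta> + y \<theta>'/\<bar>\<gamma>'\<bar>\<close>. The first summand is
  the contribution of the Christoffel symbols, in agreement with horizontal lines being
  horocycles, of curvature \<open>\<plusminus>1\<close>.\<close>

lemma curvature_eq:
  assumes d: "has_deriv01 \<gamma> \<gamma>1" "has_deriv01 \<gamma>1 \<gamma>2"
    and pos: "\<And>t. t \<in> {0..1} \<Longrightarrow> Im (\<gamma> t) > 0" and nz: "\<And>t. t \<in> {0..1} \<Longrightarrow> \<gamma>1 t \<noteq> 0"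
    and t: "t \<in> {0..1}"
  shows "curvature \<gamma> t = half_plane_curvature (\<gamma> t) (\<gamma>1 t) (\<gamma>2 t)"
proof -
  define c where "c = (\<lambda>t. Im (\<gamma> t) / cmod (\<gamma>1 t))"
  define y where "y = Im (\<gamma> t)"
  define a where "a = \<gamma>1 t"
  define n where "n = cmod a"
  have y: "y > 0" using pos[OF t] by (simp add: y_def)
  have a: "a \<noteq> 0" using nz[OF t] by (simp add: a_def)
  have n: "n > 0" using a by (simp add: n_def)
  \<comment> \<open>The derivative of \<open>c\<close> multiplies a tangential vector, which is orthogonal to the unit normal.\<close>
  obtain c' where c': "has_deriv01 c c'"
  proof -
    have i: "has_deriv01 (\<lambda>t. inverse (cmod (\<gamma>1 t)))
       (\<lambda>t. - (((Re (\<gamma>1 t) * Re (\<gamma>2 t) + Re (\<gamma>2 t) * Re (\<gamma>1 t) +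
          (Im (\<gamma>1 t) * Im (\<gamma>2 t) + Im (\<gamma>2 t) * Im (\<gamma>1 t))) / (2 * sqrt (Re (\<gamma>1 t) * Re (\<gamma>1 t) + Im (\<gamma>1 t) * Im (\<gamma>1 t))))
          * (inverse (cmod (\<gamma>1 t)) * inverse (cmod (\<gamma>1 t)))))"
      by (rule has_deriv01_inverse, unfold cmod_def power2_eq_square, rule has_deriv01_sqrt,
         intro has_deriv01_add bounded_bilinear.has_deriv01[OF bounded_bilinear_mult]
          bounded_linear.has_deriv01[OF bounded_linear_Re] bounded_linear.has_deriv01[OF bounded_linear_Im] d)
        (use nz in \<open>auto simp: complex_neq_0 power2_eq_square complex_eq_iff sum_squares_gt_zero_iff\<close>)
    show ?thesis
      by (rule that, unfold c_def divide_inverse,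
        rule bounded_bilinear.has_deriv01[OF bounded_bilinear_mult bounded_linear.has_deriv01[OF bounded_linear_Im d(1)] i])
  qed
  have ut: "unit_tangent \<gamma> s = c s *\<^sub>R \<gamma>1 s" if "s \<in> {0..1}" for s
    using unit_tangent_eq[OF d(1) that pos[OF that]] by (simp add: c_def)
  have "has_deriv01 (unit_tangent \<gamma>) (\<lambda>t. c t *\<^sub>R \<gamma>2 t + c' t *\<^sub>R \<gamma>1 t)"
    by (rule has_deriv01_cong[OF bounded_bilinear.has_deriv01[OF bounded_bilinear_scaleR c' d(2)]])
      (use ut in auto)
  then have du: "deriv01 (unit_tangent \<gamma>) t = c t *\<^sub>R \<gamma>2 t + c' t *\<^sub>R \<gamma>1 t"
    using t by (rule has_deriv01_imp_deriv01)
  have ct: "c t = y / n" by (simp add: c_def y_def n_def a_def)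
  have chr: "christoffel (\<gamma> t) a (c t *\<^sub>R a) = (1/n) *\<^sub>R (\<i> * a * a)"
    using y n by (simp add: christoffel_def y_def[symmetric] ct complex_eq_iff field_simps)
  have sp: "speed \<gamma> t = n / y"
    using t d(1) pos[OF t] by (simp add: speed_def hyp_norm_eq has_deriv01_imp_deriv01 n_def a_def y_def)
  have "hyp_inner (\<gamma> t) (cov_deriv \<gamma> (unit_tangent \<gamma>) t) (unit_normal \<gamma> t)
     = ((c t *\<^sub>R \<gamma>2 t + c' t *\<^sub>R a + (1/n) *\<^sub>R (\<i> * a * a)) \<bullet> (c t *\<^sub>R (\<i> * a))) / y\<^sup>2"
    using t by (simp add: hyp_inner_def cov_deriv_def du has_deriv01_imp_deriv01[OF d(1) t] chr
        unit_normal_def ut y_def[symmetric] a_def[symmetric])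
  also have "(c t *\<^sub>R \<gamma>2 t + c' t *\<^sub>R a + (1/n) *\<^sub>R (\<i> * a * a)) \<bullet> (c t *\<^sub>R (\<i> * a))
      = (c t)\<^sup>2 * (\<gamma>2 t \<bullet> (\<i> * a)) + c t * c' t * (a \<bullet> (\<i> * a)) + c t / n * ((\<i> * a * a) \<bullet> (\<i> * a))"
    by (simp add: inner_add_left power2_eq_square algebra_simps)
  also have "a \<bullet> (\<i> * a) = 0" by (simp add: inner_complex_def)
  also have "(\<i> * a * a) \<bullet> (\<i> * a) = n\<^sup>2 * Re a"
    unfolding n_def cmod_power2 by (simp add: inner_complex_def power2_eq_square algebra_simps)
  also have "\<gamma>2 t \<bullet> (\<i> * a) = n\<^sup>2 * Im (\<gamma>2 t / a)" unfolding n_def by (rule Im_divide_eq[OF a])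
  also have "((c t)\<^sup>2 * (n\<^sup>2 * Im (\<gamma>2 t / a)) + c t * c' t * 0 + c t / n * (n\<^sup>2 * Re a)) / y\<^sup>2
     = Im (\<gamma>2 t / a) + Re a / y"
    using y n by (simp add: ct power2_eq_square field_simps)
  finally show ?thesis
    unfolding curvature_def half_plane_curvature_def sp using y n
    by (simp add: a_def[symmetric] n_def[symmetric] y_def[symmetric] field_simps)
qed

definition turning :: "(real \<Rightarrow> complex) \<Rightarrow> real" where
  "turning \<gamma> = integral {0..1} (turn_rate \<gamma>)"

text \<open>The tangent conditions are stated without division, as in \<open>y \<gamma>' = \<bar>\<gamma>'\<bar> w\<close> for the unit vector
  \<open>w\<close> at height \<open>y\<close>.\<close>

lemma curve_spaceD:
  assumes "\<gamma> \<in> curve_space r \<kappa>1 \<kappa>2 u v" "r = Suc (Suc q)"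
  shows "\<gamma> \<in> extensional {0..1}" "Ck r \<gamma>" "Ck (Suc q) (deriv01 \<gamma>)" "Ck q (deriv01 (deriv01 \<gamma>))"
    "has_deriv01 \<gamma> (deriv01 \<gamma>)" "has_deriv01 (deriv01 \<gamma>) (deriv01 (deriv01 \<gamma>))"
    "\<And>t. t \<in> {0..1} \<Longrightarrow> Im (\<gamma> t) > 0" "\<And>t. t \<in> {0..1} \<Longrightarrow> deriv01 \<gamma> t \<noteq> 0"
    "\<And>t. t \<in> {0..1} \<Longrightarrow> \<kappa>1 < ereal (half_plane_curvature (\<gamma> t) (deriv01 \<gamma> t) (deriv01 (deriv01 \<gamma>) t))"
    "\<And>t. t \<in> {0..1} \<Longrightarrow> ereal (half_plane_curvature (\<gamma> t) (deriv01 \<gamma> t) (deriv01 (deriv01 \<gamma>) t)) < \<kappa>2"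
    "\<gamma> 0 = fst u" "\<gamma> 1 = fst v" "Im (\<gamma> 0) *\<^sub>R deriv01 \<gamma> 0 = cmod (deriv01 \<gamma> 0) *\<^sub>R snd u"
    "Im (\<gamma> 1) *\<^sub>R deriv01 \<gamma> 1 = cmod (deriv01 \<gamma> 1) *\<^sub>R snd v"
proof -
  show 1: "\<gamma> \<in> extensional {0..1}" "Ck r \<gamma>" and pos: "\<And>t. t \<in> {0..1} \<Longrightarrow> Im (\<gamma> t) > 0"
    and nz: "\<And>t. t \<in> {0..1} \<Longrightarrow> deriv01 \<gamma> t \<noteq> 0"
    using assms(1) by (auto simp: curve_space_def Cr_curves_iff)
  show 2: "has_deriv01 \<gamma> (deriv01 \<gamma>)" "Ck (Suc q) (deriv01 \<gamma>)" using 1 assms(2) by (auto simp: Ck_Suc)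
  then show 3: "has_deriv01 (deriv01 \<gamma>) (deriv01 (deriv01 \<gamma>))" "Ck q (deriv01 (deriv01 \<gamma>))"
    by (auto simp: Ck_Suc)
  have cs: "\<forall>t\<in>{0..1}. \<kappa>1 < ereal (curvature \<gamma> t) \<and> ereal (curvature \<gamma> t) < \<kappa>2"
    using assms(1) unfolding curve_space_def by blast
  fix t :: real assume t: "t \<in> {0..1}"
  have c: "curvature \<gamma> t = half_plane_curvature (\<gamma> t) (deriv01 \<gamma> t) (deriv01 (deriv01 \<gamma>) t)"
    by (rule curvature_eq[OF 2(1) 3(1) _ _ t]) (fact pos nz)+
  show "\<kappa>1 < ereal (half_plane_curvature (\<gamma> t) (deriv01 \<gamma> t) (deriv01 (deriv01 \<gamma>) t))"
    unfolding c[symmetric] using bspec[OF cs t] by blast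
  show "ereal (half_plane_curvature (\<gamma> t) (deriv01 \<gamma> t) (deriv01 (deriv01 \<gamma>) t)) < \<kappa>2"
    unfolding c[symmetric] using bspec[OF cs t] by blast
next
  have tc: "tangent_curve \<gamma> 0 = u" "tangent_curve \<gamma> 1 = v" using assms(1) by (auto simp: curve_space_def)
  have 2: "has_deriv01 \<gamma> (deriv01 \<gamma>)" "\<And>t. t \<in> {0..1} \<Longrightarrow> Im (\<gamma> t) > 0" "\<And>t. t \<in> {0..1} \<Longrightarrow> deriv01 \<gamma> t \<noteq> 0"
    using assms by (auto simp: curve_space_def Cr_curves_iff Ck_Suc)
  show "\<gamma> 0 = fst u" "\<gamma> 1 = fst v" using tc by (auto simp: tangent_curve_def)
  show "Im (\<gamma> 0) *\<^sub>R deriv01 \<gamma> 0 = cmod (deriv01 \<gamma> 0) *\<^sub>R snd u"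
    "Im (\<gamma> 1) *\<^sub>R deriv01 \<gamma> 1 = cmod (deriv01 \<gamma> 1) *\<^sub>R snd v"
    unfolding tc[symmetric] tangent_curve_def snd_conv
    using unit_tangent_eq[OF 2(1), of 0] unit_tangent_eq[OF 2(1), of 1] 2(2)[of 0] 2(2)[of 1] 2(3)[of 0] 2(3)[of 1]
    by auto
qed

lemma scaleR_quotient_eq:
  fixes w :: "'a::real_vector"
  assumes "y *\<^sub>R g = n *\<^sub>R w" "n \<noteq> 0" shows "(y / n) *\<^sub>R g = w"
proof -
  have "(y / n) *\<^sub>R g = (1 / n) *\<^sub>R (y *\<^sub>R g)" by simp
  also have "\<dots> = w" unfolding assms(1) using assms(2) by simp
  finally show ?thesis .
qed

lemma curve_spaceI:
  assumes d: "has_deriv01 \<gamma> \<gamma>1" "has_deriv01 \<gamma>1 \<gamma>2" and r: "r = Suc (Suc q)" and ck: "Ck r \<gamma>"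
    and ext: "\<gamma> \<in> extensional {0..1}"
    and pos: "\<And>t. t \<in> {0..1} \<Longrightarrow> Im (\<gamma> t) > 0" and nz: "\<And>t. t \<in> {0..1} \<Longrightarrow> \<gamma>1 t \<noteq> 0"
    and e: "\<gamma> 0 = fst u" "\<gamma> 1 = fst v" "Im (\<gamma> 0) *\<^sub>R \<gamma>1 0 = cmod (\<gamma>1 0) *\<^sub>R snd u"
      "Im (\<gamma> 1) *\<^sub>R \<gamma>1 1 = cmod (\<gamma>1 1) *\<^sub>R snd v"
    and k: "\<And>t. t \<in> {0..1} \<Longrightarrow> \<kappa>1 < ereal (half_plane_curvature (\<gamma> t) (\<gamma>1 t) (\<gamma>2 t))"
      "\<And>t. t \<in> {0..1} \<Longrightarrow> ereal (half_plane_curvature (\<gamma> t) (\<gamma>1 t) (\<gamma>2 t)) < \<kappa>2"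
  shows "\<gamma> \<in> curve_space r \<kappa>1 \<kappa>2 u v"
proof -
  have "\<gamma> \<in> Cr_curves r" using ext pos ck by (simp add: Cr_curves_iff)
  moreover have "unit_tangent \<gamma> 0 = snd u" "unit_tangent \<gamma> 1 = snd v"
    using unit_tangent_eq[OF d(1), of 0] unit_tangent_eq[OF d(1), of 1] pos[of 0] pos[of 1] e nz[of 0] nz[of 1]
    by (auto intro!: scaleR_quotient_eq)
  ultimately show ?thesis
    using e(1,2) nz k curvature_eq[OF d pos nz] has_deriv01_imp_deriv01[OF d(1)]
    by (auto simp: curve_space_def tangent_curve_def prod_eq_iff)
qed

definition angle :: "real \<Rightarrow> (real \<Rightarrow> complex) \<Rightarrow> real \<Rightarrow> real" where
  "angle \<theta> \<gamma> t = \<theta> + integral {0..t} (turn_rate \<gamma>)"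

lemma angle_1: "angle \<theta> \<gamma> 1 = \<theta> + turning \<gamma>" and angle_0: "angle \<theta> \<gamma> 0 = \<theta>"
  by (simp_all add: angle_def turning_def)

text \<open>The integral \<open>L\<close> of \<open>\<gamma>''/\<gamma>'\<close> is a logarithm of \<open>\<gamma>'\<close>, since \<open>\<gamma>' e\<^sup>-\<^sup>L\<close> has derivative 0; its
  imaginary part is a continuous choice of the direction.\<close>

lemma direction_eq_cis_angle:
  assumes d: "has_deriv01 \<gamma>1 \<gamma>2" and c2: "continuous_on {0..1} \<gamma>2"
    and nz: "\<And>t. t \<in> {0..1} \<Longrightarrow> \<gamma>1 t \<noteq> 0" and t: "t \<in> {0..1}"
    and 0: "\<gamma>1 0 = cmod (\<gamma>1 0) * cis \<theta>"
  shows "\<gamma>1 t = cmod (\<gamma>1 t) * cis (\<theta> + integral {0..t} (\<lambda>t. Im (\<gamma>2 t / \<gamma>1 t)))"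
proof -
  define L where "L = (\<lambda>t. integral {0..t} (\<lambda>t. \<gamma>2 t / \<gamma>1 t))"
  have cq: "continuous_on {0..1} (\<lambda>t. \<gamma>2 t / \<gamma>1 t)"
    by (intro continuous_on_divide c2 has_deriv01_continuous[OF d]) (use nz in auto)
  have L: "has_deriv01 L (\<lambda>t. \<gamma>2 t / \<gamma>1 t)" unfolding L_def by (rule has_deriv01_integral[OF cq])
  have ImL: "Im (L t) = integral {0..t} (\<lambda>t. Im (\<gamma>2 t / \<gamma>1 t))"
    by (rule has_deriv01_unique[OF bounded_linear.has_deriv01[OF bounded_linear_Im L]
        has_deriv01_integral _ t]) (auto simp: L_def intro!: continuous_intros c2 has_deriv01_continuous[OF d] nz)
  have "has_deriv01 (\<lambda>t. \<gamma>1 t * exp (- L t)) (\<lambda>t. 0)"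
    unfolding has_deriv01_def
  proof
    fix s :: real assume s: "s \<in> {0..1}"
    have "((\<lambda>t. exp (- L t)) has_vector_derivative (- (\<gamma>2 s / \<gamma>1 s)) * exp (- L s)) (at s within {0..1})"
      using field_vector_diff_chain_within[of "\<lambda>t. - L t" "- (\<gamma>2 s / \<gamma>1 s)" s "{0..1}" exp "exp (- L s)"]
        has_vector_derivative_minus[OF has_deriv01D[OF L s subset_refl]]
      by (auto simp: o_def intro: DERIV_subset[OF DERIV_exp])
    from has_vector_derivative_mult[OF has_deriv01D[OF d s subset_refl] this]
    show "((\<lambda>t. \<gamma>1 t * exp (- L t)) has_vector_derivative 0) (at s within {0..1})"
      using nz[OF s] by (simp add: field_simps)
  qed
  from has_deriv01_unique[OF this has_deriv01_const[of "\<gamma>1 0"] _ t]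
  have "\<gamma>1 t * exp (- L t) = \<gamma>1 0" by (simp add: L_def)
  then have g: "\<gamma>1 t = \<gamma>1 0 * exp (L t)" by (metis exp_minus_inverse mult.assoc mult.commute mult.right_neutral)
  then have n: "cmod (\<gamma>1 t) = cmod (\<gamma>1 0) * exp (Re (L t))" by (simp add: norm_mult)
  have "\<gamma>1 t = cmod (\<gamma>1 0) * cis \<theta> * (exp (Re (L t)) * cis (Im (L t)))"
    using g 0 by (simp add: exp_eq_polar)
  also have "\<dots> = cmod (\<gamma>1 t) * cis (\<theta> + Im (L t))" unfolding n by (simp add: cis_mult[symmetric] mult_ac)
  finally show ?thesis by (simp add: ImL)
qed

section \<open>Canonical subspaces and turning\<close>

text \<open>The universal covering of the unit tangent bundle, as a map from the product of the
  half-plane and the line.\<close>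

definition frame :: "complex \<times> real \<Rightarrow> complex \<times> complex" where
  "frame x = (fst x, of_real (Im (fst x)) * cis (snd x))"

definition frame_domain :: "(complex \<times> real) set" where
  "frame_domain = {z. Im z > 0} \<times> UNIV"

lemma convex_frame_domain: "convex frame_domain"
  unfolding frame_domain_def by (intro convex_Times convex_UNIV convex_halfspace_Im_gt)

lemma continuous_frame: "continuous_on S frame"
  unfolding frame_def by (intro continuous_intros)

lemma frame_in: "x \<in> frame_domain \<Longrightarrow> frame x \<in> unit_tangent_bundle"
  by (auto simp: frame_domain_def frame_def unit_tangent_bundle_def hyperbolic_plane_def hyp_norm_eq norm_mult)

lemma frame_surj:
  assumes "u \<in> unit_tangent_bundle" obtains \<theta> where "u = frame (fst u, \<theta>)" "Im (fst u) > 0"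
proof -
  have u: "Im (fst u) > 0" "cmod (snd u) = Im (fst u)"
    using assms by (auto simp: unit_tangent_bundle_def hyperbolic_plane_def hyp_norm_eq split: prod.splits)
  have "snd u = of_real (Im (fst u)) * cis (Arg (snd u))"
    using rcis_cmod_Arg[of "snd u"] u by (simp add: rcis_def)
  then show ?thesis using that[of "Arg (snd u)"] u by (simp add: frame_def prod_eq_iff)
qed

lemma deriv01_eq_cis_angle:
  assumes \<gamma>: "\<gamma> \<in> curve_space r \<kappa>1 \<kappa>2 (frame (z0, \<theta>)) v" and r: "r = Suc (Suc q)" and t: "t \<in> {0..1}"
  shows "deriv01 \<gamma> t = cmod (deriv01 \<gamma> t) * cis (angle \<theta> \<gamma> t)"
proof -
  note D = curve_spaceD[OF \<gamma> r]
  have "Im (\<gamma> 0) \<noteq> 0" using D(7)[of 0] by simp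
  moreover have "Im (\<gamma> 0) *\<^sub>R deriv01 \<gamma> 0 = Im (\<gamma> 0) *\<^sub>R (cmod (deriv01 \<gamma> 0) * cis \<theta>)"
    using D(11,13) by (simp add: frame_def scaleR_conv_of_real mult_ac)
  ultimately have 0: "deriv01 \<gamma> 0 = cmod (deriv01 \<gamma> 0) * cis \<theta>"
    unfolding scaleR_cancel_left by blast
  show ?thesis
    unfolding angle_def turn_rate_def[abs_def]
    by (rule direction_eq_cis_angle[OF D(6) Ck_continuous[OF D(4)] D(8) t 0])
qed

lemma tangent_curve_eq_frame:
  assumes \<gamma>: "\<gamma> \<in> curve_space r \<kappa>1 \<kappa>2 (frame (z0, \<theta>)) v" and r: "r = Suc (Suc q)" and t: "t \<in> {0..1}"
  shows "tangent_curve \<gamma> t = frame (\<gamma> t, angle \<theta> \<gamma> t)"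
proof -
  note D = curve_spaceD[OF \<gamma> r]
  have "unit_tangent \<gamma> t = of_real (Im (\<gamma> t)) * cis (angle \<theta> \<gamma> t)"
    unfolding unit_tangent_eq[OF D(5) t D(7)[OF t]] using D(8)[OF t] deriv01_eq_cis_angle[OF \<gamma> r t]
    by (metis (no_types, opaque_lifting) nonzero_mult_div_cancel_left norm_eq_zero of_real_divide of_real_eq_0_iff scaleR_conv_of_real times_divide_eq_left times_divide_eq_right)
  then show ?thesis by (simp add: tangent_curve_def frame_def)
qed

lemma continuous_angle:
  assumes "\<gamma> \<in> curve_space r \<kappa>1 \<kappa>2 u v" "r = Suc (Suc q)"
  shows "continuous_on {0..1} (angle \<theta> \<gamma>)"
proof -
  note D = curve_spaceD[OF assms]
  have "continuous_on {0..1} (turn_rate \<gamma>)"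
    unfolding turn_rate_def[abs_def] by (intro continuous_on_Im continuous_on_divide Ck_continuous[OF D(3)] Ck_continuous[OF D(4)]) (use D(8) in auto)
  from has_deriv01_continuous[OF has_deriv01_integral[OF this]]
  show ?thesis unfolding angle_def by (intro continuous_intros)
qed

text \<open>Equal end angles give homotopic paths in the convex \<open>frame_domain\<close>, and homotopic paths have lifts
  with the same end. Conversely, if the lifts to the simply connected \<open>E\<close> end at the same point, they are
  homotopic; so are the vectors \<open>y e\<^sup>i\<^sup>\<theta>\<close> in the punctured plane, and lifting them through the exponential
  function gives the logarithms \<open>ln y + i \<theta>\<close> with the same end.\<close>

lemma lift_frame_path_finish_iff:
  assumes cov: "universal_cover E pr unit_tangent_bundle"
    and p: "path p1" "path p2" "path_image p1 \<subseteq> frame_domain" "path_image p2 \<subseteq> frame_domain"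
      "pathstart p1 = pathstart p2" "fst (pathfinish p1) = fst (pathfinish p2)"
    and g: "path g1" "path g2" "path_image g1 \<subseteq> E" "path_image g2 \<subseteq> E" "pathstart g1 = pathstart g2"
      "\<And>t. t \<in> {0..1} \<Longrightarrow> pr (g1 t) = frame (p1 t)" "\<And>t. t \<in> {0..1} \<Longrightarrow> pr (g2 t) = frame (p2 t)"
  shows "pathfinish g1 = pathfinish g2 \<longleftrightarrow> snd (pathfinish p1) = snd (pathfinish p2)"
proof
  have cs: "covering_space E pr unit_tangent_bundle" and sc: "simply_connected E"
    using cov by (auto simp: universal_cover_def)
  have fp: "path (frame \<circ> p1)" "path (frame \<circ> p2)"
    using p continuous_frame by (auto intro!: path_continuous_image)
  have im: "path_image (frame \<circ> p1) \<subseteq> unit_tangent_bundle" "path_image (frame \<circ> p2) \<subseteq> unit_tangent_bundle"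
    using p(3,4) frame_in unfolding path_image_compose by blast+
  {
    assume "snd (pathfinish p1) = snd (pathfinish p2)"
    then have "homotopic_paths frame_domain p1 p2"
      using convex_imp_simply_connected[OF convex_frame_domain] p
      unfolding simply_connected_eq_homotopic_paths by (metis prod.expand)
    then have "homotopic_paths unit_tangent_bundle (frame \<circ> p1) (frame \<circ> p2)"
      by (rule homotopic_paths_continuous_image[OF _ continuous_frame]) (auto intro: frame_in)
    from covering_space_monodromy[OF cs fp(1) im(1) fp(2) im(2) this g(1,3) _ g(2,4) _ g(5)] g(6,7)
    show "pathfinish g1 = pathfinish g2" by simp
  }
  assume "pathfinish g1 = pathfinish g2"
  then have h: "homotopic_paths E g1 g2"
    using sc g unfolding simply_connected_eq_homotopic_paths by metis
  define a where "a = (\<lambda>p (t::real). snd (frame (p t)) :: complex)"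
  have aeq: "a p1 t = snd (pr (g1 t))" "a p2 t = snd (pr (g2 t))" if "t \<in> {0..1}" for t
    using g(6,7) that by (auto simp: a_def)
  have cpr: "continuous_on E pr" and prE: "pr ` E = unit_tangent_bundle" using cs by (auto simp: covering_space_def)
  have "homotopic_paths (-{0}) ((\<lambda>x. snd (pr x)) \<circ> g1) ((\<lambda>x. snd (pr x)) \<circ> g2)"
  proof (rule homotopic_paths_continuous_image[OF h])
    show "continuous_on E (\<lambda>x. snd (pr x))" by (intro continuous_intros cpr)
    show "(\<lambda>x. snd (pr x)) \<in> E \<rightarrow> - {0}"
    proof
      fix x assume "x \<in> E"
      then have "pr x \<in> unit_tangent_bundle" using prE by blast
      then show "snd (pr x) \<in> - {0}"
        by (auto simp: unit_tangent_bundle_def hyperbolic_plane_def hyp_norm_eq split: prod.splits)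
    qed
  qed
  then have h': "homotopic_paths (-{0}) ((\<lambda>x. snd (pr x)) \<circ> g1) ((\<lambda>x. snd (pr x)) \<circ> g2)" .
  note h'_path = homotopic_paths_imp_path[OF h'] homotopic_paths_imp_subset[OF h']
  have "homotopic_paths (-{0}) ((\<lambda>x. snd (pr x)) \<circ> g1) (a p1)"
    "homotopic_paths (-{0}) ((\<lambda>x. snd (pr x)) \<circ> g2) (a p2)"
    by (rule homotopic_paths_eq; use h'_path aeq in simp)+
  with h' have H: "homotopic_paths (-{0}) (a p1) (a p2)"
    using homotopic_paths_trans homotopic_paths_sym by blast
  define l where "l = (\<lambda>p (t::real). Complex (ln (Im (fst (p t)))) (snd (p t :: complex \<times> real)))"
  have pl: "path (l p)" if "path p" "path_image p \<subseteq> frame_domain" for p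
    using that unfolding path_def l_def Complex_eq
    by (intro continuous_intros) (auto simp: path_image_def frame_domain_def)
  have el: "exp (l p t) = a p t" if "path_image p \<subseteq> frame_domain" "t \<in> {0..1}" for p t
  proof -
    have "p t \<in> frame_domain" using that unfolding path_image_def by blast
    then have "Im (fst (p t)) > 0" by (auto simp: frame_domain_def)
    then show ?thesis by (simp add: l_def a_def frame_def exp_eq_polar)
  qed
  have "pathfinish (l p1) = pathfinish (l p2)"
  proof (rule covering_space_monodromy[OF covering_space_exp_punctured_plane _ _ _ _ H pl[OF p(1,3)] _ _ pl[OF p(2,4)]])
    show "path (a p1)" "path (a p2)" using homotopic_paths_imp_path[OF H] by blast+
    show "path_image (a p1) \<subseteq> - {0}" "path_image (a p2) \<subseteq> - {0}"
      using homotopic_paths_imp_subset[OF H] by blast+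
    show "\<And>t. t \<in> {0..1} \<Longrightarrow> exp (l p1 t) = a p1 t" "\<And>t. t \<in> {0..1} \<Longrightarrow> exp (l p2 t) = a p2 t"
      using el[OF p(3)] el[OF p(4)] by blast+
    show "pathstart (l p1) = pathstart (l p2)" using p(5) by (simp add: l_def pathstart_def)
  qed simp_all
  then show "snd (pathfinish p1) = snd (pathfinish p2)" by (simp add: l_def pathfinish_def)
qed

text \<open>Canonical subspaces are labelled by points of an abstract universal cover. The map \<open>W\<close>
  translates turnings into these labels, and it is the same for all curvature bounds. It is
  defined from straight segments in \<open>frame_domain\<close>, so it also labels turnings that no
  curve attains, which are the source of the empty canonical subspaces.\<close>

lemma lift_endpoint_turning:
  fixes \<theta>0 \<theta>1 :: real and z0 z1 :: complex
  assumes cov: "universal_cover E pr unit_tangent_bundle" and e: "e \<in> E" "pr e = frame (z0, \<theta>0)"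
    and z: "Im z0 > 0" "Im z1 > 0" and r: "r \<ge> 2"
  defines "A \<equiv> {\<Omega>. cis (\<theta>0 + \<Omega>) = cis \<theta>1}"
  obtains W where "inj_on W A" "W ` A \<subseteq> {w \<in> E. pr w = frame (z1, \<theta>1)}"
    "\<And>\<kappa>1 \<kappa>2 \<gamma>. \<gamma> \<in> curve_space r \<kappa>1 \<kappa>2 (frame (z0, \<theta>0)) (frame (z1, \<theta>1)) \<Longrightarrow>
       turning \<gamma> \<in> A \<and> lift_endpoint E pr e \<gamma> = W (turning \<gamma>)"
proof -
  have cs: "covering_space E pr unit_tangent_bundle" using cov by (auto simp: universal_cover_def)
  define lp where "lp = (\<lambda>\<Omega>. linepath (z0, \<theta>0) (z1, \<theta>0 + \<Omega>))"
  have lp: "path (lp \<Omega>)" "path_image (lp \<Omega>) \<subseteq> frame_domain" "pathstart (lp \<Omega>) = (z0, \<theta>0)"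
    "pathfinish (lp \<Omega>) = (z1, \<theta>0 + \<Omega>)" for \<Omega>
    using z closed_segment_subset[OF _ _ convex_frame_domain, of "(z0, \<theta>0)" "(z1, \<theta>0 + \<Omega>)"]
    by (auto simp: lp_def frame_domain_def)
  have "\<exists>g. path g \<and> path_image g \<subseteq> E \<and> pathstart g = e \<and> (\<forall>t\<in>{0..1}. pr (g t) = frame (lp \<Omega> t))" for \<Omega>
  proof -
    have "path (frame \<circ> lp \<Omega>)" by (rule path_continuous_image[OF lp(1) continuous_frame])
    moreover have "path_image (frame \<circ> lp \<Omega>) \<subseteq> unit_tangent_bundle"
      using lp(2)[of \<Omega>] frame_in unfolding path_image_compose by blast
    moreover have "pathstart (frame \<circ> lp \<Omega>) = pr e" using lp(3) e by (simp add: pathstart_compose)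
    ultimately obtain g where "path g" "path_image g \<subseteq> E" "pathstart g = e"
      "\<And>t. t \<in> {0..1} \<Longrightarrow> pr (g t) = (frame \<circ> lp \<Omega>) t"
      using covering_space_lift_path_strong[OF cs e(1)] by blast
    then show ?thesis by auto
  qed
  then obtain G where G: "\<And>\<Omega>. path (G \<Omega>)" "\<And>\<Omega>. path_image (G \<Omega>) \<subseteq> E" "\<And>\<Omega>. pathstart (G \<Omega>) = e"
    "\<And>\<Omega> t. t \<in> {0..1} \<Longrightarrow> pr (G \<Omega> t) = frame (lp \<Omega> t)" by metis
  show ?thesis
  proof (rule that[of "\<lambda>\<Omega>. pathfinish (G \<Omega>)"])
    show "inj_on (\<lambda>\<Omega>. pathfinish (G \<Omega>)) A"
    proof (rule inj_onI)
      fix \<Omega> \<Omega>' assume "pathfinish (G \<Omega>) = pathfinish (G \<Omega>')"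
      then show "\<Omega> = \<Omega>'"
        by (subst (asm) lift_frame_path_finish_iff[OF cov lp(1) lp(1) lp(2) lp(2) _ _ G(1) G(1) G(2) G(2) _ G(4) G(4)])
          (auto simp: lp G(3))
    qed
    show "(\<lambda>\<Omega>. pathfinish (G \<Omega>)) ` A \<subseteq> {w \<in> E. pr w = frame (z1, \<theta>1)}"
    proof clarsimp
      fix \<Omega> assume "\<Omega> \<in> A"
      moreover have "pathfinish (G \<Omega>) \<in> E" using G(2) pathfinish_in_path_image by blast
      moreover have "pr (pathfinish (G \<Omega>)) = frame (z1, \<theta>0 + \<Omega>)"
        using G(4)[of 1 \<Omega>] lp(4)[of \<Omega>] by (simp add: pathfinish_def)
      ultimately show "pathfinish (G \<Omega>) \<in> E \<and> pr (pathfinish (G \<Omega>)) = frame (z1, \<theta>1)"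
        by (simp add: A_def frame_def)
    qed
  next
    fix \<kappa>1 \<kappa>2 \<gamma> assume \<gamma>: "\<gamma> \<in> curve_space r \<kappa>1 \<kappa>2 (frame (z0, \<theta>0)) (frame (z1, \<theta>1))"
    obtain q where q: "r = Suc (Suc q)" using r by (metis add_2_eq_Suc le_Suc_ex)
    note D = curve_spaceD[OF \<gamma> q]
    define p where "p = (\<lambda>t. (\<gamma> t, angle \<theta>0 \<gamma> t))"
    have p: "path p" unfolding path_def p_def
      by (intro continuous_intros Ck_continuous[OF D(2)] continuous_angle[OF \<gamma> q])
    have p2: "path_image p \<subseteq> frame_domain" using D(7) by (auto simp: path_image_def p_def frame_domain_def)
    have p3: "pathstart p = (z0, \<theta>0)" "pathfinish p = (z1, \<theta>0 + turning \<gamma>)"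
      using D(11,12) by (auto simp: p_def pathstart_def pathfinish_def angle_0 angle_1 frame_def)
    have tp: "tangent_curve \<gamma> t = frame (p t)" if "t \<in> {0..1}" for t
      using tangent_curve_eq_frame[OF \<gamma> q that] by (simp add: p_def)
    have "frame (z1, \<theta>0 + turning \<gamma>) = frame (z1, \<theta>1)"
      using tp[of 1] p3 \<gamma> by (simp add: pathfinish_def curve_space_def)
    then have A: "turning \<gamma> \<in> A" using z by (simp add: frame_def A_def)
    have r1: "r \<ge> 1" using r by simp
    note T = path_tangent_curve[OF \<gamma> r1]
    have "pathstart (tangent_curve \<gamma>) = pr e" using \<gamma> e by (simp add: curve_space_def pathstart_def)
    then obtain g where g: "path g" "path_image g \<subseteq> E" "pathstart g = e"
      "\<And>t. t \<in> {0..1} \<Longrightarrow> pr (g t) = tangent_curve \<gamma> t"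
      using covering_space_lift_path_strong[OF cs e(1) T] by blast
    have "lift_endpoint E pr e \<gamma> = pathfinish g" by (rule lift_endpoint_eqI[OF cs \<gamma> r1 g])
    also have "\<dots> = pathfinish (G (turning \<gamma>))"
      by (subst lift_frame_path_finish_iff[OF cov p lp(1) p2 lp(2) _ _ g(1) G(1) g(2) G(2) _ _ G(4)])
        (auto simp: lp p3 g G(3) tp)
    finally show "turning \<gamma> \<in> A \<and> lift_endpoint E pr e \<gamma> = pathfinish (G (turning \<gamma>))" using A by simp
  qed
qed

section \<open>Curves developed from their radius of curvature\<close>

lemma has_deriv01_cis: "has_deriv01 (\<lambda>p. cis (a + p * b)) (\<lambda>p. of_real b * \<i> * cis (a + p * b))"
  unfolding has_deriv01_def has_vector_derivative_complex_iff
  by (auto intro!: derivative_eq_intros)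

lemma Ck_cis: "Ck k (\<lambda>p. cis (a + p * b))"
proof -
  note d = has_deriv01_cis[of a b]
  show ?thesis
    unfolding Ck_iff_tendsto
  proof (induction k)
    case 0
    then show ?case
      by (auto simp: C0_tendsto_def uniform_limit_const has_deriv01_continuous[OF d])
  next
    case (Suc k)
    have "Ck_tendsto k (top::unit filter) (\<lambda>_ p. of_real b * \<i> * cis (a + p * b)) (\<lambda>p. of_real b * \<i> * cis (a + p * b))"
      by (intro Ck_tendsto_mult[OF Ck_tendsto_const Suc.IH]) auto
    then show ?case by (intro Ck_tendsto_SucI[OF _ d]) (auto simp: d uniform_limit_const)
  qed
qed

text \<open>The parameter \<open>p \<in> [0,1]\<close> is proportional to the direction, which is \<open>\<theta> + p \<Omega>\<close>. The function
  \<open>\<rho>\<close> is the speed with respect to \<open>p\<close>, hence \<open>\<Omega>\<close> times the signed Euclidean radius of curvature.\<close>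

definition developed :: "complex \<Rightarrow> real \<Rightarrow> real \<Rightarrow> (real \<Rightarrow> real) \<Rightarrow> real \<Rightarrow> complex" where
  "developed z \<theta> \<Omega> \<rho> p = z + integral {0..p} (\<lambda>p. of_real (\<rho> p) * cis (\<theta> + p * \<Omega>))"

text \<open>A curve that has speed \<open>b p\<close> when its direction is \<open>\<theta> + p \<Omega>\<close> reaches that direction at the
  time \<open>\<integral>\<rho>/b\<close>; \<open>retiming\<close> scales the total time to 1, which multiplies the speed by
  \<open>total_time\<close>.\<close>

definition total_time :: "(real \<Rightarrow> real) \<Rightarrow> (real \<Rightarrow> real) \<Rightarrow> real" where
  "total_time \<rho> b = integral {0..1} (\<lambda>p. \<rho> p / b p)"

definition retiming :: "(real \<Rightarrow> real) \<Rightarrow> (real \<Rightarrow> real) \<Rightarrow> real \<Rightarrow> real" where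
  "retiming \<rho> b p = integral {0..p} (\<lambda>p. \<rho> p / b p) / total_time \<rho> b"

text \<open>The developed curve, traversed with the speeds prescribed by \<open>b\<close>. It is given as the primitive of its
  velocity instead of as \<open>developed\<close> composed with the inverse of \<open>retiming\<close>: for a \<open>C\<^sup>r\<close> curve
  \<open>\<rho>\<close> is only \<open>C\<^sup>r\<^sup>-\<^sup>2\<close>, whereas \<open>b\<close> is \<open>C\<^sup>r\<^sup>-\<^sup>1\<close>. The clock is an integral of \<open>\<rho>/b\<close>,
  hence \<open>C\<^sup>r\<^sup>-\<^sup>1\<close>, as is the velocity, and the primitive recovers all \<open>r\<close> derivatives.\<close>

definition angle_curve ::
  "complex \<Rightarrow> real \<Rightarrow> real \<Rightarrow> (real \<Rightarrow> real) \<Rightarrow> (real \<Rightarrow> real) \<Rightarrow> real \<Rightarrow> complex" where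
  "angle_curve z \<theta> \<Omega> \<rho> b = restrict (\<lambda>t. z + integral {0..t} (\<lambda>t.
     of_real (total_time \<rho> b * b (inv01 (retiming \<rho> b) t)) * cis (\<theta> + inv01 (retiming \<rho> b) t * \<Omega>))) {0..1}"

lemma integral_pos01:
  fixes f :: "real \<Rightarrow> real"
  assumes "continuous_on {0..1} f" "\<And>p. p \<in> {0..1} \<Longrightarrow> f p > 0"
  shows "integral {0..1} f > 0"
proof -
  obtain b where b: "b > 0" "\<And>t. t \<in> {0..1} \<Longrightarrow> b \<le> f t"
    using continuous_bounded_below[OF assms] by blast
  have "integral {0..1} (\<lambda>t::real. b) \<le> integral {0..1} f"
    by (rule integral_le) (auto intro!: integrable_continuous_real assms b(2))
  then show ?thesis using b(1) by simp
qed

lemma retiming_diffeo: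
  assumes c: "continuous_on {0..1} \<rho>" "continuous_on {0..1} b"
    and p: "\<And>p. p \<in> {0..1} \<Longrightarrow> \<rho> p > 0" "\<And>p. p \<in> {0..1} \<Longrightarrow> b p > 0"
  shows "total_time \<rho> b > 0" "diffeo01 (retiming \<rho> b)"
    "has_deriv01 (retiming \<rho> b) (\<lambda>p. \<rho> p / (total_time \<rho> b * b p))"
proof -
  have cq: "continuous_on {0..1} (\<lambda>p. \<rho> p / b p)"
    by (intro continuous_on_divide c) (use p in force)
  show N: "total_time \<rho> b > 0"
    unfolding total_time_def by (rule integral_pos01[OF cq]) (use p in force)
  have "has_deriv01 (\<lambda>p. integral {0..p} (\<lambda>p. \<rho> p / b p) / total_time \<rho> b) (\<lambda>p. \<rho> p / b p / total_time \<rho> b)"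
    by (rule bounded_linear.has_deriv01[OF bounded_linear_divide has_deriv01_integral[OF cq]])
  then show d: "has_deriv01 (retiming \<rho> b) (\<lambda>p. \<rho> p / (total_time \<rho> b * b p))"
    unfolding retiming_def by (simp add: mult.commute)
  show "diffeo01 (retiming \<rho> b)"
    unfolding diffeo01_def
  proof (intro conjI exI[of _ "\<lambda>p. \<rho> p / (total_time \<rho> b * b p)"] d ballI)
    show "retiming \<rho> b 1 = 1" using N by (simp add: retiming_def total_time_def)
  qed (use p N in \<open>auto simp: retiming_def\<close>)
qed

locale development =
  fixes z :: complex and \<theta> \<Omega> :: real and \<rho> b b' :: "real \<Rightarrow> real"
  assumes c\<rho>: "continuous_on {0..1} \<rho>" and db: "has_deriv01 b b'"
    and \<rho>: "\<And>p. p \<in> {0..1} \<Longrightarrow> \<rho> p > 0" and b: "\<And>p. p \<in> {0..1} \<Longrightarrow> b p > 0"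
begin

abbreviation "N \<equiv> total_time \<rho> b"
abbreviation "T \<equiv> retiming \<rho> b"
abbreviation "f \<equiv> angle_curve z \<theta> \<Omega> \<rho> b"
abbreviation "W \<equiv> \<lambda>p. of_real (N * b p) * cis (\<theta> + p * \<Omega>)"
abbreviation "f2 \<equiv> \<lambda>t. (N * b (inv01 T t) / \<rho> (inv01 T t)) *\<^sub>R ((of_real (N * b' (inv01 T t)) + of_real (N * b (inv01 T t) * \<Omega>) * \<i>) * cis (\<theta> + inv01 T t * \<Omega>))"

lemmas cb = has_deriv01_continuous[OF db]

lemma N: "N > 0" and T: "diffeo01 T" and dT: "has_deriv01 T (\<lambda>p. \<rho> p / (N * b p))"
  by (rule retiming_diffeo[OF c\<rho> cb]; fact \<rho> b)+

lemma dT_pos: "p \<in> {0..1} \<Longrightarrow> \<rho> p / (N * b p) > 0"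
  using \<rho> b N by simp

lemma W_deriv: "has_deriv01 W (\<lambda>p. (of_real (N * b' p) + of_real (N * b p * \<Omega>) * \<i>) * cis (\<theta> + p * \<Omega>))"
proof -
  have "has_deriv01 (\<lambda>p. N * b p) (\<lambda>p. N * b' p)"
    by (rule bounded_linear.has_deriv01[OF bounded_linear_mult_right db])
  from bounded_bilinear.has_deriv01[OF bounded_bilinear_mult
      bounded_linear.has_deriv01[OF bounded_linear_of_real this] has_deriv01_cis]
  show ?thesis by (rule has_deriv01_cong) (auto simp: algebra_simps)
qed

lemma f_deriv: "has_deriv01 f (\<lambda>t. W (inv01 T t))"
proof -
  have "continuous_on {0..1} (\<lambda>t. W (inv01 T t))"
    using inv01_in[OF T] by (intro continuous_on_compose2[OF has_deriv01_continuous[OF W_deriv] inv01_continuous[OF T]]) auto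
  from has_deriv01_integral[OF this]
  have "has_deriv01 (\<lambda>t. z + integral {0..t} (\<lambda>t. W (inv01 T t))) (\<lambda>t. 0 + W (inv01 T t))"
    by (intro has_deriv01_add has_deriv01_const)
  then show ?thesis by (rule has_deriv01_cong) (auto simp: angle_curve_def)
qed

lemma f_deriv2: "has_deriv01 (\<lambda>t. W (inv01 T t))
    (\<lambda>t. f2 t)"
  by (rule has_deriv01_cong[OF has_deriv01_compose_inv01[OF T dT dT_pos W_deriv]]) auto

lemma developed_deriv: "has_deriv01 (developed z \<theta> \<Omega> \<rho>) (\<lambda>p. of_real (\<rho> p) * cis (\<theta> + p * \<Omega>))"
proof -
  have "continuous_on {0..1} (\<lambda>p. of_real (\<rho> p) * cis (\<theta> + p * \<Omega>))"
    by (intro continuous_intros c\<rho>)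
  from has_deriv01_add[OF has_deriv01_const has_deriv01_integral[OF this], of z]
  show ?thesis by (simp add: developed_def[abs_def])
qed

lemma f_eq_developed: assumes t: "t \<in> {0..1}" shows "f t = developed z \<theta> \<Omega> \<rho> (inv01 T t)"
proof (rule has_deriv01_unique[OF f_deriv _ _ t])
  show "has_deriv01 (\<lambda>t. developed z \<theta> \<Omega> \<rho> (inv01 T t)) (\<lambda>t. W (inv01 T t))"
  proof (rule has_deriv01_cong[OF has_deriv01_compose_inv01[OF T dT dT_pos developed_deriv]])
    fix s :: real assume "s \<in> {0..1}"
    then show "inverse (\<rho> (inv01 T s) / (N * b (inv01 T s))) *\<^sub>R
         (of_real (\<rho> (inv01 T s)) * cis (\<theta> + inv01 T s * \<Omega>)) = W (inv01 T s)"
      using \<rho>[OF inv01_in[OF T]] by (simp add: scaleR_conv_of_real less_imp_neq[symmetric])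
  qed auto
  show "f 0 = developed z \<theta> \<Omega> \<rho> (inv01 T 0)"
    by (simp add: angle_curve_def developed_def inv01_0[OF T])
qed

lemma f_turn:
  assumes "t \<in> {0..1}"
  shows "Im (f2 t / W (inv01 T t)) = \<Omega> * (N * b (inv01 T t) / \<rho> (inv01 T t))"
proof -
  define p where "p = inv01 T t"
  have p: "b p > 0" "\<rho> p > 0" using b \<rho> inv01_in[OF T assms] by (auto simp: p_def)
  have "((N * b p / \<rho> p) *\<^sub>R ((of_real (N * b' p) + of_real (N * b p * \<Omega>) * \<i>) * cis (\<theta> + p * \<Omega>))) / W p
      = of_real (N * b p / \<rho> p) * (of_real (b' p / b p) + of_real \<Omega> * \<i>)"
    using p N by (simp add: scaleR_conv_of_real field_simps)
  then show ?thesis by (simp add: p_def)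
qed

lemma angle_curve_in_curve_space:
  assumes r: "r = Suc (Suc q)" and ck: "Ck r f"
    and pos: "\<And>p. p \<in> {0..1} \<Longrightarrow> Im (developed z \<theta> \<Omega> \<rho> p) > 0"
    and e: "developed z \<theta> \<Omega> \<rho> 1 = z1" "cis (\<theta> + \<Omega>) = cis \<theta>1"
    and k: "\<And>p. p \<in> {0..1} \<Longrightarrow> \<kappa>1 < ereal (cos (\<theta> + p * \<Omega>) + Im (developed z \<theta> \<Omega> \<rho> p) * \<Omega> / \<rho> p)"
      "\<And>p. p \<in> {0..1} \<Longrightarrow> ereal (cos (\<theta> + p * \<Omega>) + Im (developed z \<theta> \<Omega> \<rho> p) * \<Omega> / \<rho> p) < \<kappa>2"
  shows "f \<in> curve_space r \<kappa>1 \<kappa>2 (frame (z, \<theta>)) (frame (z1, \<theta>1))" "turning f = \<Omega>"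
proof -
  have K: "half_plane_curvature (f t) (W (inv01 T t)) (f2 t) =
      cos (\<theta> + inv01 T t * \<Omega>) + Im (developed z \<theta> \<Omega> \<rho> (inv01 T t)) * \<Omega> / \<rho> (inv01 T t)"
    if t: "t \<in> {0..1}" for t
  proof -
    define p where "p = inv01 T t"
    have p: "b p > 0" "\<rho> p > 0" using b \<rho> inv01_in[OF T t] by (auto simp: p_def)
    show ?thesis
      unfolding half_plane_curvature_def f_turn[OF t] f_eq_developed[OF t] unfolding p_def[symmetric]
      using p N by (simp add: norm_mult field_simps)
  qed
  have ends: "f 0 = z" "f 1 = z1"
    using f_eq_developed[of 0] f_eq_developed[of 1] e by (auto simp: inv01_0[OF T] inv01_1[OF T] developed_def)
  show "f \<in> curve_space r \<kappa>1 \<kappa>2 (frame (z, \<theta>)) (frame (z1, \<theta>1))"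
  proof (rule curve_spaceI[OF f_deriv f_deriv2 r ck])
    show "f \<in> extensional {0..1}" by (simp add: angle_curve_def)
    fix t :: real assume t: "t \<in> {0..1}"
    show "0 < Im (f t)" using pos inv01_in[OF T t] by (simp add: f_eq_developed[OF t])
    show "W (inv01 T t) \<noteq> 0" using b[OF inv01_in[OF T t]] N by simp
  next
    show "Im (f 0) *\<^sub>R W (inv01 T 0) = cmod (W (inv01 T 0)) *\<^sub>R snd (frame (z, \<theta>))"
      using b[of 0] N by (simp add: ends frame_def inv01_0[OF T] norm_mult scaleR_conv_of_real mult_ac)
    show "Im (f 1) *\<^sub>R W (inv01 T 1) = cmod (W (inv01 T 1)) *\<^sub>R snd (frame (z1, \<theta>1))"
      using b[of 1] N by (simp add: ends frame_def inv01_1[OF T] norm_mult scaleR_conv_of_real mult_ac e)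
  next
    fix t :: real assume t: "t \<in> {0..1}"
    show "\<kappa>1 < ereal (half_plane_curvature (f t) (W (inv01 T t)) (f2 t))"
      unfolding K[OF t] by (rule k(1)[OF inv01_in[OF T t]])
    show "ereal (half_plane_curvature (f t) (W (inv01 T t)) (f2 t)) < \<kappa>2"
      unfolding K[OF t] by (rule k(2)[OF inv01_in[OF T t]])
  qed (auto simp: ends frame_def)
  have "turning f = integral {0..1} (\<lambda>t. \<Omega> * (N * b (inv01 T t) / \<rho> (inv01 T t)))"
    unfolding turning_def turn_rate_def
  proof (rule integral_cong)
    fix t :: real assume t: "t \<in> {0..1}"
    have "has_deriv01 (deriv01 f) (\<lambda>t. f2 t)"
      by (rule has_deriv01_cong[OF f_deriv2]) (auto simp: has_deriv01_imp_deriv01[OF f_deriv])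
    from has_deriv01_imp_deriv01[OF this t] has_deriv01_imp_deriv01[OF f_deriv t] f_turn[OF t]
    show "Im (deriv01 (deriv01 f) t / deriv01 f t) = \<Omega> * (N * b (inv01 T t) / \<rho> (inv01 T t))"
      by simp
  qed
  also have "\<dots> = \<Omega> * integral {0..1} (\<lambda>t. N * b (inv01 T t) / \<rho> (inv01 T t))"
    by (rule integral_mult_right)
  also have "integral {0..1} (\<lambda>t. N * b (inv01 T t) / \<rho> (inv01 T t)) = 1"
  proof -
    have "has_deriv01 (inv01 T) (\<lambda>t. N * b (inv01 T t) / \<rho> (inv01 T t))"
      by (rule has_deriv01_cong[OF has_deriv01_inv01[OF T dT dT_pos]]) auto
    from has_deriv01_has_integral[OF this, of 1] show ?thesis
      by (simp add: inv01_0[OF T] inv01_1[OF T] integral_unique)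
  qed
  finally show "turning f = \<Omega>" by simp
qed

end

lemma Ck_tendsto_angle_curve:
  assumes \<rho>: "Ck_tendsto q F \<rho> \<rho>0" and b: "Ck_tendsto (Suc q) F b b0"
    and pos: "\<And>p. p \<in> {0..1} \<Longrightarrow> \<rho>0 p > 0" "\<And>p. p \<in> {0..1} \<Longrightarrow> b0 p > 0"
  shows "Ck_tendsto (Suc (Suc q)) F (\<lambda>i. angle_curve z \<theta> \<Omega> (\<rho> i) (b i)) (angle_curve z \<theta> \<Omega> \<rho>0 b0)"
proof -
  have b1: "Ck_tendsto q F b b0" by (rule Ck_tendsto_Suc_mono[OF b])
  have Q: "Ck_tendsto q F (\<lambda>i p. \<rho> i p / b i p) (\<lambda>p. \<rho>0 p / b0 p)"
    by (rule Ck_tendsto_divide[OF \<rho> b1]) (use pos in force)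
  have I: "Ck_tendsto (Suc q) F (\<lambda>i t. integral {0..t} (\<lambda>p. \<rho> i p / b i p)) (\<lambda>t. integral {0..t} (\<lambda>p. \<rho>0 p / b0 p))"
    by (rule Ck_tendsto_integral[OF Q])
  have N: "((\<lambda>i. total_time (\<rho> i) (b i)) \<longlongrightarrow> total_time \<rho>0 b0) F"
    unfolding total_time_def by (rule C0_tendsto_at[OF Ck_tendsto_C0[OF I]]) simp
  have c0: "continuous_on {0..1} \<rho>0" "continuous_on {0..1} b0"
    using Ck_tendsto_C0[OF \<rho>] Ck_tendsto_C0[OF b] by (auto simp: C0_tendsto_def)
  have d0: "total_time \<rho>0 b0 > 0" "diffeo01 (retiming \<rho>0 b0)"
    by (rule retiming_diffeo[OF c0]; fact pos)+
  have evp: "\<forall>\<^sub>F i in F. \<forall>p\<in>{0..1}. \<rho> i p > 0" "\<forall>\<^sub>F i in F. \<forall>p\<in>{0..1}. b i p > 0"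
    by (rule C0_tendsto_eventually_pos[OF Ck_tendsto_C0[OF \<rho>]], fact pos,
        rule C0_tendsto_eventually_pos[OF Ck_tendsto_C0[OF b]], fact pos)
  have ev: "\<forall>\<^sub>F i in F. diffeo01 (retiming (\<rho> i) (b i))"
    using evp Ck_tendsto_C0[OF \<rho>, unfolded C0_tendsto_def, THEN conjunct1]
      Ck_tendsto_C0[OF b, unfolded C0_tendsto_def, THEN conjunct1]
    by eventually_elim (rule retiming_diffeo, auto)
  have T: "Ck_tendsto (Suc q) F (\<lambda>i. retiming (\<rho> i) (b i)) (retiming \<rho>0 b0)"
    unfolding retiming_def using d0(1) by (intro Ck_tendsto_divide I Ck_tendsto_const N) auto
  have W: "Ck_tendsto (Suc q) F (\<lambda>i p. of_real (total_time (\<rho> i) (b i) * b i p) * cis (\<theta> + p * \<Omega>))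
      (\<lambda>p. of_real (total_time \<rho>0 b0 * b0 p) * cis (\<theta> + p * \<Omega>))"
    by (intro Ck_tendsto_mult Ck_tendsto_of_real Ck_tendsto_const N b Ck_tendsto_const_family Ck_cis)
  have "Ck_tendsto (Suc (Suc q)) F (\<lambda>i t. z + integral {0..t} (\<lambda>t.
     of_real (total_time (\<rho> i) (b i) * b i (inv01 (retiming (\<rho> i) (b i)) t)) * cis (\<theta> + inv01 (retiming (\<rho> i) (b i)) t * \<Omega>)))
     (\<lambda>t. z + integral {0..t} (\<lambda>t. of_real (total_time \<rho>0 b0 * b0 (inv01 (retiming \<rho>0 b0) t)) * cis (\<theta> + inv01 (retiming \<rho>0 b0) t * \<Omega>)))"
    by (intro Ck_tendsto_add Ck_tendsto_const tendsto_const Ck_tendsto_integral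
        Ck_tendsto_compose_inv01[OF W T order_refl _ d0(2) ev]) simp
  then show ?thesis
    by (rule Ck_tendsto_cong) (auto simp: angle_curve_def)
qed

lemma Ck_angle_curve:
  assumes "Ck q \<rho>" "Ck (Suc q) b" "\<And>p. p \<in> {0..1} \<Longrightarrow> \<rho> p > 0" "\<And>p. p \<in> {0..1} \<Longrightarrow> b p > 0"
  shows "Ck (Suc (Suc q)) (angle_curve z \<theta> \<Omega> \<rho> b)"
  using assms unfolding Ck_iff_tendsto by (rule Ck_tendsto_angle_curve)

text \<open>Conditions on the radius function alone: the timing affects neither the curvature nor the ends.\<close>

definition admissible ::
  "nat \<Rightarrow> ereal \<Rightarrow> ereal \<Rightarrow> complex \<Rightarrow> real \<Rightarrow> real \<Rightarrow> complex \<Rightarrow> (real \<Rightarrow> real) \<Rightarrow> bool" where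
  "admissible q \<kappa>1 \<kappa>2 z \<theta> \<Omega> z1 \<rho> \<longleftrightarrow> Ck q \<rho> \<and> developed z \<theta> \<Omega> \<rho> 1 = z1 \<and>
     (\<forall>p\<in>{0..1}. \<rho> p > 0 \<and> Im (developed z \<theta> \<Omega> \<rho> p) > 0 \<and>
       \<kappa>1 < ereal (cos (\<theta> + p * \<Omega>) + Im (developed z \<theta> \<Omega> \<rho> p) * \<Omega> / \<rho> p) \<and>
       ereal (cos (\<theta> + p * \<Omega>) + Im (developed z \<theta> \<Omega> \<rho> p) * \<Omega> / \<rho> p) < \<kappa>2)"

lemma angle_curve_admissible:
  assumes adm: "admissible q \<kappa>1 \<kappa>2 z \<theta> \<Omega> z1 \<rho>" and Ckb: "Ck (Suc q) b" "\<And>p. p \<in> {0..1} \<Longrightarrow> b p > 0"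
    and e: "cis (\<theta> + \<Omega>) = cis \<theta>1" and r: "r = Suc (Suc q)"
  shows "angle_curve z \<theta> \<Omega> \<rho> b \<in> curve_space r \<kappa>1 \<kappa>2 (frame (z, \<theta>)) (frame (z1, \<theta>1))"
    "turning (angle_curve z \<theta> \<Omega> \<rho> b) = \<Omega>"
proof -
  have a: "Ck q \<rho>" "\<And>p. p \<in> {0..1} \<Longrightarrow> \<rho> p > 0" using adm by (auto simp: admissible_def)
  interpret development z \<theta> \<Omega> \<rho> b "deriv01 b"
    by standard (auto intro: a Ck_continuous Ck_has_deriv01[OF Ckb(1)] Ckb(2))
  have "Ck r (angle_curve z \<theta> \<Omega> \<rho> b)" unfolding r by (rule Ck_angle_curve[OF a(1) Ckb(1)]; fact a Ckb)
  from angle_curve_in_curve_space[OF r this _ _ e, of z1 \<kappa>1 \<kappa>2] adm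
  show "angle_curve z \<theta> \<Omega> \<rho> b \<in> curve_space r \<kappa>1 \<kappa>2 (frame (z, \<theta>)) (frame (z1, \<theta>1))"
    "turning (angle_curve z \<theta> \<Omega> \<rho> b) = \<Omega>"
    unfolding admissible_def by blast+
qed

text \<open>The middle fraction is a convex combination of \<open>a / b\<close> and \<open>c / d\<close>, with weights proportional to
  \<open>(1 - s) b\<close> and \<open>s d\<close>.\<close>

lemma mediant_bounds:
  fixes a b c d s :: real
  assumes "b > 0" "d > 0" "0 \<le> s" "s \<le> 1"
  shows "min (a / b) (c / d) \<le> ((1 - s) * a + s * c) / ((1 - s) * b + s * d)"
    "((1 - s) * a + s * c) / ((1 - s) * b + s * d) \<le> max (a / b) (c / d)"
proof -
  have p: "(1 - s) * b + s * d > 0"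
    using assms by (cases "s = 0") (auto intro: add_nonneg_pos)
  have x: "(a / b) * b = a" "(c / d) * d = c" using assms by auto
  have "min (a / b) (c / d) * ((1 - s) * b + s * d) = (1 - s) * (min (a/b) (c/d) * b) + s * (min (a/b) (c/d) * d)"
    by (simp add: algebra_simps)
  also have "\<dots> \<le> (1 - s) * (a / b * b) + s * (c / d * d)"
    using assms by (intro add_mono mult_left_mono mult_right_mono) auto
  finally show "min (a / b) (c / d) \<le> ((1 - s) * a + s * c) / ((1 - s) * b + s * d)"
    using p x by (simp add: pos_le_divide_eq)
  have "(1 - s) * (a / b * b) + s * (c / d * d) \<le> (1 - s) * (max (a/b) (c/d) * b) + s * (max (a/b) (c/d) * d)"
    using assms by (intro add_mono mult_left_mono mult_right_mono) auto
  also have "\<dots> = max (a / b) (c / d) * ((1 - s) * b + s * d)"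
    by (simp add: algebra_simps)
  finally show "((1 - s) * a + s * c) / ((1 - s) * b + s * d) \<le> max (a / b) (c / d)"
    using p x by (simp add: pos_divide_le_eq)
qed

lemma developed_affine:
  assumes "continuous_on {0..1} \<rho>" "continuous_on {0..1} \<sigma>" "p \<in> {0..1}"
  shows "developed z \<theta> \<Omega> (\<lambda>p. (1 - s) * \<rho> p + s * \<sigma> p) p =
    of_real (1 - s) * developed z \<theta> \<Omega> \<rho> p + of_real s * developed z \<theta> \<Omega> \<sigma> p"
proof -
  have i: "(\<lambda>p. of_real (\<tau> p) * cis (\<theta> + p * \<Omega>)) integrable_on {0..p}" if "continuous_on {0..1} \<tau>" for \<tau>
    by (rule integrable_01[OF _ assms(3)]) (intro continuous_intros that)
  have "integral {0..p} (\<lambda>p. of_real ((1 - s) * \<rho> p + s * \<sigma> p) * cis (\<theta> + p * \<Omega>)) =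
     integral {0..p} (\<lambda>p. of_real (1 - s) * (of_real (\<rho> p) * cis (\<theta> + p * \<Omega>)) + of_real s * (of_real (\<sigma> p) * cis (\<theta> + p * \<Omega>)))"
    by (rule integral_cong) (simp add: algebra_simps)
  also have "\<dots> = of_real (1 - s) * integral {0..p} (\<lambda>p. of_real (\<rho> p) * cis (\<theta> + p * \<Omega>)) +
      of_real s * integral {0..p} (\<lambda>p. of_real (\<sigma> p) * cis (\<theta> + p * \<Omega>))"
    by (subst integral_add) (auto intro!: integrable_on_mult_right i assms)
  finally show ?thesis unfolding developed_def by (simp add: algebra_simps)
qed

lemma Ck_affine:
  fixes f g :: "real \<Rightarrow> real"
  assumes "Ck k f" "Ck k g" shows "Ck k (\<lambda>p. (1 - s) * f p + s * g p)"
  using assms unfolding Ck_iff_tendsto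
  by (intro Ck_tendsto_add Ck_tendsto_mult Ck_tendsto_const tendsto_const)

lemma Ck_tendsto_affine:
  fixes f g :: "'i \<Rightarrow> real \<Rightarrow> real"
  assumes "(s \<longlongrightarrow> s0) F" "Ck_tendsto k F f f0" "Ck_tendsto k F g g0"
  shows "Ck_tendsto k F (\<lambda>i p. (1 - s i) * f i p + s i * g i p) (\<lambda>p. (1 - s0) * f0 p + s0 * g0 p)"
  using assms by (intro Ck_tendsto_add Ck_tendsto_mult Ck_tendsto_const tendsto_diff tendsto_const)

text \<open>Both \<open>\<rho>\<close> and the height \<open>y\<close> of the developed curve are affine in \<open>\<rho>\<close>, and the curvature at the parameter
  \<open>p\<close> is a constant plus \<open>y \<Omega> / \<rho>\<close>. So it lies between the two given curvatures by the
  mediant inequality.\<close>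

lemma admissible_convex:
  assumes a: "admissible q \<kappa>1 \<kappa>2 z \<theta> \<Omega> z1 \<rho>" "admissible q \<kappa>1 \<kappa>2 z \<theta> \<Omega> z1 \<sigma>" and s: "0 \<le> s" "s \<le> 1"
  shows "admissible q \<kappa>1 \<kappa>2 z \<theta> \<Omega> z1 (\<lambda>p. (1 - s) * \<rho> p + s * \<sigma> p)"
  unfolding admissible_def
proof (intro conjI ballI)
  have c: "continuous_on {0..1} \<rho>" "continuous_on {0..1} \<sigma>" using a by (auto simp: admissible_def intro: Ck_continuous)
  show "Ck q (\<lambda>p. (1 - s) * \<rho> p + s * \<sigma> p)" using a by (auto simp: admissible_def intro: Ck_affine)
  show "developed z \<theta> \<Omega> (\<lambda>p. (1 - s) * \<rho> p + s * \<sigma> p) 1 = z1"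
    using a by (subst developed_affine[OF c]) (auto simp: admissible_def algebra_simps)
  fix p :: real assume p: "p \<in> {0..1}"
  define Y where "Y = (\<lambda>\<rho>. Im (developed z \<theta> \<Omega> \<rho> p))"
  define c where "c = cos (\<theta> + p * \<Omega>)"
  have A: "\<rho> p > 0" "\<sigma> p > 0" "Y \<rho> > 0" "Y \<sigma> > 0" "\<kappa>1 < ereal (c + Y \<rho> * \<Omega> / \<rho> p)" "ereal (c + Y \<rho> * \<Omega> / \<rho> p) < \<kappa>2"
    "\<kappa>1 < ereal (c + Y \<sigma> * \<Omega> / \<sigma> p)" "ereal (c + Y \<sigma> * \<Omega> / \<sigma> p) < \<kappa>2"
    using a p unfolding admissible_def Y_def c_def by blast+
  have pos: "(1 - s) * x + s * y > 0" if "x > 0" "y > 0" for x y :: real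
    using s that by (cases "s = 0") (auto intro: add_nonneg_pos)
  have Y: "Y (\<lambda>p. (1 - s) * \<rho> p + s * \<sigma> p) = (1 - s) * Y \<rho> + s * Y \<sigma>"
    unfolding Y_def by (subst developed_affine[OF c p]) simp
  show "(1 - s) * \<rho> p + s * \<sigma> p > 0" using A pos by blast
  show "Im (developed z \<theta> \<Omega> (\<lambda>p. (1 - s) * \<rho> p + s * \<sigma> p) p) > 0" using Y A pos unfolding Y_def by metis
  have e: "((1 - s) * Y \<rho> + s * Y \<sigma>) * \<Omega> = (1 - s) * (Y \<rho> * \<Omega>) + s * (Y \<sigma> * \<Omega>)" by (simp add: algebra_simps)
  note m = mediant_bounds[OF A(1,2) s, of "Y \<rho> * \<Omega>" "Y \<sigma> * \<Omega>"]
  let ?x = "c + ((1 - s) * Y \<rho> + s * Y \<sigma>) * \<Omega> / ((1 - s) * \<rho> p + s * \<sigma> p)"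
  have "min (c + Y \<rho> * \<Omega> / \<rho> p) (c + Y \<sigma> * \<Omega> / \<sigma> p) \<le> ?x" using m(1) unfolding e by linarith
  moreover have "\<kappa>1 < ereal (min (c + Y \<rho> * \<Omega> / \<rho> p) (c + Y \<sigma> * \<Omega> / \<sigma> p))" using A by (simp add: min_def)
  ultimately have "\<kappa>1 < ereal ?x" by (meson ereal_less_eq(3) less_le_trans)
  then show "\<kappa>1 < ereal (cos (\<theta> + p * \<Omega>) + Im (developed z \<theta> \<Omega> (\<lambda>p. (1 - s) * \<rho> p + s * \<sigma> p) p) * \<Omega> / ((1 - s) * \<rho> p + s * \<sigma> p))"
    unfolding Y[unfolded Y_def] Y_def c_def .
  have "?x \<le> max (c + Y \<rho> * \<Omega> / \<rho> p) (c + Y \<sigma> * \<Omega> / \<sigma> p)" using m(2) unfolding e by linarith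
  moreover have "ereal (max (c + Y \<rho> * \<Omega> / \<rho> p) (c + Y \<sigma> * \<Omega> / \<sigma> p)) < \<kappa>2" using A by (simp add: max_def)
  ultimately have "ereal ?x < \<kappa>2" by (meson ereal_less_eq(3) le_less_trans)
  then show "ereal (cos (\<theta> + p * \<Omega>) + Im (developed z \<theta> \<Omega> (\<lambda>p. (1 - s) * \<rho> p + s * \<sigma> p) p) * \<Omega> / ((1 - s) * \<rho> p + s * \<sigma> p)) < \<kappa>2"
    unfolding Y[unfolded Y_def] Y_def c_def .
qed

section \<open>Contracting a class of locally convex curves\<close>

text \<open>The inverse of \<open>angle_curve\<close>: the radius function and the speeds of a given curve of total turning \<open>\<Omega>\<close>,
  as functions of its direction.\<close>

definition relative_angle :: "real \<Rightarrow> (real \<Rightarrow> complex) \<Rightarrow> real \<Rightarrow> real" where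
  "relative_angle \<Omega> \<gamma> t = integral {0..t} (turn_rate \<gamma>) / \<Omega>"

definition speed_at_angle :: "real \<Rightarrow> (real \<Rightarrow> complex) \<Rightarrow> real \<Rightarrow> real" where
  "speed_at_angle \<Omega> \<gamma> p = cmod (deriv01 \<gamma> (inv01 (relative_angle \<Omega> \<gamma>) p))"

definition radius_at_angle :: "real \<Rightarrow> (real \<Rightarrow> complex) \<Rightarrow> real \<Rightarrow> real" where
  "radius_at_angle \<Omega> \<gamma> p = (let t = inv01 (relative_angle \<Omega> \<gamma>) p in cmod (deriv01 \<gamma> t) * \<Omega> / turn_rate \<gamma> t)"

context
  fixes r q :: nat and \<kappa>1 \<kappa>2 :: ereal and z0 z1 :: complex and \<theta>0 \<theta>1 \<Omega> :: real
  assumes r: "r = Suc (Suc q)"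
begin

abbreviation (input) "curves \<equiv> curve_space r \<kappa>1 \<kappa>2 (frame (z0, \<theta>0)) (frame (z1, \<theta>1))"

abbreviation (input) "turn_class \<equiv> {\<gamma> \<in> curves.
    turning \<gamma> = \<Omega> \<and> (\<forall>t\<in>{0..1}. turn_rate \<gamma> t / \<Omega> > 0)}"

lemma Ck_tendsto_turn_rate:
  assumes "\<gamma> \<in> curve_space r \<kappa>1 \<kappa>2 u v" "Ck_tendsto r F \<gamma>s \<gamma>"
  shows "Ck_tendsto q F (\<lambda>i. turn_rate (\<gamma>s i)) (turn_rate \<gamma>)"
proof -
  have 1: "Ck_tendsto (Suc q) F (\<lambda>i. deriv01 (\<gamma>s i)) (deriv01 \<gamma>)"
    using assms(2) unfolding r by (rule Ck_tendsto_deriv01)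
  show ?thesis
    unfolding turn_rate_def using curve_spaceD(8)[OF assms(1) r]
    by (intro Ck_tendsto_Im Ck_tendsto_divide Ck_tendsto_deriv01[OF 1] Ck_tendsto_Suc_mono[OF 1])
qed

lemma turn_rate_Ck: "\<gamma> \<in> curve_space r \<kappa>1 \<kappa>2 u v \<Longrightarrow> Ck q (turn_rate \<gamma>)"
  using Ck_tendsto_limit[OF Ck_tendsto_turn_rate[OF _ Ck_tendsto_const_family[OF curve_spaceD(2)[OF _ r]]]] .

lemma relative_angle_diffeo:
  assumes "\<gamma> \<in> turn_class"
  shows "diffeo01 (relative_angle \<Omega> \<gamma>)" "has_deriv01 (relative_angle \<Omega> \<gamma>) (\<lambda>t. turn_rate \<gamma> t / \<Omega>)"
proof -
  have \<gamma>: "\<gamma> \<in> curves" using assms by auto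
  have c: "continuous_on {0..1} (turn_rate \<gamma>)" by (rule Ck_continuous[OF turn_rate_Ck[OF \<gamma>]])
  show d: "has_deriv01 (relative_angle \<Omega> \<gamma>) (\<lambda>t. turn_rate \<gamma> t / \<Omega>)"
    unfolding relative_angle_def by (rule bounded_linear.has_deriv01[OF bounded_linear_divide has_deriv01_integral[OF c]])
  have "\<Omega> \<noteq> 0" using assms by force
  moreover have "integral {0..1} (turn_rate \<gamma>) = \<Omega>"
    using assms by (simp add: turning_def)
  ultimately show "diffeo01 (relative_angle \<Omega> \<gamma>)"
    using d assms unfolding diffeo01_def by (auto simp: relative_angle_def)
qed

lemma Ck_tendsto_relative_angle:
  assumes "\<gamma> \<in> turn_class" "Ck_tendsto r F \<gamma>s \<gamma>"
  shows "Ck_tendsto (Suc q) F (\<lambda>i. relative_angle \<Omega> (\<gamma>s i)) (relative_angle \<Omega> \<gamma>)"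
proof -
  have "\<Omega> \<noteq> 0" using assms by force
  then show ?thesis
    unfolding relative_angle_def using assms
    by (intro Ck_tendsto_divide Ck_tendsto_integral Ck_tendsto_turn_rate Ck_tendsto_const tendsto_const) auto
qed

lemma Ck_tendsto_at_angle:
  assumes \<gamma>: "\<gamma> \<in> turn_class" and c: "Ck_tendsto r F \<gamma>s \<gamma>" and ev: "\<forall>\<^sub>F i in F. \<gamma>s i \<in> turn_class"
  shows "Ck_tendsto (Suc q) F (\<lambda>i. speed_at_angle \<Omega> (\<gamma>s i)) (speed_at_angle \<Omega> \<gamma>)"
    "Ck_tendsto q F (\<lambda>i. radius_at_angle \<Omega> (\<gamma>s i)) (radius_at_angle \<Omega> \<gamma>)"
proof -
  have \<gamma>': "\<gamma> \<in> curves" using \<gamma> by auto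
  note A = Ck_tendsto_relative_angle[OF \<gamma> c]
  note d = relative_angle_diffeo(1)[OF \<gamma>]
  have ed: "\<forall>\<^sub>F i in F. diffeo01 (relative_angle \<Omega> (\<gamma>s i))"
    using ev by eventually_elim (rule relative_angle_diffeo(1))
  have 1: "Ck_tendsto (Suc q) F (\<lambda>i t. cmod (deriv01 (\<gamma>s i) t)) (\<lambda>t. cmod (deriv01 \<gamma> t))"
    by (intro Ck_tendsto_cmod Ck_tendsto_deriv01 c[unfolded r] curve_spaceD(8)[OF \<gamma>' r])
  show "Ck_tendsto (Suc q) F (\<lambda>i. speed_at_angle \<Omega> (\<gamma>s i)) (speed_at_angle \<Omega> \<gamma>)"
    unfolding speed_at_angle_def[abs_def] by (rule Ck_tendsto_compose_inv01[OF 1 A order_refl _ d ed]) simp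
  have "Ck_tendsto q F (\<lambda>i t. cmod (deriv01 (\<gamma>s i) t) * \<Omega> / turn_rate (\<gamma>s i) t)
     (\<lambda>t. cmod (deriv01 \<gamma> t) * \<Omega> / turn_rate \<gamma> t)"
    using \<gamma> by (intro Ck_tendsto_divide Ck_tendsto_mult Ck_tendsto_Suc_mono[OF 1] Ck_tendsto_const tendsto_const
      Ck_tendsto_turn_rate[OF \<gamma>' c]) force
  then show "Ck_tendsto q F (\<lambda>i. radius_at_angle \<Omega> (\<gamma>s i)) (radius_at_angle \<Omega> \<gamma>)"
    unfolding radius_at_angle_def[abs_def] Let_def by (rule Ck_tendsto_compose_inv01[OF _ A _ _ d ed]) auto
qed

lemma radius_at_angle_admissible:
  assumes \<gamma>: "\<gamma> \<in> turn_class"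
  shows "admissible q \<kappa>1 \<kappa>2 z0 \<theta>0 \<Omega> z1 (radius_at_angle \<Omega> \<gamma>)"
    "Ck (Suc q) (speed_at_angle \<Omega> \<gamma>)" "\<And>p. p \<in> {0..1} \<Longrightarrow> speed_at_angle \<Omega> \<gamma> p > 0"
    "angle_curve z0 \<theta>0 \<Omega> (radius_at_angle \<Omega> \<gamma>) (speed_at_angle \<Omega> \<gamma>) = \<gamma>"
proof -
  have \<gamma>': "\<gamma> \<in> curves" using \<gamma> by auto
  have pos: "\<And>t. t \<in> {0..1} \<Longrightarrow> turn_rate \<gamma> t / \<Omega> > 0" using \<gamma> by auto
  note D = curve_spaceD[OF \<gamma>' r]
  note cf = Ck_tendsto_at_angle[OF \<gamma> Ck_tendsto_const_family[OF D(2), of "top::unit filter"] always_eventually[OF allI[OF \<gamma>]]]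
  define S where "S = inv01 (relative_angle \<Omega> \<gamma>)"
  note d = relative_angle_diffeo[OF \<gamma>]
  have S: "S p \<in> {0..1}" "relative_angle \<Omega> \<gamma> (S p) = p" if "p \<in> {0..1}" for p
    using inv01_in[OF d(1) that] inv01_right[OF d(1) that] by (auto simp: S_def)
  have dS: "diffeo01 S" unfolding S_def by (rule diffeo01_inv01[OF d(1)])
  have \<Omega>: "\<Omega> \<noteq> 0" using pos[of 0] by auto
  have rad: "radius_at_angle \<Omega> \<gamma> p = cmod (deriv01 \<gamma> (S p)) * inverse (turn_rate \<gamma> (S p) / \<Omega>)" for p
    by (simp add: radius_at_angle_def S_def Let_def divide_inverse)
  have spd: "speed_at_angle \<Omega> \<gamma> p = cmod (deriv01 \<gamma> (S p))" for p
    by (simp add: speed_at_angle_def S_def)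
  show ck: "Ck (Suc q) (speed_at_angle \<Omega> \<gamma>)" using cf(1) by (rule Ck_tendsto_limit)
  have ckr: "Ck q (radius_at_angle \<Omega> \<gamma>)" using cf(2) by (rule Ck_tendsto_limit)
  show sp: "speed_at_angle \<Omega> \<gamma> p > 0" if "p \<in> {0..1}" for p using D(8)[OF S(1)[OF that]] by (simp add: spd)
  have rp: "radius_at_angle \<Omega> \<gamma> p > 0" if "p \<in> {0..1}" for p
    unfolding rad using D(8)[OF S(1)[OF that]] pos[OF S(1)[OF that]] by (intro mult_pos_pos positive_imp_inverse_positive) auto
  interpret development z0 \<theta>0 \<Omega> "radius_at_angle \<Omega> \<gamma>" "speed_at_angle \<Omega> \<gamma>" "deriv01 (speed_at_angle \<Omega> \<gamma>)"
    by standard (auto intro: Ck_continuous[OF ckr] Ck_has_deriv01[OF ck] sp rp)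
  have dir: "deriv01 \<gamma> (S p) = cmod (deriv01 \<gamma> (S p)) * cis (\<theta>0 + p * \<Omega>)" if p: "p \<in> {0..1}" for p
  proof -
    have a: "angle \<theta>0 \<gamma> (S p) = \<theta>0 + p * \<Omega>"
      using S(2)[OF p] \<Omega> by (simp add: angle_def relative_angle_def field_simps)
    from deriv01_eq_cis_angle[OF \<gamma>' r S(1)[OF p]] show ?thesis unfolding a .
  qed
  have dev: "developed z0 \<theta>0 \<Omega> (radius_at_angle \<Omega> \<gamma>) p = \<gamma> (S p)" if p: "p \<in> {0..1}" for p
  proof (rule has_deriv01_unique[OF developed_deriv _ _ p])
    show "has_deriv01 (\<lambda>p. \<gamma> (S p)) (\<lambda>p. of_real (radius_at_angle \<Omega> \<gamma> p) * cis (\<theta>0 + p * \<Omega>))"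
    proof (rule has_deriv01_cong[OF has_deriv01_compose_inv01[OF d pos D(5)]])
      fix p :: real assume p: "p \<in> {0..1}"
      show "inverse (turn_rate \<gamma> (inv01 (relative_angle \<Omega> \<gamma>) p) / \<Omega>) *\<^sub>R deriv01 \<gamma> (inv01 (relative_angle \<Omega> \<gamma>) p) =
          of_real (radius_at_angle \<Omega> \<gamma> p) * cis (\<theta>0 + p * \<Omega>)"
        unfolding S_def[symmetric] by (subst dir[OF p]) (simp add: rad scaleR_conv_of_real)
    qed (auto simp: S_def)
    show "developed z0 \<theta>0 \<Omega> (radius_at_angle \<Omega> \<gamma>) 0 = \<gamma> (S 0)"
      using D(11) by (simp add: developed_def S_def inv01_0[OF d(1)] frame_def)
  qed
  have I: "integral {0..p} (\<lambda>p. radius_at_angle \<Omega> \<gamma> p / speed_at_angle \<Omega> \<gamma> p) = S p" if p: "p \<in> {0..1}" for p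
  proof -
    have "has_deriv01 S (\<lambda>p. radius_at_angle \<Omega> \<gamma> p / speed_at_angle \<Omega> \<gamma> p)"
      unfolding S_def
      by (rule has_deriv01_cong[OF has_deriv01_inv01[OF d pos]]) (use sp in \<open>auto simp: rad spd S_def\<close>)
    from integral_unique[OF has_deriv01_has_integral[OF this p]] show ?thesis
      using inv01_0[OF d(1)] by (simp add: S_def)
  qed
  have N1: "N = 1" using I[of 1] inv01_1[OF d(1)] by (simp add: total_time_def S_def)
  have TS: "T p = S p" if "p \<in> {0..1}" for p using I[OF that] by (simp add: retiming_def N1)
  show "f = \<gamma>"
  proof (rule extensionalityI[of _ "{0..1}"])
    show "f \<in> extensional {0..1}" by (simp add: angle_curve_def)
    show "\<gamma> \<in> extensional {0..1}" by (rule D(1))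
    fix t :: real assume t: "t \<in> {0..1}"
    have \<tau>: "relative_angle \<Omega> \<gamma> t \<in> {0..1}" by (rule diffeo01_in[OF d(1) t])
    have "T (relative_angle \<Omega> \<gamma> t) = t" by (simp add: TS[OF \<tau>] S_def inv01_left[OF d(1) t])
    then have "inv01 T t = relative_angle \<Omega> \<gamma> t" using inv01_left[OF T \<tau>] by simp
    then show "f t = \<gamma> t"
      by (simp add: f_eq_developed[OF t] dev[OF \<tau>] S_def inv01_left[OF d(1) t])
  qed
  have k: "cos (\<theta>0 + p * \<Omega>) + Im (developed z0 \<theta>0 \<Omega> (radius_at_angle \<Omega> \<gamma>) p) * \<Omega> / radius_at_angle \<Omega> \<gamma> p =
     half_plane_curvature (\<gamma> (S p)) (deriv01 \<gamma> (S p)) (deriv01 (deriv01 \<gamma>) (S p))"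
    if p: "p \<in> {0..1}" for p
  proof -
    have n: "cmod (deriv01 \<gamma> (S p)) > 0" using D(8)[OF S(1)[OF p]] by simp
    have "Re (deriv01 \<gamma> (S p)) = cmod (deriv01 \<gamma> (S p)) * cos (\<theta>0 + p * \<Omega>)"
      by (subst dir[OF p]) simp
    then show ?thesis
      using n \<Omega> pos[OF S(1)[OF p]]
      by (simp add: dev[OF p] rad half_plane_curvature_def turn_rate_def[symmetric] add_divide_distrib)
  qed
  show "admissible q \<kappa>1 \<kappa>2 z0 \<theta>0 \<Omega> z1 (radius_at_angle \<Omega> \<gamma>)"
    unfolding admissible_def
  proof (intro conjI ballI)
    show "developed z0 \<theta>0 \<Omega> (radius_at_angle \<Omega> \<gamma>) 1 = z1"
      using D(12) by (simp add: dev S_def inv01_1[OF d(1)] frame_def)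
    fix p :: real assume p: "p \<in> {0..1}"
    show "Im (developed z0 \<theta>0 \<Omega> (radius_at_angle \<Omega> \<gamma>) p) > 0" using D(7)[OF S(1)[OF p]] by (simp add: dev[OF p])
    show "\<kappa>1 < ereal (cos (\<theta>0 + p * \<Omega>) + Im (developed z0 \<theta>0 \<Omega> (radius_at_angle \<Omega> \<gamma>) p) * \<Omega> / radius_at_angle \<Omega> \<gamma> p)"
      unfolding k[OF p] by (rule D(9)[OF S(1)[OF p]])
    show "ereal (cos (\<theta>0 + p * \<Omega>) + Im (developed z0 \<theta>0 \<Omega> (radius_at_angle \<Omega> \<gamma>) p) * \<Omega> / radius_at_angle \<Omega> \<gamma> p) < \<kappa>2"
      unfolding k[OF p] by (rule D(10)[OF S(1)[OF p]])
  qed (use rp ckr in auto)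
qed

text \<open>A straight homotopy in the two coordinates: the radius function moves to the one of a fixed
  curve \<open>\<eta>\<close>, through the convex set of admissible ones, and the speed function moves to 1.\<close>

lemma contractible_turn_class:
  assumes sgn: "\<And>\<gamma> t. \<gamma> \<in> curves \<Longrightarrow> turning \<gamma> = \<Omega> \<Longrightarrow> t \<in> {0..1} \<Longrightarrow> turn_rate \<gamma> t / \<Omega> > 0"
    and e: "cis (\<theta>0 + \<Omega>) = cis \<theta>1"
  shows "contractible_space (subtopology (curve_topology r \<kappa>1 \<kappa>2 (frame (z0, \<theta>0)) (frame (z1, \<theta>1)))
    {\<gamma> \<in> curves. turning \<gamma> = \<Omega>})"
    (is "contractible_space (subtopology ?X ?C)")
proof (cases "?C = {}")
  case True
  show ?thesis unfolding True by (rule contractible_space_subset_singleton[of _ undefined]) simp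
next
  case False
  then obtain \<eta> where "\<eta> \<in> ?C" by blast
  have C: "?C = turn_class" using sgn by blast
  have \<eta>: "\<eta> \<in> turn_class" using \<open>\<eta> \<in> ?C\<close> unfolding C .
  note ad\<eta> = radius_at_angle_admissible[OF \<eta>]
  define R where "R = (\<lambda>s \<gamma> p. (1 - s) * radius_at_angle \<Omega> \<gamma> p + s * radius_at_angle \<Omega> \<eta> p)"
  define B where "B = (\<lambda>s \<gamma> p. (1 - s) * speed_at_angle \<Omega> \<gamma> p + s * (1::real))"
  define H where "H = (\<lambda>s \<gamma>. angle_curve z0 \<theta>0 \<Omega> (R s \<gamma>) (B s \<gamma>))"
  have ck1: "Ck k (\<lambda>p::real. 1::real)" for k unfolding Ck_iff_tendsto by (intro Ck_tendsto_const) auto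
  have adR: "admissible q \<kappa>1 \<kappa>2 z0 \<theta>0 \<Omega> z1 (R s \<gamma>)" if "s \<in> {0..1}" "\<gamma> \<in> turn_class" for s \<gamma>
    unfolding R_def using that by (intro admissible_convex radius_at_angle_admissible ad\<eta>) auto
  have Bpos: "B s \<gamma> p > 0" if "s \<in> {0..1}" "\<gamma> \<in> turn_class" "p \<in> {0..1}" for s \<gamma> p
    unfolding B_def using that radius_at_angle_admissible(3)[OF that(2,3)]
    by (cases "s = 0") (auto intro: add_nonneg_pos)
  have BCk: "Ck (Suc q) (B s \<gamma>)" if "\<gamma> \<in> turn_class" for s \<gamma>
    unfolding B_def by (intro Ck_affine radius_at_angle_admissible that ck1)
  have Rpos: "R s \<gamma> p > 0" if "s \<in> {0..1}" "\<gamma> \<in> turn_class" "p \<in> {0..1}" for s \<gamma> p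
    using adR[OF that(1,2)] that(3) by (auto simp: admissible_def)
  show ?thesis
    unfolding C
  proof (rule contractible_curve_subspace[where H = H and \<eta> = "angle_curve z0 \<theta>0 \<Omega> (radius_at_angle \<Omega> \<eta>) (\<lambda>p. 1)"])
    fix s \<gamma> assume s: "s \<in> {0..1::real}" and \<gamma>: "\<gamma> \<in> turn_class"
    show "H s \<gamma> \<in> turn_class"
      using angle_curve_admissible[OF adR[OF s \<gamma>] BCk[OF \<gamma>] Bpos[OF s \<gamma>] e r]
      unfolding C[symmetric] H_def by blast
    fix F assume F: "(fst \<longlongrightarrow> s) F" "\<forall>\<^sub>F i in F. fst i \<in> {0..1} \<and> snd i \<in> turn_class" "Ck_tendsto r F snd \<gamma>"
    have ev: "\<forall>\<^sub>F i in F. snd i \<in> turn_class" using F(2) by eventually_elim blast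
    note A = Ck_tendsto_at_angle[OF \<gamma> F(3) ev]
    have "Ck_tendsto q F (\<lambda>i. R (fst i) (snd i)) (R s \<gamma>)"
      unfolding R_def using ad\<eta>(1) by (intro Ck_tendsto_affine F(1) A(2) Ck_tendsto_const_family) (simp add: admissible_def)
    moreover have "Ck_tendsto (Suc q) F (\<lambda>i. B (fst i) (snd i)) (B s \<gamma>)"
      unfolding B_def by (intro Ck_tendsto_affine F(1) A(1) Ck_tendsto_const_family ck1)
    ultimately show "Ck_tendsto r F (\<lambda>i. H (fst i) (snd i)) (H s \<gamma>)"
      unfolding H_def r by (rule Ck_tendsto_angle_curve[OF _ _ Rpos[OF s \<gamma>] Bpos[OF s \<gamma>]])
  next
    fix \<gamma> assume \<gamma>: "\<gamma> \<in> turn_class"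
    show "H 0 \<gamma> = \<gamma>" using radius_at_angle_admissible(4)[OF \<gamma>] by (simp add: H_def R_def B_def)
    show "H 1 \<gamma> = angle_curve z0 \<theta>0 \<Omega> (radius_at_angle \<Omega> \<eta>) (\<lambda>p. 1)" by (simp add: H_def R_def B_def)
  qed auto
qed

end

section \<open>Slowly drifting circles\<close>

text \<open>If a function with equal end values is linear up to a bounded term, then its slope is controlled
  by the bounded term as well.\<close>

lemma bounded_plus_linear_bound:
  fixes G B :: "real \<Rightarrow> real"
  assumes G: "\<And>p. G p = A * p + B p + c" and B: "\<And>p. \<bar>B p\<bar> \<le> M" and "G 0 = G 1" "p \<in> {0..1}"
  shows "\<bar>G p - G 0\<bar> \<le> 4 * M"
proof -
  have "A = B 0 - B 1" using assms(3) by (simp add: G)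
  then have A: "\<bar>A\<bar> \<le> 2 * M" using B[of 0] B[of 1] by linarith
  have "\<bar>A * p\<bar> \<le> \<bar>A\<bar>" using assms(4) by (auto simp: abs_mult intro: mult_left_le)
  then show ?thesis using A B[of 0] B[of p] G[of p] G[of 0] by linarith
qed

text \<open>The linear system for the drift of the osculating circles. Here \<open>2 h\<close> is the total turning, and the
  coefficients are the integrals over \<open>[-h, h]\<close> of the products of 1, cosine and sine. For
  large \<open>h\<close> these functions are almost orthogonal, and the solution is of order \<open>1/h\<close>.\<close>

lemma drift_coefficients:
  fixes h r C S :: real
  assumes h: "\<bar>h\<bar> \<ge> 4"
  obtains \<alpha> \<beta> \<zeta> where "2 * h * \<alpha> + 2 * sin h * \<beta> = r" "2 * sin h * \<alpha> + (h + sin h * cos h) * \<beta> = C"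
    "(h - sin h * cos h) * \<zeta> = S" "\<bar>\<alpha>\<bar> \<le> (2 * \<bar>r\<bar> + \<bar>C\<bar>) / \<bar>h\<bar>" "\<bar>\<beta>\<bar> \<le> (2 * \<bar>C\<bar> + \<bar>r\<bar>) / \<bar>h\<bar>"
    "\<bar>\<zeta>\<bar> \<le> 2 * \<bar>S\<bar> / \<bar>h\<bar>"
proof -
  define d where "d = 2 * h * (h + sin h * cos h) - 4 * (sin h)\<^sup>2"
  have sc: "\<bar>sin h * cos h\<bar> \<le> 1" using mult_mono[of "\<bar>sin h\<bar>" 1 "\<bar>cos h\<bar>" 1] by (simp add: abs_mult)
  have hh: "h\<^sup>2 \<ge> 4 * \<bar>h\<bar>" "\<bar>h\<bar> > 0" using h mult_right_mono[OF h, of "\<bar>h\<bar>"] by (auto simp: power2_eq_square)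
  have "\<bar>h * (sin h * cos h)\<bar> \<le> \<bar>h\<bar>" using mult_left_mono[OF sc, of "\<bar>h\<bar>"] by (simp add: abs_mult)
  moreover have "(sin h)\<^sup>2 \<le> 1" by (simp add: abs_square_le_1)
  moreover have "d = 2 * h\<^sup>2 + 2 * (h * (sin h * cos h)) - 4 * (sin h)\<^sup>2" by (simp add: d_def algebra_simps power2_eq_square)
  ultimately have d: "d \<ge> h\<^sup>2" using hh h by linarith
  have dp: "d > 0" using d hh h by linarith
  have div: "\<bar>x / d\<bar> \<le> y / \<bar>h\<bar>" if "\<bar>x\<bar> \<le> y * \<bar>h\<bar>" for x y
  proof -
    have "\<bar>x / d\<bar> = \<bar>x\<bar> / d" using dp by simp
    also have "\<dots> \<le> \<bar>x\<bar> / h\<^sup>2" using d dp hh h by (intro divide_left_mono mult_pos_pos) auto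
    also have "\<dots> \<le> (y * \<bar>h\<bar>) / h\<^sup>2" using that by (intro divide_right_mono) auto
    also have "\<dots> = y / \<bar>h\<bar>" using hh(2) by (simp add: power2_eq_square divide_simps)
    finally show ?thesis .
  qed
  define \<alpha> where "\<alpha> = (r * (h + sin h * cos h) - 2 * sin h * C) / d"
  define \<beta> where "\<beta> = (2 * h * C - 2 * sin h * r) / d"
  define \<zeta> where "\<zeta> = S / (h - sin h * cos h)"
  have s1: "\<bar>sin h\<bar> \<le> 1" by simp
  have l: "\<bar>h - sin h * cos h\<bar> \<ge> \<bar>h\<bar> / 2" using sc h by linarith
  show ?thesis
  proof (rule that[of \<alpha> \<beta> \<zeta>])
    have "2 * h * \<alpha> + 2 * sin h * \<beta> = r * d / d" unfolding \<alpha>_def \<beta>_def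
      by (simp add: add_divide_distrib[symmetric] diff_divide_distrib[symmetric] d_def power2_eq_square algebra_simps)
    then show "2 * h * \<alpha> + 2 * sin h * \<beta> = r" using dp by simp
    have "2 * sin h * \<alpha> + (h + sin h * cos h) * \<beta> = C * d / d" unfolding \<alpha>_def \<beta>_def
      by (simp add: add_divide_distrib[symmetric] diff_divide_distrib[symmetric] d_def power2_eq_square algebra_simps)
    then show "2 * sin h * \<alpha> + (h + sin h * cos h) * \<beta> = C" using dp by simp
    show "(h - sin h * cos h) * \<zeta> = S" using l hh(2) by (auto simp: \<zeta>_def)
    have a1: "\<bar>r * (h + sin h * cos h)\<bar> \<le> \<bar>r\<bar> * (2 * \<bar>h\<bar>)"
      unfolding abs_mult by (rule mult_left_mono) (use sc h in linarith, simp)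
    have a2: "\<bar>2 * sin h * C\<bar> \<le> \<bar>C\<bar> * \<bar>h\<bar>"
    proof -
      have "\<bar>C\<bar> * (2 * \<bar>sin h\<bar>) \<le> \<bar>C\<bar> * \<bar>h\<bar>" using s1 h by (intro mult_left_mono) linarith+
      then show ?thesis by (simp add: abs_mult mult_ac)
    qed
    have a3: "\<bar>2 * sin h * r\<bar> \<le> \<bar>r\<bar> * \<bar>h\<bar>"
    proof -
      have "\<bar>r\<bar> * (2 * \<bar>sin h\<bar>) \<le> \<bar>r\<bar> * \<bar>h\<bar>" using s1 h by (intro mult_left_mono) linarith+
      then show ?thesis by (simp add: abs_mult mult_ac)
    qed
    show "\<bar>\<alpha>\<bar> \<le> (2 * \<bar>r\<bar> + \<bar>C\<bar>) / \<bar>h\<bar>" unfolding \<alpha>_def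
      by (rule div) (use a1 a2 abs_triangle_ineq4[of "r * (h + sin h * cos h)" "2 * sin h * C"]
          in \<open>simp add: distrib_right\<close>)
    have "\<bar>2 * h * C\<bar> = 2 * \<bar>C\<bar> * \<bar>h\<bar>" by (simp add: abs_mult)
    then show "\<bar>\<beta>\<bar> \<le> (2 * \<bar>C\<bar> + \<bar>r\<bar>) / \<bar>h\<bar>" unfolding \<beta>_def
      by (intro div) (use a3 abs_triangle_ineq4[of "2 * h * C" "2 * sin h * r"] in \<open>simp add: distrib_right\<close>)
    have "\<bar>\<zeta>\<bar> = \<bar>S\<bar> / \<bar>h - sin h * cos h\<bar>" by (simp add: \<zeta>_def)
    also have "\<dots> \<le> \<bar>S\<bar> / (\<bar>h\<bar> / 2)" using l hh(2) by (intro divide_left_mono mult_pos_pos) linarith+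
    finally show "\<bar>\<zeta>\<bar> \<le> 2 * \<bar>S\<bar> / \<bar>h\<bar>" by (simp add: mult.commute)
  qed
qed

text \<open>A curve in direction \<open>\<theta>\<close> whose osculating circle has centre \<open>C\<close> and signed radius \<open>R\<close> is at
  \<open>C - i R e\<^sup>i\<^sup>\<theta>\<close> and has hyperbolic curvature \<open>Im C / R\<close>. The only constraint on the motion is
  \<open>dC = i e\<^sup>i\<^sup>\<theta> dR\<close>. At each end there is a circle of curvature \<open>k\<close> through the given vector. To
  connect them, \<open>R\<close> and the two coordinates of \<open>C\<close> have to change by prescribed amounts, and
  \<open>dR/d\<theta> = \<alpha> + \<beta> cos \<theta> + \<zeta> sin \<theta>\<close>, with \<open>\<theta>\<close> measured from the mean direction, has just
  enough coefficients for it. They are of order \<open>1/\<Omega>\<close>, so \<open>R\<close> stays within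
  \<open>O(1/\<Omega>)\<close> of the linear interpolation of its end values, and \<open>Im C - k R\<close> within \<open>O(1/\<Omega>)\<close> of 0.\<close>

lemma drifting_circles:
  fixes k \<theta>0 \<theta>1 \<Omega> r0 r1 \<epsilon> :: real and z0 z1 :: complex
  defines "d \<equiv> cmod (z1 + \<i> * r1 * cis \<theta>1 - z0 - \<i> * r0 * cis \<theta>0)"
  defines "K \<equiv> (2 * \<bar>r1 - r0\<bar> + d) + (1 + \<bar>k\<bar>) * (4 * d + \<bar>r1 - r0\<bar>)"
  assumes e: "cis (\<theta>0 + \<Omega>) = cis \<theta>1" and \<Omega>: "\<bar>\<Omega>\<bar> \<ge> 8" "8 * K \<le> \<bar>\<Omega>\<bar> * \<epsilon>"
    and y: "Im z0 = r0 * (k - cos \<theta>0)" "Im z1 = r1 * (k - cos \<theta>1)"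
  obtains R where "\<And>n. Ck n R" "developed z0 \<theta>0 \<Omega> (\<lambda>p. \<Omega> * R p) 1 = z1"
    "\<And>p. p \<in> {0..1} \<Longrightarrow> \<bar>R p - ((1 - p) * r0 + p * r1)\<bar> \<le> \<epsilon>"
    "\<And>p. p \<in> {0..1} \<Longrightarrow> \<bar>Im (developed z0 \<theta>0 \<Omega> (\<lambda>p. \<Omega> * R p) p) + R p * cos (\<theta>0 + p * \<Omega>) - k * R p\<bar> \<le> \<epsilon>"
proof -
  define h where "h = \<Omega> / 2"
  define \<theta>m where "\<theta>m = \<theta>0 + h"
  define dC where "dC = z1 + \<i> * r1 * cis \<theta>1 - z0 - \<i> * r0 * cis \<theta>0"
  \<comment> \<open>The required displacement of the centre, turned so that it becomes the integral of \<open>(dR/d\<theta>) e\<^sup>i\<^sup>\<theta>\<close> over \<open>[-h, h]\<close>.\<close>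
  define D where "D = - \<i> * dC * cis (- \<theta>m)"
  have h4: "\<bar>h\<bar> \<ge> 4" using \<Omega> by (simp add: h_def)
  have nD: "cmod D = d" by (simp add: D_def norm_mult dC_def d_def)
  obtain \<alpha> \<beta> \<zeta> where eq: "2 * h * \<alpha> + 2 * sin h * \<beta> = r1 - r0"
    "2 * sin h * \<alpha> + (h + sin h * cos h) * \<beta> = Re D" "(h - sin h * cos h) * \<zeta> = Im D"
    and bd: "\<bar>\<alpha>\<bar> \<le> (2 * \<bar>r1 - r0\<bar> + \<bar>Re D\<bar>) / \<bar>h\<bar>" "\<bar>\<beta>\<bar> \<le> (2 * \<bar>Re D\<bar> + \<bar>r1 - r0\<bar>) / \<bar>h\<bar>"
    "\<bar>\<zeta>\<bar> \<le> 2 * \<bar>Im D\<bar> / \<bar>h\<bar>"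
    using drift_coefficients[OF h4] by metis
  define M where "M = \<bar>\<alpha>\<bar> + (1 + \<bar>k\<bar>) * (\<bar>\<beta>\<bar> + \<bar>\<zeta>\<bar>)"
  have M: "4 * M \<le> \<epsilon>"
  proof -
    have hp: "\<bar>h\<bar> > 0" using h4 by linarith
    have D2: "\<bar>Re D\<bar> \<le> d" "\<bar>Im D\<bar> \<le> d" using abs_Re_le_cmod[of D] abs_Im_le_cmod[of D] nD by auto
    have "\<bar>\<alpha>\<bar> * \<bar>h\<bar> \<le> 2 * \<bar>r1 - r0\<bar> + d" "\<bar>\<beta>\<bar> * \<bar>h\<bar> \<le> 2 * d + \<bar>r1 - r0\<bar>" "\<bar>\<zeta>\<bar> * \<bar>h\<bar> \<le> 2 * d"
      using bd D2 hp by (auto simp: pos_le_divide_eq)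
    then have "\<bar>\<alpha>\<bar> * \<bar>h\<bar> + (1 + \<bar>k\<bar>) * (\<bar>\<beta>\<bar> * \<bar>h\<bar> + \<bar>\<zeta>\<bar> * \<bar>h\<bar>) \<le> K"
      unfolding K_def by (intro add_mono[OF _ mult_left_mono]) auto
    then have "M * \<bar>h\<bar> \<le> K" by (simp add: M_def algebra_simps)
    then have "4 * M * \<bar>h\<bar> \<le> \<epsilon> * \<bar>h\<bar>" using \<Omega>(2) by (simp add: h_def mult.commute)
    then show ?thesis using hp by simp
  qed
  define e1 where "e1 = (\<lambda>p. cis (- h + p * \<Omega>))"
  define e2 where "e2 = (\<lambda>p. cis (- (2 * h) + p * (2 * \<Omega>)))"
  have ne: "cmod (e1 p) = 1" "cmod (e2 p) = 1" for p by (auto simp: e1_def e2_def)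
  have e12: "e1 p * e1 p = e2 p" "e1 p * cnj (e1 p) = 1" for p
    by (auto simp: e1_def e2_def cis_mult cis_cnj algebra_simps)
  \<comment> \<open>\<open>nu\<close> is \<open>dR/d\<theta>\<close>, \<open>P\<close> a primitive of \<open>nu e1\<close> with respect to \<open>\<theta>\<close>, and \<open>Q\<close> the centre.\<close>
  define nu where "nu = (\<lambda>p. \<alpha> + \<beta> * Re (e1 p) + \<zeta> * Im (e1 p))"
  define R where "R = (\<lambda>p. r0 + (\<alpha> * \<Omega>) * p + (\<beta> * (Im (e1 p) + sin h) + (- \<zeta>) * (Re (e1 p) - cos h)))"
  define P where "P = (\<lambda>p. - \<i> * \<alpha> * e1 p + Complex (- \<zeta>) (- \<beta>) / 4 * e2 p + Complex \<beta> \<zeta> / 2 * of_real (p * \<Omega>))"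
  define Q where "Q = (\<lambda>p. z0 + \<i> * r0 * cis \<theta>0 + \<i> * cis \<theta>m * (P p - P 0))"
  have nu_e: "of_real (nu p) * e1 p = \<alpha> * e1 p + Complex \<beta> (- \<zeta>) / 2 * e2 p + Complex \<beta> \<zeta> / 2" for p
  proof -
    have "of_real (nu p) = \<alpha> + Complex \<beta> (- \<zeta>) / 2 * e1 p + Complex \<beta> \<zeta> / 2 * cnj (e1 p)"
      by (simp add: nu_def complex_eq_iff field_simps)
    then have "of_real (nu p) * e1 p = \<alpha> * e1 p + Complex \<beta> (- \<zeta>) / 2 * (e1 p * e1 p) + Complex \<beta> \<zeta> / 2 * (e1 p * cnj (e1 p))"
      by (simp add: algebra_simps)
    then show ?thesis by (simp add: e12)
  qed
  have de1: "has_deriv01 e1 (\<lambda>p. of_real \<Omega> * \<i> * e1 p)" unfolding e1_def by (rule has_deriv01_cis)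
  have de2: "has_deriv01 e2 (\<lambda>p. of_real (2 * \<Omega>) * \<i> * e2 p)" unfolding e2_def by (rule has_deriv01_cis)
  have di: "has_deriv01 (\<lambda>p. a * p) (\<lambda>p. a)" for a :: real
    unfolding has_deriv01_def has_real_derivative_iff_has_vector_derivative[symmetric]
    by (auto intro!: derivative_eq_intros)
  have dR: "has_deriv01 R (\<lambda>p. \<Omega> * nu p)"
  proof -
    have "has_deriv01 R (\<lambda>p. 0 + \<alpha> * \<Omega> + (\<beta> * (Im (of_real \<Omega> * \<i> * e1 p) + 0) + (- \<zeta>) * (Re (of_real \<Omega> * \<i> * e1 p) + 0)))"
      unfolding R_def diff_conv_add_uminus
      by (intro has_deriv01_add has_deriv01_const di bounded_linear.has_deriv01[OF bounded_linear_mult_right]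
          bounded_linear.has_deriv01[OF bounded_linear_Re] bounded_linear.has_deriv01[OF bounded_linear_Im] de1)
    then show ?thesis by (rule has_deriv01_cong) (auto simp: nu_def algebra_simps)
  qed
  have dP: "has_deriv01 P (\<lambda>p. of_real \<Omega> * (of_real (nu p) * e1 p))"
  proof -
    have "has_deriv01 P (\<lambda>p. (- \<i> * \<alpha>) * (of_real \<Omega> * \<i> * e1 p) + (Complex (- \<zeta>) (- \<beta>) / 4) * (of_real (2 * \<Omega>) * \<i> * e2 p)
         + (Complex \<beta> \<zeta> / 2) * of_real \<Omega>)"
      unfolding P_def
      by (intro has_deriv01_add bounded_linear.has_deriv01[OF bounded_linear_mult_right]
          bounded_linear.has_deriv01[OF bounded_linear_of_real] de1 de2 di[of \<Omega>, unfolded mult.commute[of \<Omega>]])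
    then show ?thesis
    proof (rule has_deriv01_cong)
      fix p
      have c: "Complex (- \<zeta>) (- \<beta>) * \<i> = Complex \<beta> (- \<zeta>)" by (simp add: complex_eq_iff)
      show "(- \<i> * \<alpha>) * (of_real \<Omega> * \<i> * e1 p) + (Complex (- \<zeta>) (- \<beta>) / 4) * (of_real (2 * \<Omega>) * \<i> * e2 p)
         + (Complex \<beta> \<zeta> / 2) * of_real \<Omega> = of_real \<Omega> * (of_real (nu p) * e1 p)"
        unfolding nu_e c[symmetric] by (simp add: algebra_simps)
    qed simp
  qed
  have dir: "cis \<theta>m * e1 p = cis (\<theta>0 + p * \<Omega>)" for p
    by (simp add: e1_def cis_mult \<theta>m_def algebra_simps)
  define Z where "Z = (\<lambda>p. Q p + (- \<i>) * (of_real (R p) * (cis \<theta>m * e1 p)))"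
  have dZ: "has_deriv01 Z (\<lambda>p. of_real (\<Omega> * R p) * cis (\<theta>0 + p * \<Omega>))"
  proof -
    have "has_deriv01 Z (\<lambda>p. (0 + \<i> * cis \<theta>m * (of_real \<Omega> * (of_real (nu p) * e1 p) + 0)) +
        (- \<i>) * (of_real (R p) * (cis \<theta>m * (of_real \<Omega> * \<i> * e1 p)) + of_real (\<Omega> * nu p) * (cis \<theta>m * e1 p)))"
      unfolding Z_def Q_def diff_conv_add_uminus
      by (intro has_deriv01_add has_deriv01_const bounded_linear.has_deriv01[OF bounded_linear_mult_right]
         bounded_bilinear.has_deriv01[OF bounded_bilinear_mult] bounded_linear.has_deriv01[OF bounded_linear_of_real] dP dR de1)
    then show ?thesis by (rule has_deriv01_cong) (auto simp: dir[symmetric] algebra_simps)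
  qed
  have R0: "R 0 = r0" by (simp add: R_def e1_def)
  have h2: "e1 0 = cis (- h)" "e1 1 = cis h" "e2 0 = cis (- (2 * h))" "e2 1 = cis (2 * h)"
    by (auto simp: e1_def e2_def h_def)
  have R1: "R 1 = r1"
  proof -
    have "R 1 = r0 + \<alpha> * \<Omega> + 2 * sin h * \<beta>" by (simp add: R_def h2)
    then show ?thesis using eq(1) by (simp add: h_def algebra_simps)
  qed
  have Q0: "Q 0 = z0 + \<i> * r0 * cis \<theta>0" by (simp add: Q_def)
  have "P 1 - P 0 = D"
  proof -
    have s2: "sin (2 * h) = 2 * (sin h * cos h)" by (simp add: sin_double)
    show ?thesis
    proof (rule complex_eqI)
      have "Re (P 1 - P 0) = 2 * sin h * \<alpha> + (\<beta> * sin (2 * h)) / 2 + \<beta> * (\<Omega> / 2)"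
        by (simp add: P_def h2 field_simps)
      also have "\<dots> = Re D" unfolding eq(2)[symmetric] s2 h_def[symmetric] by (simp add: algebra_simps)
      finally show "Re (P 1 - P 0) = Re D" .
      have "Im (P 1 - P 0) = - (\<zeta> * sin (2 * h)) / 2 + \<zeta> * (\<Omega> / 2)"
        by (simp add: P_def h2 field_simps)
      also have "\<dots> = Im D" unfolding eq(3)[symmetric] s2 h_def[symmetric] by (simp add: algebra_simps)
      finally show "Im (P 1 - P 0) = Im D" .
    qed
  qed
  moreover have "\<i> * cis \<theta>m * D = dC" by (simp add: D_def cis_mult algebra_simps)
  ultimately have Q1: "Q 1 = z1 + \<i> * r1 * cis \<theta>1" by (simp add: Q_def dC_def)
  have cR: "continuous_on {0..1} (\<lambda>p. of_real (\<Omega> * R p) * cis (\<theta>0 + p * \<Omega>) :: complex)"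
    by (intro continuous_intros has_deriv01_continuous[OF dR])
  have dev: "developed z0 \<theta>0 \<Omega> (\<lambda>p. \<Omega> * R p) p = Z p" if "p \<in> {0..1}" for p
  proof (rule has_deriv01_unique[OF _ dZ _ that])
    show "has_deriv01 (developed z0 \<theta>0 \<Omega> (\<lambda>p. \<Omega> * R p)) (\<lambda>p. of_real (\<Omega> * R p) * cis (\<theta>0 + p * \<Omega>))"
      using has_deriv01_add[OF has_deriv01_const has_deriv01_integral[OF cR], of z0]
      by (simp add: developed_def[abs_def])
    show "developed z0 \<theta>0 \<Omega> (\<lambda>p. \<Omega> * R p) 0 = Z 0"
      using dir[of 0] by (simp add: developed_def Z_def Q0 R0)
  qed
  have ImQ: "Im (Z p) + R p * cos (\<theta>0 + p * \<Omega>) = Im (Q p)" for p by (simp add: Z_def dir)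
  have bR: "\<bar>\<beta> * Im (e1 p) + (- \<zeta>) * Re (e1 p)\<bar> \<le> \<bar>\<beta>\<bar> + \<bar>\<zeta>\<bar>" for p
  proof -
    have "\<bar>Im (e1 p)\<bar> \<le> 1" "\<bar>Re (e1 p)\<bar> \<le> 1" using abs_Re_le_cmod[of "e1 p"] abs_Im_le_cmod[of "e1 p"] ne by auto
    then have "\<bar>\<beta> * Im (e1 p)\<bar> \<le> \<bar>\<beta>\<bar>" "\<bar>(- \<zeta>) * Re (e1 p)\<bar> \<le> \<bar>\<zeta>\<bar>" by (auto simp: abs_mult intro: mult_left_le)
    then show ?thesis by linarith
  qed
  have MR: "\<bar>\<beta>\<bar> + \<bar>\<zeta>\<bar> \<le> M" unfolding M_def distrib_right by auto
  have 1: "\<bar>R p - ((1 - p) * r0 + p * r1)\<bar> \<le> 4 * M" if p: "p \<in> {0..1}" for p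
  proof -
    have "\<bar>(R p - ((1 - p) * r0 + p * r1)) - (R 0 - ((1 - 0) * r0 + 0 * r1))\<bar> \<le> 4 * M"
    proof (rule bounded_plus_linear_bound[OF _ _ _ p])
      show "R p - ((1 - p) * r0 + p * r1) = (\<alpha> * \<Omega> + r0 - r1) * p + (\<beta> * Im (e1 p) + (- \<zeta>) * Re (e1 p)) + (\<beta> * sin h + \<zeta> * cos h)" for p
        by (simp add: R_def algebra_simps)
      show "\<bar>\<beta> * Im (e1 p) + (- \<zeta>) * Re (e1 p)\<bar> \<le> M" for p using bR[of p] MR by linarith
    qed (simp add: R0 R1)
    then show ?thesis by (simp add: R0)
  qed
  define V where "V = (\<lambda>p. - \<i> * \<alpha> * e1 p + Complex (- \<zeta>) (- \<beta>) / 4 * e2 p)"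
  have 2: "\<bar>Im (Q p) - k * R p\<bar> \<le> 4 * M" if p: "p \<in> {0..1}" for p
  proof -
    have z: "Im (Q 0) - k * R 0 = 0" using y(1) by (simp add: Q0 R0 algebra_simps)
    have "\<bar>(Im (Q p) - k * R p) - (Im (Q 0) - k * R 0)\<bar> \<le> 4 * M"
    proof (rule bounded_plus_linear_bound[OF _ _ _ p])
      show "Im (Q p) - k * R p = (Re (cis \<theta>m * (Complex \<beta> \<zeta> / 2)) * \<Omega> - k * (\<alpha> * \<Omega>)) * p +
         (Re (cis \<theta>m * V p) - k * (\<beta> * Im (e1 p) + (- \<zeta>) * Re (e1 p))) +
         (Im (z0 + \<i> * r0 * cis \<theta>0) - Re (cis \<theta>m * P 0) - k * (r0 + \<beta> * sin h + \<zeta> * cos h))" for p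
      proof -
        have "Im (\<i> * cis \<theta>m * (P p - P 0)) = Re (cis \<theta>m * V p) + Re (cis \<theta>m * (Complex \<beta> \<zeta> / 2)) * \<Omega> * p - Re (cis \<theta>m * P 0)"
          by (simp add: P_def V_def algebra_simps)
        then show ?thesis by (simp only: Q_def plus_complex.sel R_def) (simp add: algebra_simps)
      qed
      fix p
      have "cmod (V p) \<le> cmod (- \<i> * \<alpha> * e1 p) + cmod (Complex (- \<zeta>) (- \<beta>) / 4 * e2 p)"
        unfolding V_def by (rule norm_triangle_ineq)
      also have "\<dots> = \<bar>\<alpha>\<bar> + cmod (Complex (- \<zeta>) (- \<beta>)) / 4" by (simp add: norm_mult ne norm_divide)
      also have "\<dots> \<le> \<bar>\<alpha>\<bar> + (\<bar>\<beta>\<bar> + \<bar>\<zeta>\<bar>)"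
        using cmod_le[of "Complex (- \<zeta>) (- \<beta>)"] by simp
      finally have V: "\<bar>Re (cis \<theta>m * V p)\<bar> \<le> \<bar>\<alpha>\<bar> + (\<bar>\<beta>\<bar> + \<bar>\<zeta>\<bar>)"
        using abs_Re_le_cmod[of "cis \<theta>m * V p"] by (simp add: norm_mult)
      have "\<bar>k * (\<beta> * Im (e1 p) + (- \<zeta>) * Re (e1 p))\<bar> \<le> \<bar>k\<bar> * (\<bar>\<beta>\<bar> + \<bar>\<zeta>\<bar>)"
        unfolding abs_mult[of k] by (intro mult_left_mono bR) auto
      from order_trans[OF abs_triangle_ineq4 add_mono[OF V this]]
      show "\<bar>Re (cis \<theta>m * V p) - k * (\<beta> * Im (e1 p) + (- \<zeta>) * Re (e1 p))\<bar> \<le> M"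
        by (simp add: M_def distrib_right)
    next
      have "Im (Q 1) - k * R 1 = 0" using y(2) by (simp add: Q1 R1 algebra_simps)
      then show "Im (Q 0) - k * R 0 = Im (Q 1) - k * R 1" using z by simp
    qed
    then show ?thesis using z by simp
  qed
  show ?thesis
  proof (rule that[of R])
    have cke: "Ck n e1" for n unfolding e1_def by (rule Ck_cis)
    show "Ck n R" for n
      unfolding R_def Ck_iff_tendsto diff_conv_add_uminus
      by (intro Ck_tendsto_add Ck_tendsto_mult Ck_tendsto_const tendsto_const Ck_tendsto_Re Ck_tendsto_Im
          cke[unfolded Ck_iff_tendsto] Ck_tendsto_ident)
    show "developed z0 \<theta>0 \<Omega> (\<lambda>p. \<Omega> * R p) 1 = z1"
      using dir[of 1] e by (simp add: dev Z_def Q1 R1)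
    fix p :: real assume p: "p \<in> {0..1}"
    show "\<bar>R p - ((1 - p) * r0 + p * r1)\<bar> \<le> \<epsilon>" using 1[OF p] M by linarith
    show "\<bar>Im (developed z0 \<theta>0 \<Omega> (\<lambda>p. \<Omega> * R p) p) + R p * cos (\<theta>0 + p * \<Omega>) - k * R p\<bar> \<le> \<epsilon>"
      unfolding dev[OF p] ImQ using 2[OF p] M by linarith
  qed
qed

text \<open>The radius of the circle of curvature \<open>k\<close> through \<open>z\<close> in direction \<open>\<theta>\<close> is
  \<open>y / (k - cos \<theta>)\<close>, which has the sign of \<open>k\<close> as \<open>\<bar>k\<bar> > 1\<close>. For many turns the
  drifting circles keep a radius bounded away from 0 and a curvature close to \<open>k\<close>.\<close>

lemma exists_admissible:
  fixes k :: real
  assumes k: "\<kappa>1 < ereal k" "ereal k < \<kappa>2" "\<bar>k\<bar> > 1" and z: "Im z0 > 0" "Im z1 > 0"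
  obtains B where "\<And>\<Omega>. cis (\<theta>0 + \<Omega>) = cis \<theta>1 \<Longrightarrow> \<Omega> * k > 0 \<Longrightarrow> \<bar>\<Omega>\<bar> \<ge> B \<Longrightarrow>
    \<exists>\<rho>. admissible q \<kappa>1 \<kappa>2 z0 \<theta>0 \<Omega> z1 \<rho>"
proof -
  obtain a where a: "\<kappa>1 < ereal a" "a < k" using ereal_dense2[OF k(1)] by auto
  obtain b where b: "k < b" "ereal b < \<kappa>2" using ereal_dense2[OF k(2)] by auto
  define \<delta> where "\<delta> = min (min (k - a) (b - k)) (\<bar>k\<bar> - 1) / 2"
  have \<delta>: "\<delta> > 0" "a < k - \<delta>" "k + \<delta> < b" "\<delta> < \<bar>k\<bar> - 1"
    using a b k(3) unfolding \<delta>_def by (auto simp: min_def field_simps)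
  have kc: "k * (k - cos x) > 0" for x
  proof -
    have "cos x \<le> 1" "- 1 \<le> cos x" by simp_all
    then have "(k > 0 \<and> k - cos x > 0) \<or> (k < 0 \<and> k - cos x < 0)" using k(3) by linarith
    then show ?thesis unfolding zero_less_mult_iff .
  qed
  define r0 where "r0 = Im z0 / (k - cos \<theta>0)"
  define r1 where "r1 = Im z1 / (k - cos \<theta>1)"
  have y: "Im z0 = r0 * (k - cos \<theta>0)" "Im z1 = r1 * (k - cos \<theta>1)"
    using kc[of \<theta>0] kc[of \<theta>1] by (auto simp: r0_def r1_def)
  have kr: "k * r > 0" if "r * (k - cos x) > 0" for r x
  proof -
    have "0 < (k * (k - cos x)) * (r * (k - cos x))" by (rule mult_pos_pos[OF kc that])
    also have "\<dots> = (k * r) * (k - cos x)\<^sup>2" by (simp add: power2_eq_square)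
    finally show ?thesis by (rule zero_less_mult_pos2) (use that in \<open>auto simp: zero_less_power2\<close>)
  qed
  have rk: "k * r0 > 0" "k * r1 > 0" using kr y z by metis+
  define m where "m = min \<bar>r0\<bar> \<bar>r1\<bar>"
  have m: "m > 0" using rk by (auto simp: m_def)
  define \<epsilon> where "\<epsilon> = min (m / 2) (m / 2 * \<delta>)"
  have \<epsilon>: "\<epsilon> > 0" "\<epsilon> \<le> m / 2" "\<epsilon> \<le> m / 2 * \<delta>" using m \<delta> by (auto simp: \<epsilon>_def)
  define d where "d = cmod (z1 + \<i> * r1 * cis \<theta>1 - z0 - \<i> * r0 * cis \<theta>0)"
  define K where "K = (2 * \<bar>r1 - r0\<bar> + d) + (1 + \<bar>k\<bar>) * (4 * d + \<bar>r1 - r0\<bar>)"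
  show ?thesis
  proof (rule that[of "max 8 (8 * K / \<epsilon>)"])
    fix \<Omega> assume e: "cis (\<theta>0 + \<Omega>) = cis \<theta>1" and \<Omega>k: "\<Omega> * k > 0" and "max 8 (8 * K / \<epsilon>) \<le> \<bar>\<Omega>\<bar>"
    then have \<Omega>: "\<bar>\<Omega>\<bar> \<ge> 8" "8 * K \<le> \<bar>\<Omega>\<bar> * \<epsilon>" using \<epsilon>(1) by (auto simp: pos_divide_le_eq)
    obtain R where R: "\<And>n. Ck n R" "developed z0 \<theta>0 \<Omega> (\<lambda>p. \<Omega> * R p) 1 = z1"
      "\<And>p. p \<in> {0..1} \<Longrightarrow> \<bar>R p - ((1 - p) * r0 + p * r1)\<bar> \<le> \<epsilon>"
      "\<And>p. p \<in> {0..1} \<Longrightarrow> \<bar>Im (developed z0 \<theta>0 \<Omega> (\<lambda>p. \<Omega> * R p) p) + R p * cos (\<theta>0 + p * \<Omega>) - k * R p\<bar> \<le> \<epsilon>"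
      using drifting_circles[OF e \<Omega>(1) \<Omega>(2)[unfolded K_def d_def] y] by metis
    have "admissible q \<kappa>1 \<kappa>2 z0 \<theta>0 \<Omega> z1 (\<lambda>p. \<Omega> * R p)"
      unfolding admissible_def
    proof (intro conjI ballI)
      show "Ck q (\<lambda>p. \<Omega> * R p)"
        unfolding Ck_iff_tendsto by (intro Ck_tendsto_mult Ck_tendsto_const tendsto_const R(1)[unfolded Ck_iff_tendsto])
      show "developed z0 \<theta>0 \<Omega> (\<lambda>p. \<Omega> * R p) 1 = z1" by (rule R(2))
      fix p :: real assume p: "p \<in> {0..1}"
      define Y where "Y = Im (developed z0 \<theta>0 \<Omega> (\<lambda>p. \<Omega> * R p) p)"
      define c where "c = cos (\<theta>0 + p * \<Omega>)"
      define sg where "sg = sgn k"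
      have sg: "\<bar>sg\<bar> = 1" "sg * k = \<bar>k\<bar>" "sg * r0 = \<bar>r0\<bar>" "sg * r1 = \<bar>r1\<bar>" "sg * \<Omega> = \<bar>\<Omega>\<bar>" "sg * sg = 1"
        using rk \<Omega>k by (auto simp: sg_def sgn_if zero_less_mult_iff)
      have "sg * ((1 - p) * r0 + p * r1) = (1 - p) * \<bar>r0\<bar> + p * \<bar>r1\<bar>"
        by (simp add: distrib_left mult.left_commute[of sg] sg)
      moreover have "(1 - p) * m + p * m \<le> (1 - p) * \<bar>r0\<bar> + p * \<bar>r1\<bar>"
        using p by (intro add_mono mult_left_mono) (auto simp: m_def)
      ultimately have lin: "sg * ((1 - p) * r0 + p * r1) \<ge> m" by (simp add: algebra_simps)
      have "\<bar>sg * (R p - ((1 - p) * r0 + p * r1))\<bar> \<le> \<epsilon>" using R(3)[OF p] by (simp add: abs_mult sg)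
      then have "\<bar>sg * R p - sg * ((1 - p) * r0 + p * r1)\<bar> \<le> \<epsilon>" by (simp add: right_diff_distrib)
      then have Rm: "sg * R p \<ge> m / 2" using lin \<epsilon>(2) by linarith
      then have Rp: "sg * R p > 0" using m by linarith
      have Rnz: "R p \<noteq> 0" using Rp by auto
      have absR: "\<bar>R p\<bar> = sg * R p" using Rp sg(1) abs_mult[of sg "R p"] by simp
      have "sg * \<Omega> > 0" using sg(5) \<Omega>(1) by linarith
      then have "0 < (sg * \<Omega>) * (sg * R p)" using Rp by (rule mult_pos_pos)
      also have "\<dots> = (sg * sg) * (\<Omega> * R p)" by (simp only: mult_ac)
      finally show pos: "\<Omega> * R p > 0" by (simp add: sg(6))
      have "\<bar>(c + Y / R p - k) * R p\<bar> \<le> \<epsilon>"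
        using R(4)[OF p] Rnz by (simp add: Y_def c_def algebra_simps)
      then have "\<bar>c + Y / R p - k\<bar> * \<bar>R p\<bar> \<le> \<delta> * \<bar>R p\<bar>"
      proof -
        have "m / 2 * \<delta> \<le> \<delta> * \<bar>R p\<bar>"
          using mult_left_mono[OF Rm, of \<delta>] \<delta>(1) unfolding absR by (simp only: mult.commute less_imp_le)
        moreover assume "\<bar>(c + Y / R p - k) * R p\<bar> \<le> \<epsilon>"
        ultimately show ?thesis using \<epsilon>(3) unfolding abs_mult by linarith
      qed
      then have kk: "\<bar>c + Y / R p - k\<bar> \<le> \<delta>" using Rnz by simp
      have "\<bar>c\<bar> \<le> 1" by (simp add: c_def)
      have "sg * (Y / R p) > 0"
      proof -
        have "\<bar>sg * (Y / R p - (k - c))\<bar> \<le> \<delta>" using kk unfolding abs_mult sg(1) by (simp add: algebra_simps)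
        then have "\<bar>sg * (Y / R p) - (\<bar>k\<bar> - sg * c)\<bar> \<le> \<delta>" using sg(2) by (simp add: right_diff_distrib)
        moreover have "\<bar>sg * c\<bar> \<le> 1" using \<open>\<bar>c\<bar> \<le> 1\<close> by (simp add: abs_mult sg)
        ultimately show ?thesis using \<delta>(4) by linarith
      qed
      then have "0 < (sg * (Y / R p)) * (sg * R p)" using Rp by (rule mult_pos_pos)
      also have "\<dots> = (sg * sg) * (Y / R p * R p)" by (simp only: mult_ac)
      finally show "Im (developed z0 \<theta>0 \<Omega> (\<lambda>p. \<Omega> * R p) p) > 0"
        using Rnz by (simp add: Y_def[symmetric] sg(6))
      have E: "cos (\<theta>0 + p * \<Omega>) + Im (developed z0 \<theta>0 \<Omega> (\<lambda>p. \<Omega> * R p) p) * \<Omega> / (\<Omega> * R p) = c + Y / R p"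
        using \<Omega>(1) by (auto simp: c_def Y_def)
      show "\<kappa>1 < ereal (cos (\<theta>0 + p * \<Omega>) + Im (developed z0 \<theta>0 \<Omega> (\<lambda>p. \<Omega> * R p) p) * \<Omega> / (\<Omega> * R p))"
        unfolding E by (rule less_trans[OF a(1)]) (use kk \<delta> in auto)
      show "ereal (cos (\<theta>0 + p * \<Omega>) + Im (developed z0 \<theta>0 \<Omega> (\<lambda>p. \<Omega> * R p) p) * \<Omega> / (\<Omega> * R p)) < \<kappa>2"
        unfolding E by (rule less_trans[OF _ b(2)]) (use kk \<delta> in auto)
    qed
    then show "\<exists>\<rho>. admissible q \<kappa>1 \<kappa>2 z0 \<theta>0 \<Omega> z1 \<rho>" by blast
  qed
qed

section \<open>Level sets of a monotone integral functional\<close>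

lemma Ck_intros:
  fixes f g :: "real \<Rightarrow> real"
  shows Ck_const: "Ck k (\<lambda>p. c :: 'a::real_normed_vector)" and Ck_ident: "Ck k (\<lambda>p. p)"
    and Ck_add: "Ck k f \<Longrightarrow> Ck k g \<Longrightarrow> Ck k (\<lambda>p. f p + g p)"
    and Ck_diff: "Ck k f \<Longrightarrow> Ck k g \<Longrightarrow> Ck k (\<lambda>p. f p - g p)"
    and Ck_mult: "Ck k f \<Longrightarrow> Ck k g \<Longrightarrow> Ck k (\<lambda>p. f p * g p)"
    and Ck_sqrt: "Ck k f \<Longrightarrow> (\<And>p. p \<in> {0..1} \<Longrightarrow> f p > 0) \<Longrightarrow> Ck k (\<lambda>p. sqrt (f p))"
  unfolding Ck_iff_tendsto
  by (intro Ck_tendsto_const tendsto_const Ck_tendsto_ident Ck_tendsto_add Ck_tendsto_diff Ck_tendsto_mult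
      Ck_tendsto_sqrt; assumption)+

lemma has_deriv01_linear: "has_deriv01 (\<lambda>p. a + b * p) (\<lambda>p. b :: real)"
  unfolding has_deriv01_def has_real_derivative_iff_has_vector_derivative[symmetric]
  by (auto intro!: derivative_eq_intros)

text \<open>Functions \<open>Q\<close> on \<open>[0,1]\<close> with prescribed end values and slopes in \<open>(a1, a2)\<close>, together with
  the functional \<open>\<integral>G p (Q p)\<close>, where \<open>G\<close> is increasing with difference quotients in
  \<open>[g1, g2]\<close>. The strip on which \<open>G\<close> is controlled is swept out by the slopes backwards from the
  end value at \<open>p = 1\<close>; it contains all the functions in question and their envelopes.\<close>

locale level_set =
  fixes a1 a2 P0 P1 g1 g2 :: real and G :: "real \<Rightarrow> real \<Rightarrow> real"
  assumes g: "0 < g1" "g1 \<le> g2"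
    and G: "\<And>p x y. p \<in> {0..1} \<Longrightarrow> P1 - a2 * (1 - p) \<le> x \<Longrightarrow> x \<le> y \<Longrightarrow> y \<le> P1 - a1 * (1 - p) \<Longrightarrow>
      g1 * (y - x) \<le> G p y - G p x \<and> G p y - G p x \<le> g2 * (y - x)"
    and Gcont: "\<And>Q. continuous_on {0..1} Q \<Longrightarrow>
      (\<And>p. p \<in> {0..1} \<Longrightarrow> P1 - a2 * (1 - p) \<le> Q p \<and> Q p \<le> P1 - a1 * (1 - p)) \<Longrightarrow>
      continuous_on {0..1} (\<lambda>p. G p (Q p))"
begin

definition in_range :: "(real \<Rightarrow> real) \<Rightarrow> bool" where
  "in_range Q \<longleftrightarrow> continuous_on {0..1} Q \<and>
     (\<forall>p\<in>{0..1}. P1 - a2 * (1 - p) \<le> Q p \<and> Q p \<le> P1 - a1 * (1 - p))"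

definition cone :: "(real \<Rightarrow> real) \<Rightarrow> bool" where
  "cone Q \<longleftrightarrow> Q 0 = P0 \<and> Q 1 = P1 \<and> (\<exists>Q'. has_deriv01 Q Q' \<and> (\<forall>p\<in>{0..1}. a1 < Q' p \<and> Q' p < a2))"

definition F :: "(real \<Rightarrow> real) \<Rightarrow> real" where
  "F Q = integral {0..1} (\<lambda>p. G p (Q p))"

text \<open>The lower envelope: the graph of every \<open>Q\<close> in the cone stays above the line of slope \<open>a1\<close> through the left
  end and the line of slope \<open>a2\<close> through the right end.\<close>

definition envelope :: "real \<Rightarrow> real" where
  "envelope p = max (P0 + a1 * p) (P1 - a2 * (1 - p))"

lemma Gint: "in_range Q \<Longrightarrow> (\<lambda>p. G p (Q p)) integrable_on {0..1}"
  using Gcont unfolding in_range_def by (intro integrable_continuous_real) blast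

lemma G_le:
  assumes "in_range Q" "in_range R" "p \<in> {0..1}" "Q p \<le> R p"
  shows "g1 * (R p - Q p) \<le> G p (R p) - G p (Q p)" "G p (R p) - G p (Q p) \<le> g2 * (R p - Q p)"
  using G[of p "Q p" "R p"] assms unfolding in_range_def by auto

lemma cone_bounds:
  assumes Q: "cone Q" and p: "p \<in> {0..1}"
  shows "P0 + a1 * p \<le> Q p" "P1 - a2 * (1 - p) \<le> Q p" "Q p \<le> P0 + a2 * p" "Q p \<le> P1 - a1 * (1 - p)"
    "0 < p \<Longrightarrow> P0 + a1 * p < Q p" "p < 1 \<Longrightarrow> P1 - a2 * (1 - p) < Q p"
proof -
  obtain Q' where Q': "has_deriv01 Q Q'" "\<forall>p\<in>{0..1}. a1 < Q' p \<and> Q' p < a2" and e: "Q 0 = P0" "Q 1 = P1"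
    using Q by (auto simp: cone_def)
  have d1: "has_deriv01 (\<lambda>p. Q p + (0 + (- a1) * p)) (\<lambda>p. Q' p + (- a1))"
    by (intro has_deriv01_add Q' has_deriv01_linear)
  have d2: "has_deriv01 (\<lambda>p. (0 + a2 * p) + (- 1) * Q p) (\<lambda>p. a2 + (- 1) * Q' p)"
    by (intro has_deriv01_add Q' has_deriv01_linear bounded_linear.has_deriv01[OF bounded_linear_mult_right])
  have 1: "Q s - a1 * s < Q t - a1 * t" "a2 * s - Q s < a2 * t - Q t" if "0 \<le> s" "s < t" "t \<le> 1" for s t
    using has_deriv01_pos_strict_mono[OF d1 _ that] has_deriv01_pos_strict_mono[OF d2 _ that] Q'(2) by auto
  show s1: "P0 + a1 * p < Q p" if "0 < p" using 1(1)[of 0 p] p e that by auto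
  show s2: "P1 - a2 * (1 - p) < Q p" if "p < 1" using 1(2)[of p 1] p e that by (auto simp: algebra_simps)
  show "P0 + a1 * p \<le> Q p" using s1 p e by (cases "p = 0") auto
  show "P1 - a2 * (1 - p) \<le> Q p" using s2 p e by (cases "p = 1") auto
  show "Q p \<le> P0 + a2 * p" using 1(2)[of 0 p] p e by (cases "p = 0") auto
  show "Q p \<le> P1 - a1 * (1 - p)" using 1(1)[of p 1] p e by (cases "p = 1") (auto simp: algebra_simps)
qed

lemma cone_in_range: "cone Q \<Longrightarrow> in_range Q"
  using cone_bounds[of Q] has_deriv01_continuous unfolding in_range_def cone_def by blast

lemma cone_convex:
  assumes "cone Q" "cone R" "0 \<le> s" "s \<le> 1"
  shows "cone (\<lambda>p. (1 - s) * Q p + s * R p)"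
proof -
  obtain Q' where Q': "has_deriv01 Q Q'" "\<forall>p\<in>{0..1}. a1 < Q' p \<and> Q' p < a2" and eQ: "Q 0 = P0" "Q 1 = P1"
    using assms(1) by (auto simp: cone_def)
  obtain R' where R': "has_deriv01 R R'" "\<forall>p\<in>{0..1}. a1 < R' p \<and> R' p < a2" and eR: "R 0 = P0" "R 1 = P1"
    using assms(2) by (auto simp: cone_def)
  have d: "has_deriv01 (\<lambda>p. (1 - s) * Q p + s * R p) (\<lambda>p. (1 - s) * Q' p + s * R' p)"
    by (intro has_deriv01_add bounded_linear.has_deriv01[OF bounded_linear_mult_right] Q' R')
  have "a1 < (1 - s) * Q' p + s * R' p \<and> (1 - s) * Q' p + s * R' p < a2" if p: "p \<in> {0..1}" for p
  proof -
    have *: "(1 - s) * x + s * y > 0" if "x > 0" "y > 0" for x y :: real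
      using that assms(3,4) by (cases "s = 0") (auto intro: add_nonneg_pos)
    from *[of "Q' p - a1" "R' p - a1"] *[of "a2 - Q' p" "a2 - R' p"] Q'(2) R'(2) p
    show ?thesis by (auto simp: algebra_simps)
  qed
  with d eQ eR show ?thesis unfolding cone_def by (auto simp: algebra_simps)
qed

text \<open>The envelope itself has a corner and extreme slopes. A branch of a hyperbola through the two end
  points, whose asymptotes are parallel to the two lines of the envelope and slightly below them,
  is smooth and has slopes strictly between those of its asymptotes.\<close>

lemma near_envelope:
  assumes ne: "cone Q" and \<epsilon>: "\<epsilon> > 0"
  obtains q where "\<And>k. Ck k q" "cone q" "\<And>p. p \<in> {0..1} \<Longrightarrow> q p \<le> envelope p + \<epsilon>"
    "\<And>p. p \<in> {0..1} \<Longrightarrow> q p \<le> (1 - p) * P0 + p * P1"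
proof -
  define A where "A = P1 - P0 - a1"
  define B where "B = a2 - (P1 - P0)"
  have AB: "A > 0" "B > 0" using cone_bounds(5)[OF ne, of 1] cone_bounds(6)[OF ne, of 0] ne
    by (auto simp: A_def B_def cone_def)
  define \<tau> where "\<tau> = min 1 (\<epsilon>\<^sup>2 / (2 * A * B))"
  have "\<tau> \<le> \<epsilon>\<^sup>2 / (2 * A * B)" unfolding \<tau>_def by (rule min.cobounded2)
  then have "2 * \<tau> * A * B \<le> \<epsilon>\<^sup>2" using AB by (simp add: pos_le_divide_eq mult_ac)
  moreover have "\<tau> > 0" "\<tau> \<le> 1" using AB \<epsilon> by (auto simp: \<tau>_def)
  ultimately have \<tau>: "\<tau> > 0" "\<tau> \<le> 1" "2 * \<tau> * A * B \<le> \<epsilon>\<^sup>2" by blast+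
  \<comment> \<open>The asymptotes \<open>u + w\<close> and \<open>u - w\<close> are lowered by \<open>\<tau> A\<close> and \<open>\<tau> B\<close>; this value of \<open>E\<close> makes \<open>(q - u - w) (q - u + w) = E\<close> hold at both ends.\<close>
  define E where "E = \<tau> * (\<tau> + 1) * A * B"
  have E: "E > 0" using \<tau> AB by (simp add: E_def)
  have "\<tau> * (\<tau> + 1) * (A * B) \<le> \<tau> * 2 * (A * B)" using \<tau> AB by (intro mult_right_mono mult_left_mono) auto
  then have E2: "sqrt E \<le> \<epsilon>" using \<tau>(3) \<epsilon> by (intro real_le_lsqrt) (auto simp: E_def mult_ac)
  define u where "u = (\<lambda>p. (P0 - \<tau> * A + P1 - a2 - \<tau> * B) / 2 + (a1 + a2) / 2 * p)"
  define w where "w = (\<lambda>p. (P0 - \<tau> * A - P1 + a2 + \<tau> * B) / 2 + (a1 - a2) / 2 * p)"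
  define q where "q = (\<lambda>p. u p + sqrt (w p * w p + E))"
  have wE: "w p * w p + E > 0" for p using E by (simp add: add_nonneg_pos)
  have up: "u p + w p = P0 + a1 * p - \<tau> * A" "u p - w p = P1 - a2 * (1 - p) - \<tau> * B" for p
    by (auto simp: u_def w_def field_simps)
  have q_le: "q p \<le> x" if "(x - (u p + w p)) * (x - (u p - w p)) \<ge> E" "x \<ge> u p" for x p
  proof -
    have "(x - u p)\<^sup>2 = (x - (u p + w p)) * (x - (u p - w p)) + w p * w p" by (simp add: power2_eq_square algebra_simps)
    then have "sqrt (w p * w p + E) \<le> x - u p" using that by (intro real_le_lsqrt) auto
    then show ?thesis by (simp add: q_def)
  qed
  have q_eq: "q p = x" if "(x - (u p + w p)) * (x - (u p - w p)) = E" "x \<ge> u p" for x p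
  proof -
    have "(x - u p)\<^sup>2 = w p * w p + E" using that(1) by (simp add: power2_eq_square algebra_simps)
    then have "sqrt (w p * w p + E) = x - u p" using that(2) by (metis diff_ge_0_iff_ge real_sqrt_unique)
    then show ?thesis by (simp add: q_def)
  qed
  have u2: "x \<ge> u p" if "x \<ge> u p + w p" "x \<ge> u p - w p" for x p using that by linarith
  have q0: "q 0 = P0" unfolding A_def[symmetric]
  proof (rule q_eq)
    show "(P0 - (u 0 + w 0)) * (P0 - (u 0 - w 0)) = E" unfolding up E_def B_def by (simp add: algebra_simps)
    have "P1 - a2 = P0 - B" by (simp add: B_def)
    then have "u 0 + w 0 \<le> P0" "u 0 - w 0 \<le> P0"
      using AB mult_pos_pos[OF \<tau>(1) AB(1)] mult_pos_pos[OF \<tau>(1) AB(2)] unfolding up by auto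
    then show "P0 \<ge> u 0" by linarith
  qed
  have q1: "q 1 = P1"
  proof (rule q_eq)
    show "(P1 - (u 1 + w 1)) * (P1 - (u 1 - w 1)) = E" unfolding up E_def A_def by (simp add: algebra_simps)
    have "P0 + a1 = P1 - A" by (simp add: A_def)
    then have "u 1 + w 1 \<le> P1" "u 1 - w 1 \<le> P1"
      using AB mult_pos_pos[OF \<tau>(1) AB(1)] mult_pos_pos[OF \<tau>(1) AB(2)] unfolding up by auto
    then show "P1 \<ge> u 1" by linarith
  qed
  show ?thesis
  proof (rule that[of q])
    show "Ck k q" for k
      unfolding q_def u_def w_def by (intro Ck_add Ck_mult Ck_sqrt Ck_const Ck_ident) (use wE in \<open>simp add: w_def\<close>)
    show "cone q"
      unfolding cone_def
    proof (intro conjI q0 q1 exI ballI)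
      have du: "has_deriv01 u (\<lambda>p. (a1 + a2) / 2)" unfolding u_def by (rule has_deriv01_linear)
      have dw: "has_deriv01 w (\<lambda>p. (a1 - a2) / 2)" unfolding w_def by (rule has_deriv01_linear)
      show "has_deriv01 q (\<lambda>p. (a1 + a2) / 2 + ((w p * ((a1 - a2) / 2) + (a1 - a2) / 2 * w p) + 0) / (2 * sqrt (w p * w p + E)))"
        unfolding q_def
        by (intro has_deriv01_add has_deriv01_sqrt du dw has_deriv01_const bounded_bilinear.has_deriv01[OF bounded_bilinear_mult] wE)
      fix p :: real
      define S where "S = sqrt (w p * w p + E)"
      have S: "S > \<bar>w p\<bar>" unfolding S_def by (rule real_less_rsqrt) (use E in \<open>simp add: power2_eq_square\<close>)
      have eq: "(a1 + a2) / 2 + ((w p * ((a1 - a2) / 2) + (a1 - a2) / 2 * w p) + 0) / (2 * S) = (a1 + a2) / 2 - (a2 - a1) / 2 * (w p / S)"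
        using S by (simp add: field_simps)
      have x: "\<bar>w p / S\<bar> < 1" using S by auto
      have a: "(a2 - a1) / 2 > 0" using AB by (simp add: A_def B_def)
      have "\<bar>(a2 - a1) / 2 * (w p / S)\<bar> < (a2 - a1) / 2"
        using mult_strict_left_mono[OF x a] unfolding abs_mult abs_of_pos[OF a] by simp
      moreover have "a1 < (a1 + a2) / 2 - y \<and> (a1 + a2) / 2 - y < a2" if "\<bar>y\<bar> < (a2 - a1) / 2" for y
        using that by (cases "y \<ge> 0") (simp_all add: field_simps)
      ultimately have "a1 < (a1 + a2) / 2 - (a2 - a1) / 2 * (w p / S) \<and> (a1 + a2) / 2 - (a2 - a1) / 2 * (w p / S) < a2"
        by blast
      then show "a1 < (a1 + a2) / 2 + ((w p * ((a1 - a2) / 2) + (a1 - a2) / 2 * w p) + 0) / (2 * sqrt (w p * w p + E))"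
        "(a1 + a2) / 2 + ((w p * ((a1 - a2) / 2) + (a1 - a2) / 2 * w p) + 0) / (2 * sqrt (w p * w p + E)) < a2"
        unfolding S_def[symmetric] eq by blast+
    qed
    fix p :: real assume p: "p \<in> {0..1}"
    show "q p \<le> envelope p + \<epsilon>"
    proof -
      have "sqrt (w p * w p + E) \<le> sqrt (w p * w p) + sqrt E" using E by (intro sqrt_add_le_add_sqrt) auto
      also have "\<dots> \<le> \<bar>w p\<bar> + \<epsilon>" using E2 by simp
      finally have "q p \<le> u p + \<bar>w p\<bar> + \<epsilon>" by (simp add: q_def)
      also have "u p + \<bar>w p\<bar> \<le> envelope p"
        using up[of p] mult_pos_pos[OF \<tau>(1) AB(1)] mult_pos_pos[OF \<tau>(1) AB(2)] unfolding envelope_def by linarith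
      finally show ?thesis by simp
    qed
    show "q p \<le> (1 - p) * P0 + p * P1"
    proof (rule q_le)
      let ?x = "(1 - p) * P0 + p * P1"
      have 1: "?x - (u p + w p) = A * (\<tau> + p)" unfolding up A_def by (simp add: algebra_simps)
      have 2: "?x - (u p - w p) = B * (\<tau> + (1 - p))" unfolding up B_def by (simp add: algebra_simps)
      have "E + A * B * (p * (1 - p)) = (A * (\<tau> + p)) * (B * (\<tau> + (1 - p)))" by (simp add: E_def algebra_simps)
      moreover have "A * B * (p * (1 - p)) \<ge> 0" using AB p by simp
      ultimately show "(?x - (u p + w p)) * (?x - (u p - w p)) \<ge> E" unfolding 1 2 by linarith
      have "A * (\<tau> + p) \<ge> 0" "B * (\<tau> + (1 - p)) \<ge> 0" using AB \<tau> p by auto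
      then show "?x \<ge> u p" unfolding 1[symmetric] 2[symmetric] by linarith
    qed
  qed
qed

lemma in_range_envelope: assumes "cone Q" shows "in_range envelope"
  unfolding in_range_def
proof (intro conjI ballI)
  show "continuous_on {0..1} envelope" unfolding envelope_def by (intro continuous_intros)
  fix p :: real assume p: "p \<in> {0..1}"
  show "P1 - a2 * (1 - p) \<le> envelope p" by (simp add: envelope_def)
  show "envelope p \<le> P1 - a1 * (1 - p)" using cone_bounds(1,2,4)[OF assms p] by (simp add: envelope_def)
qed

lemma envelope_le: "cone Q \<Longrightarrow> p \<in> {0..1} \<Longrightarrow> envelope p \<le> Q p"
  using cone_bounds[of Q p] by (simp add: envelope_def)

lemma integrable_diff_in_range: "in_range Q \<Longrightarrow> in_range R \<Longrightarrow> (\<lambda>p. R p - Q p) integrable_on {0..1}"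
  unfolding in_range_def by (intro integrable_continuous_real continuous_on_diff) auto

lemma F_diff: "in_range Q \<Longrightarrow> in_range R \<Longrightarrow> F R - F Q = integral {0..1} (\<lambda>p. G p (R p) - G p (Q p))"
  unfolding F_def by (rule integral_diff[symmetric]) (auto intro: Gint)

lemma F_mono:
  assumes Q: "in_range Q" and R: "in_range R" and le: "\<And>p. p \<in> {0..1} \<Longrightarrow> Q p \<le> R p"
  shows "g1 * integral {0..1} (\<lambda>p. R p - Q p) \<le> F R - F Q" "F R - F Q \<le> g2 * integral {0..1} (\<lambda>p. R p - Q p)"
proof -
  have i: "(\<lambda>p. c * (R p - Q p)) integrable_on {0..1}" for c
    by (rule integrable_on_mult_right[OF integrable_diff_in_range[OF Q R]])
  have j: "(\<lambda>p. G p (R p) - G p (Q p)) integrable_on {0..1}" by (rule integrable_diff[OF Gint[OF R] Gint[OF Q]])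
  show "g1 * integral {0..1} (\<lambda>p. R p - Q p) \<le> F R - F Q"
    unfolding F_diff[OF Q R] integral_mult_right[symmetric] by (rule integral_le[OF i j]) (rule G_le[OF Q R _ le])
  show "F R - F Q \<le> g2 * integral {0..1} (\<lambda>p. R p - Q p)"
    unfolding F_diff[OF Q R] integral_mult_right[symmetric] by (rule integral_le[OF j i]) (rule G_le[OF Q R _ le])
qed

text \<open>By the bounds on \<open>G\<close>, all elements of the level set of \<open>Q0\<close> lie above the envelope by the same
  definite amount \<open>\<nu>\<close> in the mean. A function that exceeds the envelope by much less than \<open>\<nu>\<close> is therefore,
  in the mean, below each of them, even after weighting the negative and positive parts of the
  difference by \<open>g1\<close> and \<open>g2\<close>; moving towards it decreases the functional.\<close>

lemma exists_lower:
  assumes Q0: "cone Q0"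
  obtains q where "\<And>k. Ck k q" "cone q" "\<And>p. p \<in> {0..1} \<Longrightarrow> q p \<le> (1 - p) * P0 + p * P1"
    "\<And>Q \<eta>. cone Q \<Longrightarrow> F Q = F Q0 \<Longrightarrow> 0 < \<eta> \<Longrightarrow> \<eta> \<le> 1 \<Longrightarrow> F (\<lambda>p. (1 - \<eta>) * Q p + \<eta> * q p) < F Q0"
proof -
  have g2: "g2 > 0" using g by linarith
  note m = in_range_envelope[OF Q0]
  define I where "I = (\<lambda>Q. integral {0..1} (\<lambda>p. Q p - envelope p))"
  have Ipos: "I Q0 > 0"
  proof -
    have nn: "\<And>p. p \<in> {0..1} \<Longrightarrow> 0 \<le> Q0 p - envelope p" using envelope_le[OF Q0] by simp
    have i: "(\<lambda>p. Q0 p - envelope p) integrable_on {0..1}" by (rule integrable_diff_in_range[OF m cone_in_range[OF Q0]])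
    have "I Q0 \<noteq> 0"
    proof
      assume "I Q0 = 0"
      then have "((\<lambda>p. Q0 p - envelope p) has_integral 0) (cbox 0 1)"
        using integrable_integral[OF i] by (simp add: I_def)
      moreover have "continuous_on (cbox 0 1) (\<lambda>p. Q0 p - envelope p)"
        using m cone_in_range[OF Q0] unfolding in_range_def by (auto intro: continuous_on_diff)
      ultimately have "Q0 (1/2) - envelope (1/2) = 0"
        using has_integral_0_cbox_imp_0[of 0 1 "\<lambda>p. Q0 p - envelope p" "1/2"] nn by auto
      then show False using cone_bounds(5,6)[OF Q0, of "1/2"] by (auto simp: envelope_def max_def split: if_splits)
    qed
    moreover have "I Q0 \<ge> 0" unfolding I_def by (rule integral_nonneg[OF i nn])
    ultimately show ?thesis by linarith
  qed
  define \<nu> where "\<nu> = (F Q0 - F envelope) / g2"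
  have "F Q0 - F envelope \<ge> g1 * I Q0"
    unfolding I_def by (rule F_mono(1)[OF m cone_in_range[OF Q0] envelope_le[OF Q0]])
  moreover have "g1 * I Q0 > 0" using g Ipos by simp
  ultimately have \<nu>: "\<nu> > 0" using g2 by (simp add: \<nu>_def)
  have I\<nu>: "I Q \<ge> \<nu>" if "cone Q" "F Q = F Q0" for Q
    using F_mono(2)[OF m cone_in_range[OF that(1)] envelope_le[OF that(1)]] that g2
    by (simp add: \<nu>_def I_def pos_divide_le_eq mult.commute)
  define \<epsilon> where "\<epsilon> = g1 * \<nu> / (2 * (g1 + g2))"
  have \<epsilon>: "\<epsilon> > 0" "g1 * (\<nu> - \<epsilon>) - g2 * \<epsilon> > 0"
  proof -
    show "\<epsilon> > 0" using g g2 \<nu> by (simp add: \<epsilon>_def)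
    have "(g1 + g2) * \<epsilon> = g1 * \<nu> / 2" using g g2 by (simp add: \<epsilon>_def field_simps)
    moreover have "g1 * \<nu> > 0" using g \<nu> by simp
    ultimately show "g1 * (\<nu> - \<epsilon>) - g2 * \<epsilon> > 0" by (simp add: algebra_simps)
  qed
  obtain q where q: "\<And>k. Ck k q" "cone q" "\<And>p. p \<in> {0..1} \<Longrightarrow> q p \<le> envelope p + \<epsilon>"
    "\<And>p. p \<in> {0..1} \<Longrightarrow> q p \<le> (1 - p) * P0 + p * P1"
    using near_envelope[OF Q0 \<epsilon>(1)] by metis
  show ?thesis
  proof (rule that[OF q(1,2,4)])
    fix Q \<eta> assume Q: "cone Q" "F Q = F Q0" and \<eta>: "0 < \<eta>" "\<eta> \<le> (1::real)"
    define R where "R = (\<lambda>p. (1 - \<eta>) * Q p + \<eta> * q p)"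
    have R: "cone R" unfolding R_def using \<eta> by (intro cone_convex Q q) auto
    note rQ = cone_in_range[OF Q(1)] and rR = cone_in_range[OF R] and rq = cone_in_range[OF q(2)]
    have pt: "\<eta> * (g1 * (Q p - envelope p) - (g1 + g2) * \<epsilon>) \<le> G p (Q p) - G p (R p)" if p: "p \<in> {0..1}" for p
    proof -
      define D where "D = Q p - q p"
      have RD: "R p = Q p - \<eta> * D" by (simp add: R_def D_def algebra_simps)
      have D: "D \<ge> Q p - envelope p - \<epsilon>" "D \<ge> - \<epsilon>" using q(3)[OF p] envelope_le[OF Q(1) p] by (auto simp: D_def)
      have "g1 * (Q p - envelope p) - (g1 + g2) * \<epsilon> \<le> g1 * D - g2 * \<epsilon>"
        using mult_left_mono[OF D(1), of g1] g by (simp add: algebra_simps)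
      then have "\<eta> * (g1 * (Q p - envelope p) - (g1 + g2) * \<epsilon>) \<le> \<eta> * (g1 * D - g2 * \<epsilon>)"
        using \<eta> by (intro mult_left_mono) auto
      also have "\<dots> \<le> G p (Q p) - G p (R p)"
      proof (cases "D \<ge> 0")
        case True
        then have "g1 * (Q p - R p) \<le> G p (Q p) - G p (R p)" using \<eta> by (intro G_le[OF rR rQ p]) (simp add: RD)
        moreover have "\<eta> * (g1 * D - g2 * \<epsilon>) \<le> g1 * (Q p - R p)" using g2 \<epsilon> \<eta> by (simp add: RD algebra_simps)
        ultimately show ?thesis by linarith
      next
        case False
        then have "G p (R p) - G p (Q p) \<le> g2 * (R p - Q p)"
          using \<eta> by (intro G_le[OF rQ rR p]) (simp add: RD mult_nonneg_nonpos)
        moreover have "\<eta> * (g1 * D - g2 * \<epsilon>) \<le> - (g2 * (R p - Q p))"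
        proof -
          have "g1 * D - g2 * \<epsilon> \<le> g2 * D"
          proof -
            have "g2 * - \<epsilon> \<le> g2 * D" using D(2) g2 by (intro mult_left_mono) auto
            moreover have "g1 * D \<le> 0" using False g by (simp add: mult_nonneg_nonpos)
            ultimately show ?thesis by simp
          qed
          then have "\<eta> * (g1 * D - g2 * \<epsilon>) \<le> \<eta> * (g2 * D)" using \<eta> by (intro mult_left_mono) auto
          then show ?thesis by (simp add: RD algebra_simps)
        qed
        ultimately show ?thesis by linarith
      qed
      finally show ?thesis .
    qed
    have iQ: "(\<lambda>p. Q p - envelope p) integrable_on {0..1}" by (rule integrable_diff_in_range[OF m rQ])
    have "\<eta> * (g1 * I Q - (g1 + g2) * \<epsilon>) = integral {0..1} (\<lambda>p. \<eta> * (g1 * (Q p - envelope p) - (g1 + g2) * \<epsilon>))"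
      unfolding I_def by (subst integral_mult_right, subst integral_diff) (auto intro!: integrable_on_mult_right iQ)
    also have "\<dots> \<le> F Q - F R"
      unfolding F_diff[OF rR rQ]
      by (rule integral_le) (auto intro!: integrable_on_mult_right integrable_diff iQ Gint rQ rR pt)
    finally have "\<eta> * (g1 * I Q - (g1 + g2) * \<epsilon>) \<le> F Q - F R" .
    moreover have "g1 * I Q - (g1 + g2) * \<epsilon> > 0"
    proof -
      have "g1 * \<nu> \<le> g1 * I Q" by (rule mult_left_mono[OF I\<nu>[OF Q]]) (use g in simp)
      moreover have "(g1 + g2) * \<epsilon> < g1 * \<nu>" using \<epsilon>(2) by (simp add: algebra_simps)
      ultimately show ?thesis by linarith
    qed
    ultimately show "F (\<lambda>p. (1 - \<eta>) * Q p + \<eta> * q p) < F Q0"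
      using \<eta> Q(2) mult_pos_pos[of \<eta> "g1 * I Q - (g1 + g2) * \<epsilon>"] unfolding R_def by linarith
  qed
qed

text \<open>The continuity of the shift in \<open>level_contraction\<close>: if two functions on the same level differ by
  \<open>\<delta> w\<close> up to a uniform error \<open>\<epsilon>\<close>, then \<open>\<delta>\<close> is of order \<open>\<epsilon>\<close>.\<close>

lemma level_shift_bound:
  assumes R: "in_range R" "in_range R'" and F: "F R = F R'" and w: "continuous_on {0..1} w"
    "\<And>p. p \<in> {0..1} \<Longrightarrow> w p \<ge> 0" and \<delta>: "\<delta> \<ge> 0" and \<epsilon>: "\<epsilon> \<ge> 0"
    and le: "\<And>p. p \<in> {0..1} \<Longrightarrow> R' p - R p \<ge> \<delta> * w p - \<epsilon>"
  shows "g1 * (\<delta> * integral {0..1} w) \<le> g2 * \<epsilon>"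
proof -
  have pt: "g1 * (\<delta> * w p) - g2 * \<epsilon> \<le> G p (R' p) - G p (R p)" if p: "p \<in> {0..1}" for p
  proof -
    have dw: "\<delta> * w p \<ge> 0" using w(2)[OF p] \<delta> by simp
    have ge: "g1 * \<epsilon> \<le> g2 * \<epsilon>" "g1 * (\<delta> * w p) \<le> g2 * (\<delta> * w p)" using g \<epsilon> dw by (auto intro: mult_right_mono)
    show ?thesis
    proof (cases "R p \<le> R' p")
      case True
      have "g1 * (\<delta> * w p - \<epsilon>) \<le> g1 * (R' p - R p)" using le[OF p] g by (intro mult_left_mono) auto
      then show ?thesis using G_le(1)[OF R p True] ge by (simp add: algebra_simps)
    next
      case False
      have "g2 * (\<delta> * w p - \<epsilon>) \<le> g2 * (R' p - R p)" using le[OF p] g by (intro mult_left_mono) auto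
      then show ?thesis using G_le(2)[OF R(2,1) p] False ge by (simp add: algebra_simps)
    qed
  qed
  have iw: "w integrable_on {0..1}" by (rule integrable_continuous_real[OF w(1)])
  have "g1 * (\<delta> * integral {0..1} w) - g2 * \<epsilon> = integral {0..1} (\<lambda>p. g1 * (\<delta> * w p) - g2 * \<epsilon>)"
    by (subst integral_diff) (auto intro!: integrable_on_mult_right iw)
  also have "\<dots> \<le> F R' - F R"
    unfolding F_diff[OF R]
    by (rule integral_le) (auto intro!: integrable_on_mult_right integrable_diff iw Gint R pt)
  finally show ?thesis using F by simp
qed

end

text \<open>The reflection \<open>Q \<mapsto> -Q\<close> exchanges the lower and the upper envelope.\<close>

lemma level_set_mirror:
  assumes "level_set a1 a2 P1 g1 g2 G"
  shows "level_set (- a2) (- a1) (- P1) g1 g2 (\<lambda>p x. - G p (- x))"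
proof -
  interpret level_set a1 a2 P0 P1 g1 g2 G for P0 by (rule assms)
  show ?thesis
  proof
    fix p x y :: real assume "p \<in> {0..1}" "- P1 - - a1 * (1 - p) \<le> x" "x \<le> y" "y \<le> - P1 - - a2 * (1 - p)"
    then show "g1 * (y - x) \<le> - G p (- y) - - G p (- x) \<and> - G p (- y) - - G p (- x) \<le> g2 * (y - x)"
      using G[of p "- y" "- x"] by auto
  next
    fix Q :: "real \<Rightarrow> real" assume "continuous_on {0..1} Q"
      "\<And>p. p \<in> {0..1} \<Longrightarrow> - P1 - - a1 * (1 - p) \<le> Q p \<and> Q p \<le> - P1 - - a2 * (1 - p)"
    then show "continuous_on {0..1} (\<lambda>p. - G p (- Q p))"
      by (intro continuous_on_minus Gcont) (auto, fastforce+)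
  qed (rule g)+
qed

context level_set
begin

lemma exists_upper:
  assumes Q0: "cone Q0"
  obtains q where "\<And>k. Ck k q" "cone q" "\<And>p. p \<in> {0..1} \<Longrightarrow> q p \<ge> (1 - p) * P0 + p * P1"
    "\<And>Q \<eta>. cone Q \<Longrightarrow> F Q = F Q0 \<Longrightarrow> 0 < \<eta> \<Longrightarrow> \<eta> \<le> 1 \<Longrightarrow> F (\<lambda>p. (1 - \<eta>) * Q p + \<eta> * q p) > F Q0"
proof -
  interpret m: level_set "- a2" "- a1" "- P0" "- P1" g1 g2 "\<lambda>p x. - G p (- x)"
    by (rule level_set_mirror) (rule level_set_axioms)
  have F: "m.F R = - F (\<lambda>p. - R p)" for R by (simp add: F_def m.F_def)
  have dm: "has_deriv01 f f' \<Longrightarrow> has_deriv01 (\<lambda>p. - f p) (\<lambda>p. - f' p)" for f f' :: "real \<Rightarrow> real"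
    by (rule bounded_linear.has_deriv01[OF bounded_linear_minus[OF bounded_linear_ident]])
  have c1: "m.cone (\<lambda>p. - R p)" if "cone R" for R
    using that dm unfolding cone_def m.cone_def by fastforce
  have c2: "cone (\<lambda>p. - R p)" if "m.cone R" for R
    using that dm unfolding cone_def m.cone_def by fastforce
  obtain q where q: "\<And>k. Ck k q" "m.cone q" "\<And>p. p \<in> {0..1} \<Longrightarrow> q p \<le> (1 - p) * - P0 + p * - P1"
    "\<And>Q \<eta>. m.cone Q \<Longrightarrow> m.F Q = m.F (\<lambda>p. - Q0 p) \<Longrightarrow> 0 < \<eta> \<Longrightarrow> \<eta> \<le> 1 \<Longrightarrow>
       m.F (\<lambda>p. (1 - \<eta>) * Q p + \<eta> * q p) < m.F (\<lambda>p. - Q0 p)"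
  proof (rule m.exists_lower[OF c1[OF Q0]], goal_cases)
    case (1 q)
    show ?thesis by (rule 1(1)) (fact 1)+
  qed
  show ?thesis
  proof (rule that[of "\<lambda>p. - q p"])
    show "Ck k (\<lambda>p. - q p)" for k using Ck_mult[OF Ck_const[of k "-1"] q(1)] by simp
    show "cone (\<lambda>p. - q p)" by (rule c2[OF q(2)])
    show "- q p \<ge> (1 - p) * P0 + p * P1" if "p \<in> {0..1}" for p using q(3)[OF that] by simp
    fix Q \<eta> assume "cone Q" "F Q = F Q0" "0 < \<eta>" "\<eta> \<le> (1::real)"
    with q(4)[OF c1, of Q \<eta>] show "F Q0 < F (\<lambda>p. (1 - \<eta>) * Q p + \<eta> * - q p)"
      by (simp add: F)
  qed
qed

text \<open>Let \<open>a\<close> and \<open>b\<close> be near the lower and the upper envelope. Replacing \<open>Q\<close> by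
  \<open>(1 - \<eta>) Q + (\<eta> - \<mu>) a + \<mu> b\<close> with \<open>0 \<le> \<mu> \<le> \<eta>\<close>, the functional is below the level for
  \<open>\<mu> = 0\<close>, above it for \<open>\<mu> = \<eta>\<close>, and strictly increasing in \<open>\<mu>\<close>. The unique \<open>\<mu>\<close> that hits
  the level depends continuously on \<open>\<eta>\<close> and \<open>Q\<close>, and for \<open>\<eta> = 1\<close> the function \<open>Q\<close> is
  forgotten. Only a scalar depends nonlinearly on \<open>Q\<close>, so convergence in every \<open>C\<^sup>k\<close> is
  preserved.\<close>

lemma level_contraction:
  assumes Q0: "cone Q0"
  obtains N :: "real \<Rightarrow> (real \<Rightarrow> real) \<Rightarrow> real \<Rightarrow> real" and q
  where "\<And>s Q. s \<in> {0..1} \<Longrightarrow> cone Q \<Longrightarrow> F Q = F Q0 \<Longrightarrow> cone (N s Q) \<and> F (N s Q) = F Q0"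
    "\<And>Q. cone Q \<Longrightarrow> F Q = F Q0 \<Longrightarrow> N 0 Q = Q" "\<And>Q. cone Q \<Longrightarrow> F Q = F Q0 \<Longrightarrow> N 1 Q = q"
    "\<And>k (\<F> :: 'i filter) s s0 Qs Q. (s \<longlongrightarrow> s0) \<F> \<Longrightarrow> s0 \<in> {0..1} \<Longrightarrow> cone Q \<Longrightarrow> F Q = F Q0 \<Longrightarrow>
       \<forall>\<^sub>F i in \<F>. s i \<in> {0..1} \<and> cone (Qs i) \<and> F (Qs i) = F Q0 \<Longrightarrow>
       Ck_tendsto k \<F> Qs Q \<Longrightarrow> Ck_tendsto k \<F> (\<lambda>i. N (s i) (Qs i)) (N s0 Q)"
    "\<And>k s Q. Ck k Q \<Longrightarrow> Ck k (N s Q)"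
proof -
  obtain a where a: "\<And>k. Ck k a" "cone a" "\<And>p. p \<in> {0..1} \<Longrightarrow> a p \<le> (1 - p) * P0 + p * P1"
    "\<And>Q \<eta>. cone Q \<Longrightarrow> F Q = F Q0 \<Longrightarrow> 0 < \<eta> \<Longrightarrow> \<eta> \<le> 1 \<Longrightarrow> F (\<lambda>p. (1 - \<eta>) * Q p + \<eta> * a p) < F Q0"
  proof (rule exists_lower[OF Q0], goal_cases)
    case (1 q)
    show ?thesis by (rule 1(1)) (fact 1)+
  qed
  obtain b where b: "\<And>k. Ck k b" "cone b" "\<And>p. p \<in> {0..1} \<Longrightarrow> b p \<ge> (1 - p) * P0 + p * P1"
    "\<And>Q \<eta>. cone Q \<Longrightarrow> F Q = F Q0 \<Longrightarrow> 0 < \<eta> \<Longrightarrow> \<eta> \<le> 1 \<Longrightarrow> F (\<lambda>p. (1 - \<eta>) * Q p + \<eta> * b p) > F Q0"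
  proof (rule exists_upper[OF Q0], goal_cases)
    case (1 q)
    show ?thesis by (rule 1(1)) (fact 1)+
  qed
  define w where "w = (\<lambda>p. b p - a p)"
  have w0: "w p \<ge> 0" if "p \<in> {0..1}" for p using a(3)[OF that] b(3)[OF that] by (simp add: w_def)
  have wc: "continuous_on {0..1} w" unfolding w_def by (intro continuous_on_diff Ck_continuous a(1) b(1))
  note ra = cone_in_range[OF a(2)] and rb = cone_in_range[OF b(2)]
  define W where "W = integral {0..1} w"
  have W: "W > 0"
  proof -
    have "F a < F Q0" "F Q0 < F b" using a(4)[OF Q0 refl, of 1] b(4)[OF Q0 refl, of 1] by simp_all
    moreover have "F b - F a \<le> g2 * W"
      unfolding W_def w_def by (rule F_mono(2)[OF ra rb]) (use w0 in \<open>simp add: w_def\<close>)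
    ultimately have "g2 * W > 0" by linarith
    then show ?thesis using g by (simp add: zero_less_mult_iff)
  qed
  define R where "R = (\<lambda>\<mu> \<eta> Q p. ((1 - \<eta>) * Q p + \<eta> * a p) + \<mu> * w p)"
  have coneR: "cone (R \<mu> \<eta> Q)" if "cone Q" "0 \<le> \<mu>" "\<mu> \<le> \<eta>" "\<eta> \<le> 1" for \<mu> \<eta> Q
  proof (cases "\<eta> = 0")
    case True
    then show ?thesis using that by (simp add: R_def)
  next
    case False
    then have \<eta>: "\<eta> > 0" using that by simp
    have "cone (\<lambda>p. (1 - \<eta>) * Q p + \<eta> * ((1 - \<mu> / \<eta>) * a p + (\<mu> / \<eta>) * b p))"
      using that \<eta> by (intro cone_convex a b) auto
    moreover have "(\<lambda>p. (1 - \<eta>) * Q p + \<eta> * ((1 - \<mu> / \<eta>) * a p + (\<mu> / \<eta>) * b p)) = R \<mu> \<eta> Q"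
      using \<eta> by (auto simp: R_def w_def fun_eq_iff algebra_simps)
    ultimately show ?thesis by simp
  qed
  have FR: "g1 * ((\<mu>' - \<mu>) * W) \<le> F (R \<mu>' \<eta> Q) - F (R \<mu> \<eta> Q)" "F (R \<mu>' \<eta> Q) - F (R \<mu> \<eta> Q) \<le> g2 * ((\<mu>' - \<mu>) * W)"
    if "cone Q" "0 \<le> \<mu>" "\<mu> \<le> \<mu>'" "\<mu>' \<le> \<eta>" "\<eta> \<le> 1" for \<mu> \<mu>' \<eta> Q
  proof -
    have r: "in_range (R \<mu> \<eta> Q)" "in_range (R \<mu>' \<eta> Q)" using that by (auto intro!: cone_in_range coneR)
    have le: "R \<mu> \<eta> Q p \<le> R \<mu>' \<eta> Q p" if "p \<in> {0..1}" for p
      using w0[OF that] \<open>\<mu> \<le> \<mu>'\<close> by (simp add: R_def mult_right_mono)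
    have "integral {0..1} (\<lambda>p. R \<mu>' \<eta> Q p - R \<mu> \<eta> Q p) = integral {0..1} (\<lambda>p. (\<mu>' - \<mu>) * w p)"
      by (simp add: R_def algebra_simps)
    also have "\<dots> = (\<mu>' - \<mu>) * W" unfolding W_def by (rule integral_mult_right)
    finally have i: "integral {0..1} (\<lambda>p. R \<mu>' \<eta> Q p - R \<mu> \<eta> Q p) = (\<mu>' - \<mu>) * W" .
    show "g1 * ((\<mu>' - \<mu>) * W) \<le> F (R \<mu>' \<eta> Q) - F (R \<mu> \<eta> Q)" "F (R \<mu>' \<eta> Q) - F (R \<mu> \<eta> Q) \<le> g2 * ((\<mu>' - \<mu>) * W)"
      using F_mono[OF r le] unfolding i by blast+
  qed
  have ex: "\<exists>!\<mu>. 0 \<le> \<mu> \<and> \<mu> \<le> \<eta> \<and> F (R \<mu> \<eta> Q) = F Q0"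
    if Q: "cone Q" "F Q = F Q0" and \<eta>: "\<eta> \<in> {0..1}" for \<eta> Q
  proof (rule ex_ex1I)
    have g2W: "g2 * W \<ge> 0" using g W by auto
    have "lipschitz_on (g2 * W) {0..\<eta>} (\<lambda>\<mu>. F (R \<mu> \<eta> Q))"
    proof (rule lipschitz_on_leI)
      fix \<mu> \<mu>' assume "\<mu> \<in> {0..\<eta>}" "\<mu>' \<in> {0..\<eta>}" "\<mu> \<le> \<mu>'"
      then have "g1 * ((\<mu>' - \<mu>) * W) \<le> F (R \<mu>' \<eta> Q) - F (R \<mu> \<eta> Q)" "F (R \<mu>' \<eta> Q) - F (R \<mu> \<eta> Q) \<le> g2 * ((\<mu>' - \<mu>) * W)"
        using FR[OF Q(1), of \<mu> \<mu>' \<eta>] \<eta> by auto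
      moreover have "g1 * ((\<mu>' - \<mu>) * W) \<ge> 0" using g W \<open>\<mu> \<le> \<mu>'\<close> by simp
      ultimately show "dist (F (R \<mu> \<eta> Q)) (F (R \<mu>' \<eta> Q)) \<le> g2 * W * dist \<mu> \<mu>'"
        using \<open>\<mu> \<le> \<mu>'\<close> by (simp add: dist_real_def mult_ac)
    qed (rule g2W)
    then have "continuous_on {0..\<eta>} (\<lambda>\<mu>. F (R \<mu> \<eta> Q))" by (rule lipschitz_on_continuous_on)
    moreover have "F (R 0 \<eta> Q) \<le> F Q0" "F Q0 \<le> F (R \<eta> \<eta> Q)"
    proof -
      have "R \<eta> \<eta> Q = (\<lambda>p. (1 - \<eta>) * Q p + \<eta> * b p)" by (auto simp: R_def w_def algebra_simps)
      then show "F (R 0 \<eta> Q) \<le> F Q0" "F Q0 \<le> F (R \<eta> \<eta> Q)"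
        using a(4)[OF Q, of \<eta>] b(4)[OF Q, of \<eta>] Q \<eta> by (cases "\<eta> = 0"; simp add: R_def)+
    qed
    ultimately show "\<exists>\<mu>. 0 \<le> \<mu> \<and> \<mu> \<le> \<eta> \<and> F (R \<mu> \<eta> Q) = F Q0"
      using IVT'[of "\<lambda>\<mu>. F (R \<mu> \<eta> Q)" 0 "F Q0" \<eta>] \<eta> by auto
    have le: "\<mu>' \<le> \<mu>" if "0 \<le> \<mu>" "\<mu> \<le> \<mu>'" "\<mu>' \<le> \<eta>" "F (R \<mu> \<eta> Q) = F (R \<mu>' \<eta> Q)" for \<mu> \<mu>'
    proof -
      have "g1 * ((\<mu>' - \<mu>) * W) \<le> 0" using FR(1)[OF Q(1) that(1-3)] that(4) \<eta> by simp
      then show ?thesis using g W by (simp add: mult_le_0_iff)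
    qed
    fix \<mu> \<mu>' assume "0 \<le> \<mu> \<and> \<mu> \<le> \<eta> \<and> F (R \<mu> \<eta> Q) = F Q0" "0 \<le> \<mu>' \<and> \<mu>' \<le> \<eta> \<and> F (R \<mu>' \<eta> Q) = F Q0"
    then show "\<mu> = \<mu>'" using le[of \<mu> \<mu>'] le[of \<mu>' \<mu>] by (cases "\<mu> \<le> \<mu>'") auto
  qed
  define m where "m = (\<lambda>\<eta> Q. THE \<mu>. 0 \<le> \<mu> \<and> \<mu> \<le> \<eta> \<and> F (R \<mu> \<eta> Q) = F Q0)"
  have m: "0 \<le> m \<eta> Q" "m \<eta> Q \<le> \<eta>" "F (R (m \<eta> Q) \<eta> Q) = F Q0" if "cone Q" "F Q = F Q0" "\<eta> \<in> {0..1}" for \<eta> Q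
    using theI'[OF ex[OF that]] unfolding m_def by blast+
  have m_tendsto: "((\<lambda>i. m (s i) (Qs i)) \<longlongrightarrow> m s0 Q) \<F>"
    if s: "(s \<longlongrightarrow> s0) \<F>" "s0 \<in> {0..1}" and Q: "cone Q" "F Q = F Q0"
      and ev: "\<forall>\<^sub>F i in \<F>. s i \<in> {0..1} \<and> cone (Qs i) \<and> F (Qs i) = F Q0" and lim: "C0_tendsto \<F> Qs Q"
    for \<F> :: "'i filter" and s s0 Qs Q
  proof (rule tendstoI)
    fix e :: real assume e: "e > 0"
    define \<epsilon> where "\<epsilon> = e * (g1 * W) / (2 * g2)"
    have g2: "g2 > 0" using g by linarith
    have \<epsilon>: "\<epsilon> > 0" using e g W g2 by (simp add: \<epsilon>_def)
    have "C0_tendsto \<F> (\<lambda>i p. (1 - s i) * Qs i p + s i * a p) (\<lambda>p. (1 - s0) * Q p + s0 * a p)"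
      using Ck_tendsto_affine[OF s(1), of 0 Qs Q "\<lambda>_. a" a] lim Ck_tendsto_const_family[OF a(1)[of 0], of \<F>] by simp
    from C0_tendstoD[OF this \<epsilon>] ev show "\<forall>\<^sub>F i in \<F>. dist (m (s i) (Qs i)) (m s0 Q) < e"
    proof eventually_elim
      case (elim i)
      define \<mu> where "\<mu> = m (s i) (Qs i)"
      define \<mu>0 where "\<mu>0 = m s0 Q"
      have mi: "0 \<le> \<mu>" "\<mu> \<le> s i" "F (R \<mu> (s i) (Qs i)) = F Q0" using m[of "Qs i" "s i"] elim by (auto simp: \<mu>_def)
      have m0: "0 \<le> \<mu>0" "\<mu>0 \<le> s0" "F (R \<mu>0 s0 Q) = F Q0" using m[OF Q s(2)] by (auto simp: \<mu>0_def)
      have r: "in_range (R \<mu> (s i) (Qs i))" "in_range (R \<mu>0 s0 Q)"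
        using elim mi m0 Q s(2) by (auto intro!: cone_in_range coneR)
      have d: "\<bar>(R \<mu> (s i) (Qs i) p - R \<mu>0 s0 Q p) - (\<mu> - \<mu>0) * w p\<bar> \<le> \<epsilon>" if "p \<in> {0..1}" for p
        using bspec[OF elim(1) that] by (simp add: R_def dist_real_def algebra_simps)
      have fin: "\<delta> < e" if "g1 * (\<delta> * W) \<le> g2 * \<epsilon>" for \<delta>
      proof -
        have "g2 * \<epsilon> = e * (g1 * W) / 2" using g2 by (simp add: \<epsilon>_def)
        then have "\<delta> * (g1 * W) \<le> (e / 2) * (g1 * W)" using that by (simp add: mult_ac)
        then have "\<delta> \<le> e / 2" using g W by simp
        then show ?thesis using e by simp
      qed
      have "\<bar>\<mu> - \<mu>0\<bar> < e"
      proof (cases "\<mu>0 \<le> \<mu>")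
        case True
        have "g1 * ((\<mu> - \<mu>0) * integral {0..1} w) \<le> g2 * \<epsilon>"
          by (rule level_shift_bound[OF r(2,1) _ wc w0]) (use mi m0 True \<epsilon> d in \<open>auto simp: abs_le_iff\<close>, use d in \<open>force simp: abs_le_iff\<close>)
        then show ?thesis using fin True by (simp add: W_def)
      next
        case False
        have "g1 * ((\<mu>0 - \<mu>) * integral {0..1} w) \<le> g2 * \<epsilon>"
        proof (rule level_shift_bound[OF r _ wc w0])
          fix p :: real assume "p \<in> {0..1}"
          from d[OF this] show "R \<mu>0 s0 Q p - R \<mu> (s i) (Qs i) p \<ge> (\<mu>0 - \<mu>) * w p - \<epsilon>"
            unfolding left_diff_distrib by linarith
        qed (use mi m0 False \<epsilon> in auto)
        then show ?thesis using fin False by (simp add: W_def)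
      qed
      then show ?case by (simp add: dist_real_def \<mu>_def \<mu>0_def)
    qed
  qed
  show ?thesis
  proof (rule that[of "\<lambda>s Q. R (m s Q) s Q" "R (m 1 Q0) 1 Q0"])
    show "cone (R (m s Q) s Q) \<and> F (R (m s Q) s Q) = F Q0" if "s \<in> {0..1}" "cone Q" "F Q = F Q0" for s Q
      using m[OF that(2,3,1)] coneR[OF that(2), of "m s Q" s] that(1) by auto
    show "R (m 0 Q) 0 Q = Q" if "cone Q" "F Q = F Q0" for Q
      using m[OF that, of 0] by (simp add: R_def)
    show "R (m 1 Q) 1 Q = R (m 1 Q0) 1 Q0" for Q
    proof -
      have "R \<mu> 1 Q = R \<mu> 1 Q0" for \<mu> by (simp add: R_def)
      then show ?thesis by (simp add: m_def)
    qed
    show "Ck_tendsto k \<F> (\<lambda>i. R (m (s i) (Qs i)) (s i) (Qs i)) (R (m s0 Q) s0 Q)"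
      if "(s \<longlongrightarrow> s0) \<F>" "s0 \<in> {0..1}" "cone Q" "F Q = F Q0"
        "\<forall>\<^sub>F i in \<F>. s i \<in> {0..1} \<and> cone (Qs i) \<and> F (Qs i) = F Q0" "Ck_tendsto k \<F> Qs Q"
      for k and \<F> :: "'i filter" and s s0 Qs Q
      unfolding R_def[abs_def]
      by (intro Ck_tendsto_add Ck_tendsto_mult[OF Ck_tendsto_const] Ck_tendsto_affine Ck_tendsto_const_family
          a(1) m_tendsto[OF that(1-5) Ck_tendsto_C0[OF that(6)]] that)
        (unfold w_def, intro Ck_diff a b)
    show "Ck k (R (m s Q) s Q)" if "Ck k Q" for k s Q
      unfolding R_def[abs_def] w_def by (intro Ck_add Ck_mult Ck_const Ck_diff a b that)
  qed
qed

end

section \<open>Graphs over the height\<close>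

lemma has_deriv01_inverse_height:
  assumes "has_deriv01 y y'" "\<And>t. t \<in> {0..1} \<Longrightarrow> y t > 0"
  shows "has_deriv01 (\<lambda>t. inverse (y t)) (\<lambda>t. - (y' t / (y t)\<^sup>2 :: real))"
  by (rule has_deriv01_cong[OF has_deriv01_inverse[OF assms(1)]])
    (use assms(2) in \<open>force simp: power2_eq_square divide_inverse\<close>)+

lemma diffeo01_deriv01:
  assumes "diffeo01 T"
  shows "has_deriv01 T (deriv01 T)" "\<And>t. t \<in> {0..1} \<Longrightarrow> deriv01 T t > 0"
proof -
  obtain T' where T': "has_deriv01 T T'" "\<forall>t\<in>{0..1}. T' t > 0" using assms by (auto simp: diffeo01_def)
  show "has_deriv01 T (deriv01 T)"
    by (rule has_deriv01_cong[OF T'(1)]) (use has_deriv01_imp_deriv01[OF T'(1)] in auto)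
  show "deriv01 T t > 0" if "t \<in> {0..1}" for t
    using has_deriv01_imp_deriv01[OF T'(1) that] T'(2) that by simp
qed

lemma diffeo01_convex:
  assumes "diffeo01 S" "diffeo01 T" "s \<in> {0..1}"
  shows "diffeo01 (\<lambda>t. (1 - s) * S t + s * T t)"
proof -
  have d: "has_deriv01 (\<lambda>t. (1 - s) * S t + s * T t) (\<lambda>t. (1 - s) * deriv01 S t + s * deriv01 T t)"
    by (intro has_deriv01_add bounded_linear.has_deriv01[OF bounded_linear_mult_right] diffeo01_deriv01(1) assms)
  have "(1 - s) * deriv01 S t + s * deriv01 T t > 0" if "t \<in> {0..1}" for t
    using diffeo01_deriv01(2)[OF assms(1) that] diffeo01_deriv01(2)[OF assms(2) that] assms(3)
    by (cases "s = 0") (auto intro: add_nonneg_pos)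
  with d show ?thesis using assms unfolding diffeo01_def by (auto simp: algebra_simps)
qed

lemma diffeo01_ident: "diffeo01 (\<lambda>t. t)"
proof -
  have "has_deriv01 (\<lambda>t. t) (\<lambda>t. 1::real)" by (simp add: has_deriv01_def)
  then show ?thesis unfolding diffeo01_def by (auto intro!: exI[of _ "\<lambda>t. 1"])
qed

lemma Im_scaled_quotient:
  assumes "lam \<noteq> (0::real)" "e \<noteq> (0::complex)"
  shows "Im ((c *\<^sub>R (of_real lam * e' + of_real lam' * e)) / (of_real lam * e)) = c * Im (e' / e)"
proof -
  have "(c *\<^sub>R (of_real lam * e' + of_real lam' * e)) / (of_real lam * e) = of_real c * (e' / e + of_real (lam' / lam))"
    using assms by (simp add: scaleR_conv_of_real field_simps)
  then show ?thesis by simp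
qed

text \<open>Upward curves from \<open>z0\<close> to \<open>z1\<close>, in the inverse height \<open>s = 1/y\<close>, which decreases from
  \<open>s0\<close> to \<open>s1\<close> and is parametrised by \<open>s = s0 - h p\<close>. The momentum \<open>P = cos \<theta> / y\<close> satisfies
  \<open>dP/dp = - h \<kappa>\<close>, so curvatures in \<open>(k1, k2)\<close> are slopes in \<open>(a1, a2)\<close>. The margin \<open>\<omega>\<close> keeps
  \<open>\<bar>P\<bar>\<close> away from \<open>s\<close>, where the direction would become horizontal. It is positive because
  the final direction is not horizontal, and it is kept on the way because \<open>P\<close> changes at most as fast as \<open>s\<close>.\<close>

locale height_graph =
  fixes x0 x1 s0 s1 \<theta>0 \<theta>1 k1 k2 :: real and z0 z1 :: complex and h a1 a2 P0 P1 \<omega> :: real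
  assumes s: "0 < s1" "s1 < s0" and sin: "sin \<theta>0 > 0" "sin \<theta>1 > 0" and k: "- 1 \<le> k1" "k1 < k2" "k2 \<le> 1"
    and z: "z0 = Complex x0 (inverse s0)" "z1 = Complex x1 (inverse s1)"
    and h: "h = s0 - s1" and a: "a1 = - (h * k2)" "a2 = - (h * k1)"
    and P: "P0 = s0 * cos \<theta>0" "P1 = s1 * cos \<theta>1" and \<omega>: "\<omega> = s1 - \<bar>P1\<bar>"
begin

definition height :: "real \<Rightarrow> real" where "height p = s0 - h * p"

text \<open>With \<open>P = s cos \<theta>\<close> one has \<open>dx/dy = cot \<theta> = P / sqrt (s\<^sup>2 - P\<^sup>2)\<close> and \<open>dy = - ds / s\<^sup>2\<close>, so
  \<open>dx/dp = h G p P\<close>. The \<open>height\<close> is the inverse height \<open>s\<close>.\<close>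

definition G :: "real \<Rightarrow> real \<Rightarrow> real" where
  "G p x = x / ((height p * height p) * sqrt (height p * height p - x * x))"

abbreviation (input) "slow_curves q \<equiv> curve_space (Suc (Suc q)) (ereal k1) (ereal k2) (frame (z0, \<theta>0)) (frame (z1, \<theta>1))"

lemma hpos: "h > 0" using s h by simp

lemma \<omega>pos: "\<omega> > 0"
proof -
  have "(sin \<theta>1)\<^sup>2 > 0" using sin by simp
  then have "(cos \<theta>1)\<^sup>2 < 1" using sin_cos_squared_add[of \<theta>1] by linarith
  then have "\<bar>cos \<theta>1\<bar> < 1" by (simp add: abs_square_less_1)
  then have "s1 * \<bar>cos \<theta>1\<bar> < s1 * 1" using s by (intro mult_strict_left_mono) auto
  then show ?thesis using s by (simp add: \<omega> P abs_mult)
qed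

lemma height_bounds: "p \<in> {0..1} \<Longrightarrow> s1 \<le> height p \<and> height p \<le> s0"
proof -
  assume p: "p \<in> {0..1}"
  then have "0 \<le> h * p" "h * p \<le> h" using hpos mult_left_le[of p h] by auto
  then show ?thesis unfolding height_def using h by linarith
qed

lemma height_pos: "p \<in> {0..1} \<Longrightarrow> height p > 0"
  using height_bounds s by fastforce

lemma height_ends: "height 0 = s0" "height 1 = s1"
  unfolding height_def using h by simp_all

lemma height_nz: "p \<in> {0..1} \<Longrightarrow> height p \<noteq> 0"
  using height_pos by fastforce

lemma in_strip:
  assumes p: "p \<in> {0..1}" and x: "P1 - a2 * (1 - p) \<le> x" "x \<le> P1 - a1 * (1 - p)"
  shows "\<bar>x\<bar> \<le> height p - \<omega>"
proof -
  have "a2 * (1 - p) \<le> h * (1 - p)" "- a1 * (1 - p) \<le> h * (1 - p)"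
  proof -
    have "a2 \<le> h" "- a1 \<le> h"
      unfolding a using mult_left_mono[OF k(1), of h] mult_left_mono[OF k(3), of h] hpos by simp_all
    then show "a2 * (1 - p) \<le> h * (1 - p)" "- a1 * (1 - p) \<le> h * (1 - p)"
      using p by (intro mult_right_mono; simp)+
  qed
  moreover have "height p = s1 + h * (1 - p)" unfolding height_def using h by (simp add: algebra_simps)
  ultimately show ?thesis using x unfolding \<omega> by (simp add: abs_if split: if_splits)
qed

lemma strip_root:
  assumes p: "p \<in> {0..1}" and x: "\<bar>x\<bar> \<le> height p - \<omega>"
  shows "height p * height p - x * x > 0" "\<omega> \<le> sqrt (height p * height p - x * x)"
    "sqrt (height p * height p - x * x) \<le> s0"
proof -
  have "\<omega> * \<omega> \<le> (height p - \<bar>x\<bar>) * (height p + \<bar>x\<bar>)"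
    using x \<omega>pos height_pos[OF p] by (intro mult_mono) auto
  also have "\<dots> = height p * height p - x * x" by (simp add: algebra_simps)
  finally have 1: "\<omega> * \<omega> \<le> height p * height p - x * x" .
  have "\<omega> * \<omega> > 0" using \<omega>pos by simp
  then show "height p * height p - x * x > 0" using 1 by linarith
  show "\<omega> \<le> sqrt (height p * height p - x * x)" using 1 \<omega>pos by (intro real_le_rsqrt) (simp add: power2_eq_square)
  have "height p * height p \<le> s0 * s0" using height_bounds[OF p] height_pos[OF p] by (intro mult_mono) auto
  moreover have "x * x \<ge> 0" by simp
  ultimately have "height p * height p - x * x \<le> s0 * s0" by linarith
  then show "sqrt (height p * height p - x * x) \<le> s0" using s by (intro real_le_lsqrt) (auto simp: power2_eq_square)
qed

lemma G_deriv:
  assumes p: "p \<in> {0..1}" and x: "\<bar>x\<bar> \<le> height p - \<omega>"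
  shows "(G p has_real_derivative inverse ((sqrt (height p * height p - x * x))^3)) (at x)"
proof -
  define c where "c = height p * height p"
  define S where "S = sqrt (c - x * x)"
  have c: "c > 0" using height_pos[OF p] by (simp add: c_def)
  have pos: "c - x * x > 0" using strip_root(1)[OF assms] by (simp add: c_def)
  have S: "S > 0" "S * S = c - x * x" using pos by (auto simp: S_def)
  have "((\<lambda>x. x / (c * sqrt (c - x * x))) has_real_derivative
      (1 * (c * S) - x * (c * (- (2 * x) / (2 * S)))) / ((c * S) * (c * S))) (at x)"
    unfolding S_def using pos c by (auto intro!: derivative_eq_intros simp: field_simps)
  moreover have "(1 * (c * S) - x * (c * (- (2 * x) / (2 * S)))) / ((c * S) * (c * S)) = inverse (S^3)"
  proof -
    have "1 * (c * S) - x * (c * (- (2 * x) / (2 * S))) = c * (S * S + x * x) / S"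
      using S(1) by (simp add: field_simps)
    also have "S * S + x * x = c" using S(2) by simp
    finally show ?thesis using S c by (simp add: power3_eq_cube field_simps)
  qed
  ultimately show ?thesis unfolding G_def c_def[symmetric] S_def[symmetric] by simp
qed

sublocale level_set a1 a2 P0 P1 "inverse (s0 ^ 3)" "inverse (\<omega> ^ 3)" G
proof
  show "0 < inverse (s0 ^ 3)" using s by simp
  have "\<omega> \<le> s0" using s unfolding \<omega> by simp
  then have "\<omega> ^ 3 \<le> s0 ^ 3" using \<omega>pos by (intro power_mono) auto
  then show "inverse (s0 ^ 3) \<le> inverse (\<omega> ^ 3)" using \<omega>pos by (intro le_imp_inverse_le) auto
  fix p x y :: real
  assume p: "p \<in> {0..1}" and x: "P1 - a2 * (1 - p) \<le> x" "x \<le> y" "y \<le> P1 - a1 * (1 - p)"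
  show "inverse (s0 ^ 3) * (y - x) \<le> G p y - G p x \<and> G p y - G p x \<le> inverse (\<omega> ^ 3) * (y - x)"
  proof (cases "x = y")
    case False
    then have "x < y" using x by simp
    then obtain w where w: "x < w" "w < y" "G p y - G p x = (y - x) * inverse ((sqrt (height p * height p - w * w))^3)"
      using MVT2[of x y "G p" "\<lambda>w. inverse ((sqrt (height p * height p - w * w))^3)"] G_deriv[OF p] in_strip[OF p] x
      by (smt (verit, best))
    have w': "\<bar>w\<bar> \<le> height p - \<omega>" using in_strip[OF p] x w by simp
    note r = strip_root[OF p w']
    have "\<omega> ^ 3 \<le> (sqrt (height p * height p - w * w))^3" "(sqrt (height p * height p - w * w))^3 \<le> s0 ^ 3"
      using r \<omega>pos by (auto intro!: power_mono)
    moreover have "\<omega> ^ 3 > 0" using \<omega>pos by simp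
    ultimately have "inverse ((sqrt (height p * height p - w * w))^3) \<le> inverse (\<omega> ^ 3)"
      "inverse (s0 ^ 3) \<le> inverse ((sqrt (height p * height p - w * w))^3)"
      using s by (intro le_imp_inverse_le; linarith)+
    then show ?thesis unfolding w(3) using \<open>x < y\<close> by (simp add: mult.commute mult_left_mono)
  qed simp
next
  fix Q :: "real \<Rightarrow> real" assume c: "continuous_on {0..1} Q"
    and Q: "\<And>p. p \<in> {0..1} \<Longrightarrow> P1 - a2 * (1 - p) \<le> Q p \<and> Q p \<le> P1 - a1 * (1 - p)"
  show "continuous_on {0..1} (\<lambda>p. G p (Q p))"
    unfolding G_def
  proof (intro continuous_on_divide continuous_on_mult continuous_on_real_sqrt continuous_on_diff c ballI)
    show "continuous_on {0..1} height" unfolding height_def by (intro continuous_intros)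
    then show "continuous_on {0..1} height" "continuous_on {0..1} height" "continuous_on {0..1} height" by blast+
    fix p :: real assume p: "p \<in> {0..1}"
    have "\<bar>Q p\<bar> \<le> height p - \<omega>" using in_strip[OF p] Q[OF p] by blast
    from strip_root(1)[OF p this] height_pos[OF p]
    show "height p * height p * sqrt (height p * height p - Q p * Q p) \<noteq> 0" by simp
  qed
qed

definition root :: "(real \<Rightarrow> real) \<Rightarrow> real \<Rightarrow> real" where
  "root Q p = sqrt (height p * height p - Q p * Q p)"

definition graph :: "(real \<Rightarrow> real) \<Rightarrow> real \<Rightarrow> complex" where
  "graph Q p = of_real (x0 + h * integral {0..p} (\<lambda>p. G p (Q p))) + \<i> * of_real (inverse (height p))"

definition graph_curve :: "(real \<Rightarrow> real) \<Rightarrow> (real \<Rightarrow> real) \<Rightarrow> real \<Rightarrow> complex" where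
  "graph_curve Q T = restrict (\<lambda>t. graph Q (inv01 T t)) {0..1}"

lemma graph_Re: "Re (graph Q p) = x0 + h * integral {0..p} (\<lambda>p. G p (Q p))"
  and graph_Im: "Im (graph Q p) = inverse (height p)"
  unfolding graph_def by (simp_all del: of_real_inverse)

lemma cone_strip: assumes "cone Q" "p \<in> {0..1}" shows "height p * height p - Q p * Q p > 0"
  using strip_root(1)[OF assms(2) in_strip[OF assms(2)]] cone_bounds[OF assms] by blast

lemma cone_root: "cone Q \<Longrightarrow> p \<in> {0..1} \<Longrightarrow> root Q p > 0"
  and cone_root_sq: "cone Q \<Longrightarrow> p \<in> {0..1} \<Longrightarrow> root Q p * root Q p = height p * height p - Q p * Q p"
  using cone_strip unfolding root_def by (auto simp: less_imp_le)

lemma has_deriv01_height: "has_deriv01 height (\<lambda>p. - h)"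
  using has_deriv01_linear[of s0 "- h"] by (simp add: height_def[abs_def])

lemma Ck_height: "Ck n height"
  unfolding height_def[abs_def] by (intro Ck_diff Ck_const Ck_mult Ck_ident)

lemma Ck_tendsto_root:
  assumes "Ck_tendsto n \<F> Qs Q" "cone Q"
  shows "Ck_tendsto n \<F> (\<lambda>i. root (Qs i)) (root Q)"
  unfolding root_def[abs_def]
  by (intro Ck_tendsto_sqrt Ck_tendsto_diff Ck_tendsto_mult Ck_tendsto_const_family Ck_height assms(1) cone_strip[OF assms(2)])

lemma Ck_tendsto_graph:
  assumes "Ck_tendsto n \<F> Qs Q" "cone Q"
  shows "Ck_tendsto (Suc n) \<F> (\<lambda>i. graph (Qs i)) (graph Q)"
proof -
  have "Ck_tendsto n \<F> (\<lambda>i p. Qs i p / ((height p * height p) * root (Qs i) p)) (\<lambda>p. Q p / ((height p * height p) * root Q p))"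
    by (intro Ck_tendsto_divide Ck_tendsto_mult Ck_tendsto_const_family Ck_height Ck_tendsto_root assms)
      (use height_pos cone_root[OF assms(2)] in force)
  then have "Ck_tendsto n \<F> (\<lambda>i p. G p (Qs i p)) (\<lambda>p. G p (Q p))" unfolding G_def root_def .
  then show ?thesis
    unfolding graph_def[abs_def]
    by (intro Ck_tendsto_add Ck_tendsto_mult Ck_tendsto_of_real Ck_tendsto_inverse Ck_tendsto_const tendsto_const
        Ck_tendsto_integral Ck_tendsto_const_family Ck_height height_nz)
qed

lemma Ck_tendsto_graph_curve:
  assumes "Ck_tendsto (Suc q) \<F> Qs Q" "cone Q" "Ck_tendsto (Suc (Suc q)) \<F> Ts T" "diffeo01 T"
    "\<forall>\<^sub>F i in \<F>. diffeo01 (Ts i)"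
  shows "Ck_tendsto (Suc (Suc q)) \<F> (\<lambda>i. graph_curve (Qs i) (Ts i)) (graph_curve Q T)"
proof -
  have "Ck_tendsto (Suc (Suc q)) \<F> (\<lambda>i t. graph (Qs i) (inv01 (Ts i) t)) (\<lambda>t. graph Q (inv01 T t))"
    by (rule Ck_tendsto_compose_inv01[OF Ck_tendsto_graph[OF assms(1,2)] assms(3) order_refl _ assms(4,5)]) simp
  then show ?thesis by (rule Ck_tendsto_cong) (auto simp: graph_curve_def)
qed

lemma Ck_graph_curve:
  assumes "Ck (Suc q) Q" "cone Q" "Ck (Suc (Suc q)) T" "diffeo01 T"
  shows "Ck (Suc (Suc q)) (graph_curve Q T)"
  using assms unfolding Ck_iff_tendsto by (intro Ck_tendsto_graph_curve) auto

lemma has_deriv01_graph: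
  assumes Q: "cone Q"
  shows "has_deriv01 (graph Q) (\<lambda>p. of_real (h / (height p * height p * root Q p)) * Complex (Q p) (root Q p))"
proof -
  have c: "continuous_on {0..1} (\<lambda>p. G p (Q p))"
    using cone_in_range[OF Q] unfolding in_range_def by (intro Gcont) auto
  have "has_deriv01 (graph Q) (\<lambda>p. of_real (0 + h * G p (Q p)) + \<i> * of_real (- (- h / (height p)\<^sup>2)))"
    unfolding graph_def[abs_def]
    by (intro has_deriv01_add has_deriv01_const bounded_linear.has_deriv01[OF bounded_linear_mult_right]
        bounded_linear.has_deriv01[OF bounded_linear_of_real] has_deriv01_integral c
        has_deriv01_inverse_height has_deriv01_height height_pos)
  then show ?thesis
  proof (rule has_deriv01_cong)
    fix p :: real assume p: "p \<in> {0..1}"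
    show "of_real (0 + h * G p (Q p)) + \<i> * of_real (- (- h / (height p)\<^sup>2)) =
        of_real (h / (height p * height p * root Q p)) * Complex (Q p) (root Q p)"
      using height_pos[OF p] cone_root[OF Q p]
      by (simp add: complex_eq_iff G_def root_def[symmetric] power2_eq_square)
  qed simp
qed

text \<open>The tangent vector of the graph is a positive multiple of \<open>Q + i sqrt (s\<^sup>2 - Q\<^sup>2)\<close>, of modulus
  \<open>s\<close>; differentiating its direction gives the curvature \<open>- Q'/h\<close>. The positive factor \<open>lam\<close> drops out.\<close>

lemma graph_curve_in_curve_space:
  assumes Q: "cone Q" "Ck (Suc q) Q" "F Q = (x1 - x0) / h" and T: "diffeo01 T" "Ck (Suc (Suc q)) T"
  shows "graph_curve Q T \<in> slow_curves q"
proof -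
  define f where "f = graph_curve Q T"
  obtain Q' where Q': "has_deriv01 Q Q'" "\<forall>p\<in>{0..1}. a1 < Q' p \<and> Q' p < a2" "Q 0 = P0" "Q 1 = P1"
    using Q(1) by (auto simp: cone_def)
  note dT = diffeo01_deriv01[OF T(1)]
  define e where "e = (\<lambda>p. of_real (Q p) + \<i> * of_real (root Q p))"
  define e' where "e' = (\<lambda>p. of_real (Q' p) + \<i> * of_real (- (h * height p + Q p * Q' p) / root Q p))"
  define lam where "lam = (\<lambda>p. h / (height p * height p * root Q p) / deriv01 T p)"
  have rp: "root Q p > 0" "height p > 0" "deriv01 T p > 0" if "p \<in> {0..1}" for p
    using cone_root[OF Q(1) that] height_pos[OF that] dT(2)[OF that] by auto
  have lampos: "lam p > 0" if "p \<in> {0..1}" for p using rp[OF that] hpos by (simp add: lam_def)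
  have droot: "has_deriv01 (root Q) (\<lambda>p. - (h * height p + Q p * Q' p) / root Q p)"
  proof -
    have "has_deriv01 (\<lambda>p. height p * height p + (- 1) * (Q p * Q p)) (\<lambda>p. (height p * - h + - h * height p) + (- 1) * (Q p * Q' p + Q' p * Q p))"
      by (intro has_deriv01_add bounded_bilinear.has_deriv01[OF bounded_bilinear_mult]
          bounded_linear.has_deriv01[OF bounded_linear_mult_right] has_deriv01_height Q')
    from has_deriv01_sqrt[OF this] cone_strip[OF Q(1)]
    have "has_deriv01 (\<lambda>p. sqrt (height p * height p + (- 1) * (Q p * Q p)))
        (\<lambda>p. ((height p * - h + - h * height p) + (- 1) * (Q p * Q' p + Q' p * Q p)) / (2 * sqrt (height p * height p + (- 1) * (Q p * Q p))))"
      by simp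
    then show ?thesis
    proof (rule has_deriv01_cong)
      fix p :: real
      have "(height p * - h + - h * height p) + (- 1) * (Q p * Q' p + Q' p * Q p) = 2 * (- (h * height p + Q p * Q' p))"
        by (simp add: algebra_simps)
      then show "((height p * - h + - h * height p) + (- 1) * (Q p * Q' p + Q' p * Q p)) / (2 * sqrt (height p * height p + (- 1) * (Q p * Q p)))
          = - (h * height p + Q p * Q' p) / root Q p"
        by (simp only: mult_divide_mult_cancel_left_if root_def) simp
    qed (simp add: root_def)
  qed
  have de: "has_deriv01 e e'"
    unfolding e_def e'_def
    by (intro has_deriv01_add bounded_linear.has_deriv01[OF bounded_linear_mult_right]
        bounded_linear.has_deriv01[OF bounded_linear_of_real] Q' droot)
  have "Ck 1 lam"
  proof -
    have c1: "Ck 1 Q" "Ck 1 (deriv01 T)"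
      using Ck_mono[OF Q(2), of 1] T(2) Ck_mono[of "Suc q" "deriv01 T" 1] by (auto simp: Ck_Suc[of "Suc q" T])
    have "Ck 1 (root Q)" unfolding root_def[abs_def]
      by (intro Ck_sqrt Ck_diff Ck_mult Ck_height c1 cone_strip[OF Q(1)])
    then show ?thesis unfolding lam_def
      by (intro Ck_divide Ck_mult Ck_const Ck_height c1) (use rp in force)+
  qed
  then obtain lam' where lam': "has_deriv01 lam lam'" using Ck_has_deriv01[of 0] by auto
  define W where "W = (\<lambda>p. of_real (lam p) * e p)"
  define W' where "W' = (\<lambda>p. of_real (lam p) * e' p + of_real (lam' p) * e p)"
  have dW: "has_deriv01 W W'"
    unfolding W_def W'_def
    by (intro bounded_bilinear.has_deriv01[OF bounded_bilinear_mult] bounded_linear.has_deriv01[OF bounded_linear_of_real] lam' de)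
  have df: "has_deriv01 f (\<lambda>t. W (inv01 T t))"
  proof (rule has_deriv01_cong[OF has_deriv01_compose_inv01[OF T(1) dT has_deriv01_graph[OF Q(1)]]])
    fix t :: real assume "t \<in> {0..1}"
    show "graph Q (inv01 T t) = f t" using \<open>t \<in> {0..1}\<close> by (simp add: f_def graph_curve_def)
    show "inverse (deriv01 T (inv01 T t)) *\<^sub>R (of_real (h / (height (inv01 T t) * height (inv01 T t) * root Q (inv01 T t))) *
        Complex (Q (inv01 T t)) (root Q (inv01 T t))) = W (inv01 T t)"
      by (simp add: W_def lam_def e_def Complex_eq scaleR_conv_of_real divide_inverse)
  qed
  have df2: "has_deriv01 (\<lambda>t. W (inv01 T t)) (\<lambda>t. inverse (deriv01 T (inv01 T t)) *\<^sub>R W' (inv01 T t))"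
    by (rule has_deriv01_cong[OF has_deriv01_compose_inv01[OF T(1) dT dW]]) auto
  have ne: "cmod (e p) = height p" if p: "p \<in> {0..1}" for p
  proof -
    have "(cmod (e p))\<^sup>2 = Q p * Q p + root Q p * root Q p"
      unfolding cmod_power2 by (simp add: e_def power2_eq_square)
    then have "(cmod (e p))\<^sup>2 = height p * height p" using cone_root_sq[OF Q(1) p] by simp
    then show ?thesis using height_pos[OF p] by (simp add: power2_eq_square[symmetric])
  qed
  have e0: "e p \<noteq> 0" if "p \<in> {0..1}" for p using ne[OF that] height_pos[OF that] by auto
  have K: "(Re (W p) + inverse (height p) * Im ((inverse (deriv01 T p) *\<^sub>R W' p) / W p)) / cmod (W p) = - Q' p / h"
    if p: "p \<in> {0..1}" for p
  proof -
    define S where "S = height p"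
    define \<rho> where "\<rho> = root Q p"
    have S: "S > 0" "\<rho> > 0" "\<rho> * \<rho> = S * S - Q p * Q p" "deriv01 T p > 0"
      using rp[OF p] cone_root_sq[OF Q(1) p] by (auto simp: S_def \<rho>_def)
    have "Im (e' p / e p) = (Im (e' p) * Re (e p) - Re (e' p) * Im (e p)) / (cmod (e p))\<^sup>2"
      by (simp add: Im_divide cmod_power2)
    also have "\<dots> = (- (h * S + Q p * Q' p) / \<rho> * Q p - Q' p * \<rho>) / (S * S)"
      unfolding ne[OF p] by (simp add: e_def e'_def S_def \<rho>_def power2_eq_square)
    also have "\<dots> = - (h * S * Q p + Q' p * (Q p * Q p + \<rho> * \<rho>)) / (\<rho> * (S * S))"
      using S(1,2) by (simp add: field_simps)
    also have "Q p * Q p + \<rho> * \<rho> = S * S" using S(3) by simp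
    also have "- (h * S * Q p + Q' p * (S * S)) / (\<rho> * (S * S)) = - (h * Q p + Q' p * S) / (\<rho> * S)"
      using S(1,2) by (simp add: field_simps)
    finally have I: "Im (e' p / e p) = - (h * Q p + Q' p * S) / (\<rho> * S)" .
    have i1: "Im ((inverse (deriv01 T p) *\<^sub>R W' p) / W p) = inverse (deriv01 T p) * Im (e' p / e p)"
      unfolding W_def W'_def using Im_scaled_quotient lampos[OF p] e0[OF p] by auto
    have i2: "cmod (W p) = lam p * S" using lampos[OF p] ne[OF p] by (simp add: W_def norm_mult S_def)
    have i3: "Re (W p) = lam p * Q p" by (simp add: W_def e_def)
    have l: "lam p = h / (S * S * \<rho> * deriv01 T p)" by (simp add: lam_def S_def \<rho>_def)
    show ?thesis unfolding i1 i2 i3 I S_def[symmetric] l using S(1,2,4) hpos by (simp add: field_simps)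
  qed
  have fI: "Im (f t) = inverse (height (inv01 T t))" if "t \<in> {0..1}" for t
    using that by (simp add: f_def graph_curve_def graph_Im)
  have f0: "f 0 = z0" by (simp add: f_def graph_curve_def graph_Re graph_Im inv01_0[OF T(1)] height_ends z complex_eq_iff)
  have f1: "f 1 = z1"
    using Q(3) hpos by (simp add: f_def graph_curve_def graph_Re graph_Im inv01_1[OF T(1)] height_ends z complex_eq_iff F_def)
  have "f \<in> slow_curves q"
  proof (rule curve_spaceI[OF df df2 refl])
    show "Ck (Suc (Suc q)) f" unfolding f_def by (rule Ck_graph_curve[OF Q(2,1) T(2,1)])
    show "f \<in> extensional {0..1}" by (simp add: f_def graph_curve_def)
    show "f 0 = fst (frame (z0, \<theta>0))" "f 1 = fst (frame (z1, \<theta>1))" using f0 f1 by (auto simp: frame_def)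
    have endp: "Im z *\<^sub>R W p = cmod (W p) *\<^sub>R snd (frame (z, \<theta>))"
      if "p \<in> {0..1}" "Q p = height p * cos \<theta>" "sin \<theta> > 0" "Im z = inverse (height p)" for p z \<theta>
    proof -
      have "root Q p * root Q p = (height p * sin \<theta>) * (height p * sin \<theta>)"
      proof -
        have "root Q p * root Q p = (height p)\<^sup>2 * (1 - (cos \<theta>)\<^sup>2)"
          unfolding cone_root_sq[OF Q(1) that(1)] that(2) by (simp add: power2_eq_square algebra_simps)
        also have "1 - (cos \<theta>)\<^sup>2 = (sin \<theta>)\<^sup>2" by (simp add: sin_squared_eq)
        finally show ?thesis by (simp add: power2_eq_square)
      qed
      then have "root Q p = height p * sin \<theta>"
        using rp[OF that(1)] that(3) by (metis abs_mult_self_eq abs_of_pos mult_pos_pos power2_eq_square power2_eq_iff_nonneg less_imp_le)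
      then have "e p = of_real (height p) * cis \<theta>" using that(2) by (simp add: e_def complex_eq_iff)
      then show ?thesis using rp[OF that(1)] lampos[OF that(1)] that(4)
        by (simp add: W_def frame_def norm_mult scaleR_conv_of_real)
    qed
    show "Im (f 0) *\<^sub>R W (inv01 T 0) = cmod (W (inv01 T 0)) *\<^sub>R snd (frame (z0, \<theta>0))"
      unfolding f0 inv01_0[OF T(1)] by (rule endp) (use Q' sin in \<open>auto simp: P height_ends z\<close>)
    show "Im (f 1) *\<^sub>R W (inv01 T 1) = cmod (W (inv01 T 1)) *\<^sub>R snd (frame (z1, \<theta>1))"
      unfolding f1 inv01_1[OF T(1)] by (rule endp) (use Q' sin in \<open>auto simp: P height_ends z\<close>)
    fix t :: real assume t: "t \<in> {0..1}"
    define p where "p = inv01 T t"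
    have p: "p \<in> {0..1}" using inv01_in[OF T(1) t] by (simp add: p_def)
    show "Im (f t) > 0" using fI[OF t] rp[OF p] by (simp add: p_def)
    show "W (inv01 T t) \<noteq> 0" unfolding p_def[symmetric] using e0[OF p] lampos[OF p] by (simp add: W_def)
    have "half_plane_curvature (f t) (W (inv01 T t)) (inverse (deriv01 T (inv01 T t)) *\<^sub>R W' (inv01 T t)) = - Q' p / h"
      unfolding half_plane_curvature_def fI[OF t] p_def[symmetric] by (rule K[OF p])
    moreover have "k1 < - Q' p / h" "- Q' p / h < k2"
    proof -
      have "k1 * h < - Q' p" "- Q' p < k2 * h" using bspec[OF Q'(2) p] by (auto simp: a mult.commute)
      then show "k1 < - Q' p / h" "- Q' p / h < k2"
        unfolding pos_less_divide_eq[OF hpos] pos_divide_less_eq[OF hpos] .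
    qed
    ultimately show "ereal k1 < ereal (half_plane_curvature (f t) (W (inv01 T t)) (inverse (deriv01 T (inv01 T t)) *\<^sub>R W' (inv01 T t)))"
      "ereal (half_plane_curvature (f t) (W (inv01 T t)) (inverse (deriv01 T (inv01 T t)) *\<^sub>R W' (inv01 T t))) < ereal k2"
      by simp_all
  qed
  then show ?thesis by (simp add: f_def)
qed

end

section \<open>Curves of small curvature\<close>

lemma direction_frame:
  assumes \<gamma>: "\<gamma> \<in> curve_space r \<kappa>1 \<kappa>2 (frame (z0, \<theta>)) v" and r: "r = Suc (Suc q)" and t: "t \<in> {0..1}"
  shows "Re (deriv01 \<gamma> t) = cmod (deriv01 \<gamma> t) * cos (angle \<theta> \<gamma> t)"
    "Im (deriv01 \<gamma> t) = cmod (deriv01 \<gamma> t) * sin (angle \<theta> \<gamma> t)"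
proof -
  note eq = deriv01_eq_cis_angle[OF \<gamma> r t]
  show "Re (deriv01 \<gamma> t) = cmod (deriv01 \<gamma> t) * cos (angle \<theta> \<gamma> t)"
    using arg_cong[OF eq, of Re] by simp
  show "Im (deriv01 \<gamma> t) = cmod (deriv01 \<gamma> t) * sin (angle \<theta> \<gamma> t)"
    using arg_cong[OF eq, of Im] by simp
qed

lemma has_deriv01_angle:
  assumes "\<gamma> \<in> curve_space r \<kappa>1 \<kappa>2 u v" "r = Suc (Suc q)"
  shows "has_deriv01 (angle \<theta> \<gamma>) (turn_rate \<gamma>)"
proof -
  have "continuous_on {0..1} (turn_rate \<gamma>)" by (rule Ck_continuous[OF turn_rate_Ck[OF assms(2,1)]])
  from has_deriv01_add[OF has_deriv01_const has_deriv01_integral[OF this], of \<theta>]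
  show ?thesis by (simp add: angle_def[abs_def])
qed

lemma has_deriv01_sin: "has_deriv01 f f' \<Longrightarrow> has_deriv01 (\<lambda>t. sin (f t)) (\<lambda>t. cos (f t) * f' t :: real)"
  and has_deriv01_cos: "has_deriv01 f f' \<Longrightarrow> has_deriv01 (\<lambda>t. cos (f t)) (\<lambda>t. - sin (f t) * f' t :: real)"
  unfolding has_deriv01_def has_real_derivative_iff_has_vector_derivative[symmetric]
  by (auto intro!: derivative_eq_intros)

text \<open>Where the direction is horizontal, a curve of curvature less than 1 in absolute value turns
  downwards, as geodesics do, being semicircles with their ends on the real axis. So at the last time at
  which it does not point upwards it would turn downwards, which contradicts the choice of that time.\<close>

lemma always_up:
  assumes \<gamma>: "\<gamma> \<in> curve_space r (ereal k1) (ereal k2) (frame (z0, \<theta>0)) (frame (z1, \<theta>1))" and r: "r = Suc (Suc q)"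
    and k: "- 1 \<le> k1" "k2 \<le> 1" and up: "sin \<theta>1 > 0" and z1: "Im z1 > 0" and t: "t \<in> {0..1}"
  shows "Im (deriv01 \<gamma> t) > 0"
proof -
  note D = curve_spaceD[OF \<gamma> r]
  define S where "S = (\<lambda>t. sin (angle \<theta>0 \<gamma> t))"
  have dS: "has_deriv01 S (\<lambda>t. cos (angle \<theta>0 \<gamma> t) * turn_rate \<gamma> t)"
    unfolding S_def by (rule has_deriv01_sin[OF has_deriv01_angle[OF \<gamma> r]])
  note cS = has_deriv01_continuous[OF dS]
  have "frame (\<gamma> 1, angle \<theta>0 \<gamma> 1) = frame (z1, \<theta>1)"
    using tangent_curve_eq_frame[OF \<gamma> r, of 1] \<gamma> by (simp add: curve_space_def)
  then have S1: "S 1 > 0" using up z1 by (auto simp: frame_def S_def complex_eq_iff)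
  have down: "cos (angle \<theta>0 \<gamma> t) * turn_rate \<gamma> t < 0" if t: "t \<in> {0..1}" and S0: "S t = 0" for t
  proof -
    define n where "n = cmod (deriv01 \<gamma> t)"
    define c where "c = cos (angle \<theta>0 \<gamma> t)"
    define y where "y = Im (\<gamma> t)"
    have n: "n > 0" "y > 0" using D(7,8)[OF t] by (auto simp: n_def y_def)
    have "c\<^sup>2 = 1" using S0 by (simp add: S_def c_def cos_squared_eq)
    then have c: "c = 1 \<or> c = - 1" by (simp add: power2_eq_1_iff)
    have "k1 < (n * c + y * turn_rate \<gamma> t) / n" "(n * c + y * turn_rate \<gamma> t) / n < k2"
      using D(9,10)[OF t] direction_frame(1)[OF \<gamma> r t] by (auto simp: n_def c_def y_def turn_rate_def half_plane_curvature_def)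
    then have "- 1 < (n * c + y * turn_rate \<gamma> t) / n" "(n * c + y * turn_rate \<gamma> t) / n < 1" using k by linarith+
    then have "- n < n * c + y * turn_rate \<gamma> t" "n * c + y * turn_rate \<gamma> t < n"
      using n by (auto simp: pos_less_divide_eq pos_divide_less_eq)
    then have "c * (y * turn_rate \<gamma> t) < 0" using c by auto
    then have "y * (c * turn_rate \<gamma> t) < 0" by (simp only: mult_ac)
    then show ?thesis using n by (simp add: mult_less_0_iff c_def)
  qed
  have "S t > 0"
  proof (rule ccontr)
    assume "\<not> S t > 0"
    define A where "A = {t \<in> {0..1}. S t \<le> 0}"
    have "closed ({0..1} \<inter> S -` {..0})"
      by (rule continuous_closed_preimage[OF cS]) auto
    moreover have "A = {0..1} \<inter> S -` {..0}" by (auto simp: A_def)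
    ultimately have "closed A" by metis
    moreover have "bounded A" by (rule bounded_subset[of "{0..1}"]) (auto simp: A_def)
    ultimately have "compact A" by (simp add: compact_eq_bounded_closed)
    moreover have "A \<noteq> {}" using t \<open>\<not> S t > 0\<close> by (auto simp: A_def)
    ultimately obtain m where m: "m \<in> A" "\<And>s. s \<in> A \<Longrightarrow> s \<le> m" by (metis compact_attains_sup)
    then have mI: "m \<in> {0..1}" and Sm: "S m \<le> 0" by (auto simp: A_def)
    have m1: "m < 1" using mI Sm S1 by (cases "m = 1") auto
    have "S m = 0"
    proof -
      have "continuous_on {m..1} S" by (rule continuous_on_subset[OF cS]) (use mI in auto)
      then obtain c where c: "m \<le> c" "c \<le> 1" "S c = 0" using IVT'[of S m 0 1] Sm S1 m1 by auto
      then have "c \<in> A" using mI by (auto simp: A_def)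
      then show ?thesis using m(2)[of c] c by simp
    qed
    have "(S has_real_derivative cos (angle \<theta>0 \<gamma> m) * turn_rate \<gamma> m) (at m within {0..1})"
      using has_deriv01D[OF dS mI order_refl] by (simp add: has_real_derivative_iff_has_vector_derivative)
    from has_real_derivative_neg_dec_right[OF this down[OF mI \<open>S m = 0\<close>]]
    obtain d where d: "d > 0" "\<And>h. h > 0 \<Longrightarrow> m + h \<in> {0..1} \<Longrightarrow> h < d \<Longrightarrow> S m > S (m + h)" by auto
    define h where "h = min (d / 2) (1 - m)"
    have "h > 0" "m + h \<in> {0..1}" "h < d" using d m1 mI by (auto simp: h_def)
    with d(2)[of h] have "m + h \<in> A" using \<open>S m = 0\<close> by (auto simp: A_def)
    then show False using m(2)[of "m + h"] \<open>h > 0\<close> by simp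
  qed
  then show ?thesis unfolding direction_frame(2)[OF \<gamma> r t] using D(8)[OF t] by (simp add: S_def)
qed

context height_graph
begin

text \<open>The inverse of \<open>graph_curve\<close>: momentum and timing of an upward curve as functions of its inverse height.\<close>

definition height_param :: "(real \<Rightarrow> complex) \<Rightarrow> real \<Rightarrow> real" where
  "height_param \<gamma> t = (s0 - inverse (Im (\<gamma> t))) / h"

definition momentum :: "(real \<Rightarrow> complex) \<Rightarrow> real \<Rightarrow> real" where
  "momentum \<gamma> t = Re (deriv01 \<gamma> t) / (cmod (deriv01 \<gamma> t) * Im (\<gamma> t))"

definition momentum_at :: "(real \<Rightarrow> complex) \<Rightarrow> real \<Rightarrow> real" where
  "momentum_at \<gamma> p = momentum \<gamma> (inv01 (height_param \<gamma>) p)"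

definition up_class :: "nat \<Rightarrow> (real \<Rightarrow> complex) set" where
  "up_class q = {\<gamma> \<in> slow_curves q.
     \<forall>t\<in>{0..1}. Im (deriv01 \<gamma> t) > 0}"

lemma height_param_diffeo:
  assumes "\<gamma> \<in> up_class q"
  shows "diffeo01 (height_param \<gamma>)" "has_deriv01 (height_param \<gamma>) (\<lambda>t. Im (deriv01 \<gamma> t) / (Im (\<gamma> t))\<^sup>2 / h)"
    "\<And>t. t \<in> {0..1} \<Longrightarrow> Im (deriv01 \<gamma> t) / (Im (\<gamma> t))\<^sup>2 / h > 0"
proof -
  have \<gamma>: "\<gamma> \<in> slow_curves q"
    and up: "\<And>t. t \<in> {0..1} \<Longrightarrow> Im (deriv01 \<gamma> t) > 0" using assms by (auto simp: up_class_def)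
  note D = curve_spaceD[OF \<gamma> refl]
  have "has_deriv01 (height_param \<gamma>) (\<lambda>t. (0 + (- 1) * - (Im (deriv01 \<gamma> t) / (Im (\<gamma> t))\<^sup>2)) / h)"
    unfolding height_param_def diff_conv_add_uminus
    by (intro bounded_linear.has_deriv01[OF bounded_linear_divide] has_deriv01_add has_deriv01_const
       bounded_linear.has_deriv01[OF bounded_linear_mult_right, of _ _ "- 1", simplified mult_minus1] has_deriv01_inverse_height
       bounded_linear.has_deriv01[OF bounded_linear_Im] D(5,7))
      (use has_deriv01_inverse_height[OF bounded_linear.has_deriv01[OF bounded_linear_Im D(5)] D(7)]
        bounded_linear.has_deriv01[OF bounded_linear_minus[OF bounded_linear_ident]] in \<open>fastforce\<close>)
  then show d: "has_deriv01 (height_param \<gamma>) (\<lambda>t. Im (deriv01 \<gamma> t) / (Im (\<gamma> t))\<^sup>2 / h)" by simp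
  show pos: "Im (deriv01 \<gamma> t) / (Im (\<gamma> t))\<^sup>2 / h > 0" if "t \<in> {0..1}" for t
    using up[OF that] D(7)[OF that] hpos by simp
  have "height_param \<gamma> 0 = 0" "height_param \<gamma> 1 = 1"
    unfolding height_param_def using D(11,12) hpos s h by (auto simp: frame_def z)
  then show "diffeo01 (height_param \<gamma>)" using d pos unfolding diffeo01_def by blast
qed

lemma Ck_tendsto_up_class:
  assumes \<gamma>: "\<gamma> \<in> up_class q" and ev: "\<forall>\<^sub>F i in \<F>. \<gamma>s i \<in> up_class q"
    and c: "Ck_tendsto (Suc (Suc q)) \<F> \<gamma>s \<gamma>"
  shows "Ck_tendsto (Suc (Suc q)) \<F> (\<lambda>i. inv01 (height_param (\<gamma>s i))) (inv01 (height_param \<gamma>))"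
    "Ck_tendsto (Suc q) \<F> (\<lambda>i. momentum_at (\<gamma>s i)) (momentum_at \<gamma>)"
proof -
  have \<gamma>': "\<gamma> \<in> slow_curves q"
    using \<gamma> by (auto simp: up_class_def)
  note D = curve_spaceD[OF \<gamma>' refl]
  have nz: "Im (\<gamma> t) \<noteq> 0" "cmod (deriv01 \<gamma> t) * Im (\<gamma> t) \<noteq> 0" if "t \<in> {0..1}" for t
    using D(7,8)[OF that] by auto
  have H: "Ck_tendsto (Suc (Suc q)) \<F> (\<lambda>i. height_param (\<gamma>s i)) (height_param \<gamma>)"
    unfolding height_param_def[abs_def] using hpos
    by (intro Ck_tendsto_divide Ck_tendsto_diff Ck_tendsto_const tendsto_const Ck_tendsto_inverse Ck_tendsto_Im c nz(1)) auto
  have d: "diffeo01 (height_param \<gamma>)" by (rule height_param_diffeo[OF \<gamma>])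
  have ed: "\<forall>\<^sub>F i in \<F>. diffeo01 (height_param (\<gamma>s i))" using ev by eventually_elim (rule height_param_diffeo)
  show "Ck_tendsto (Suc (Suc q)) \<F> (\<lambda>i. inv01 (height_param (\<gamma>s i))) (inv01 (height_param \<gamma>))"
    using Ck_tendsto_compose_inv01[OF Ck_tendsto_ident H order_refl _ d ed] by simp
  have "Ck_tendsto (Suc q) \<F> (\<lambda>i. momentum (\<gamma>s i)) (momentum \<gamma>)"
    unfolding momentum_def[abs_def]
    by (intro Ck_tendsto_divide Ck_tendsto_Re Ck_tendsto_mult Ck_tendsto_cmod Ck_tendsto_Im
        Ck_tendsto_deriv01[OF c] Ck_tendsto_Suc_mono[OF c] nz(2) D(8))
  then show "Ck_tendsto (Suc q) \<F> (\<lambda>i. momentum_at (\<gamma>s i)) (momentum_at \<gamma>)"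
    unfolding momentum_at_def[abs_def] by (rule Ck_tendsto_compose_inv01[OF _ H _ _ d ed]) auto
qed

lemma up_class_data:
  assumes \<gamma>: "\<gamma> \<in> up_class q"
  shows "cone (momentum_at \<gamma>)" "F (momentum_at \<gamma>) = (x1 - x0) / h"
    "Ck (Suc q) (momentum_at \<gamma>)" "Ck (Suc (Suc q)) (inv01 (height_param \<gamma>))"
    "graph_curve (momentum_at \<gamma>) (inv01 (height_param \<gamma>)) = \<gamma>"
proof -
  have \<gamma>': "\<gamma> \<in> slow_curves q"
    and up: "\<And>t. t \<in> {0..1} \<Longrightarrow> Im (deriv01 \<gamma> t) > 0" using \<gamma> by (auto simp: up_class_def)
  note D = curve_spaceD[OF \<gamma>' refl]
  note cf = Ck_tendsto_up_class[OF \<gamma> always_eventually[OF allI[OF \<gamma>]] Ck_tendsto_const_family[OF D(2), of "top::unit filter"]]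
  show ckT: "Ck (Suc (Suc q)) (inv01 (height_param \<gamma>))" by (rule Ck_tendsto_limit[OF cf(1)])
  show "Ck (Suc q) (momentum_at \<gamma>)" by (rule Ck_tendsto_limit[OF cf(2)])
  note hp = height_param_diffeo[OF \<gamma>]
  define A where "A = inv01 (height_param \<gamma>)"
  have A: "A p \<in> {0..1}" "height_param \<gamma> (A p) = p" if "p \<in> {0..1}" for p
    using inv01_in[OF hp(1) that] inv01_right[OF hp(1) that] by (auto simp: A_def)
  have hA: "height p = inverse (Im (\<gamma> (A p)))" if "p \<in> {0..1}" for p
  proof -
    have "h * p = s0 - inverse (Im (\<gamma> (A p)))" using A(2)[OF that] hpos by (simp add: height_param_def field_simps)
    then show ?thesis by (simp add: height_def)
  qed
  have mom: "momentum \<gamma> t = cos (angle \<theta>0 \<gamma> t) * inverse (Im (\<gamma> t))" if "t \<in> {0..1}" for t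
    unfolding momentum_def direction_frame(1)[OF \<gamma>' refl that] using D(7,8)[OF that] by (simp add: field_simps)
  define kap where "kap = (\<lambda>t. (Re (deriv01 \<gamma> t) + Im (\<gamma> t) * turn_rate \<gamma> t) / cmod (deriv01 \<gamma> t))"
  have dmom: "has_deriv01 (momentum \<gamma>) (\<lambda>t. - kap t * (Im (deriv01 \<gamma> t) / (Im (\<gamma> t))\<^sup>2))"
  proof (rule has_deriv01_cong[OF bounded_bilinear.has_deriv01[OF bounded_bilinear_mult
        has_deriv01_cos[OF has_deriv01_angle[OF \<gamma>' refl]]
        has_deriv01_inverse_height[OF bounded_linear.has_deriv01[OF bounded_linear_Im D(5)] D(7)]]])
    fix t :: real assume t: "t \<in> {0..1}"
    show "cos (angle \<theta>0 \<gamma> t) * inverse (Im (\<gamma> t)) = momentum \<gamma> t" using mom[OF t] by simp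
    show "cos (angle \<theta>0 \<gamma> t) * - (Im (deriv01 \<gamma> t) / (Im (\<gamma> t))\<^sup>2) + - sin (angle \<theta>0 \<gamma> t) * turn_rate \<gamma> t * inverse (Im (\<gamma> t))
       = - kap t * (Im (deriv01 \<gamma> t) / (Im (\<gamma> t))\<^sup>2)"
      unfolding kap_def direction_frame[OF \<gamma>' refl t] using D(7,8)[OF t]
      by (simp add: power2_eq_square field_simps)
  qed auto
  have dQ: "has_deriv01 (momentum_at \<gamma>) (\<lambda>p. - (h * kap (A p)))"
  proof (rule has_deriv01_cong[OF has_deriv01_compose_inv01[OF hp(1,2) hp(3) dmom]])
    fix p :: real assume p: "p \<in> {0..1}"
    show "inverse (Im (deriv01 \<gamma> (inv01 (height_param \<gamma>) p)) / (Im (\<gamma> (inv01 (height_param \<gamma>) p)))\<^sup>2 / h) *\<^sub>R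
        (- kap (inv01 (height_param \<gamma>) p) * (Im (deriv01 \<gamma> (inv01 (height_param \<gamma>) p)) / (Im (\<gamma> (inv01 (height_param \<gamma>) p)))\<^sup>2)) = - (h * kap (A p))"
      unfolding A_def[symmetric] using up[OF A(1)[OF p]] D(7)[OF A(1)[OF p]] hpos by (simp add: field_simps)
  qed (auto simp: momentum_at_def)
  have kb: "k1 < kap t" "kap t < k2" if "t \<in> {0..1}" for t
    using D(9,10)[OF that] by (auto simp: kap_def turn_rate_def half_plane_curvature_def)
  have mom_end: "momentum \<gamma> t = inverse (Im z) * cos \<theta>"
    if "t \<in> {0..1}" "Im z > 0" "frame (z, \<theta>) = frame (\<gamma> t, angle \<theta>0 \<gamma> t)" for t z \<theta>
    using that mom[OF that(1)] by (auto simp: frame_def complex_eq_iff)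
  have ends: "momentum \<gamma> 0 = P0" "momentum \<gamma> 1 = P1"
    using mom_end[of 0 z0 \<theta>0] mom_end[of 1 z1 \<theta>1] tangent_curve_eq_frame[OF \<gamma>' refl, of 0] tangent_curve_eq_frame[OF \<gamma>' refl, of 1] \<gamma>' s
    by (auto simp: curve_space_def P z)
  show cone: "cone (momentum_at \<gamma>)"
    unfolding cone_def
  proof (intro conjI exI[of _ "\<lambda>p. - (h * kap (A p))"] dQ ballI)
    show "momentum_at \<gamma> 0 = P0" "momentum_at \<gamma> 1 = P1"
      by (simp_all add: momentum_at_def inv01_0[OF hp(1)] inv01_1[OF hp(1)] ends)
    fix p :: real assume p: "p \<in> {0..1}"
    show "a1 < - (h * kap (A p))" "- (h * kap (A p)) < a2"
      using kb[OF A(1)[OF p]] hpos by (simp_all add: a)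
  qed
  have gr: "graph (momentum_at \<gamma>) p = \<gamma> (A p)" if p: "p \<in> {0..1}" for p
  proof (rule has_deriv01_unique[OF has_deriv01_graph[OF cone] _ _ p])
    show "has_deriv01 (\<lambda>p. \<gamma> (A p)) (\<lambda>p. of_real (h / (height p * height p * root (momentum_at \<gamma>) p)) * Complex (momentum_at \<gamma> p) (root (momentum_at \<gamma>) p))"
    proof (rule has_deriv01_cong[OF has_deriv01_compose_inv01[OF hp(1,2) hp(3) D(5)]])
      fix p :: real assume p: "p \<in> {0..1}"
      note t = A(1)[OF p]
      define n where "n = cmod (deriv01 \<gamma> (A p))"
      define y where "y = Im (\<gamma> (A p))"
      define c where "c = cos (angle \<theta>0 \<gamma> (A p))"
      define S where "S = sin (angle \<theta>0 \<gamma> (A p))"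
      have n: "n > 0" "y > 0" using D(7,8)[OF t] by (auto simp: n_def y_def)
      have S: "S > 0" using up[OF t] n(1) unfolding direction_frame(2)[OF \<gamma>' refl t] n_def S_def by (simp add: zero_less_mult_iff)
      have H: "height p = inverse y" using hA[OF p] by (simp add: y_def)
      have Q: "momentum_at \<gamma> p = c * inverse y" unfolding momentum_at_def A_def[symmetric] mom[OF t] by (simp add: c_def y_def)
      have "height p * height p - momentum_at \<gamma> p * momentum_at \<gamma> p = (S * inverse y) * (S * inverse y)"
      proof -
        have "height p * height p - momentum_at \<gamma> p * momentum_at \<gamma> p = (1 - c\<^sup>2) * (inverse y * inverse y)"
          unfolding H Q by (simp add: power2_eq_square algebra_simps)
        also have "1 - c\<^sup>2 = S\<^sup>2" by (simp add: c_def S_def sin_squared_eq)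
        finally show ?thesis by (simp add: power2_eq_square)
      qed
      then have R: "root (momentum_at \<gamma>) p = S * inverse y"
        using S n by (simp add: root_def real_sqrt_mult)
      have dg: "deriv01 \<gamma> (A p) = Complex (n * c) (n * S)"
        using direction_frame[OF \<gamma>' refl t] by (simp add: complex_eq_iff n_def c_def S_def)
      show "inverse (Im (deriv01 \<gamma> (inv01 (height_param \<gamma>) p)) / (Im (\<gamma> (inv01 (height_param \<gamma>) p)))\<^sup>2 / h) *\<^sub>R deriv01 \<gamma> (inv01 (height_param \<gamma>) p) =
        of_real (h / (height p * height p * root (momentum_at \<gamma>) p)) * Complex (momentum_at \<gamma> p) (root (momentum_at \<gamma>) p)"
        unfolding A_def[symmetric] y_def[symmetric] dg H Q R
        using n S hpos by (simp add: complex_eq_iff power2_eq_square field_simps)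
    qed (auto simp: A_def)
    show "graph (momentum_at \<gamma>) 0 = \<gamma> (A 0)"
      using D(11) by (simp add: A_def inv01_0[OF hp(1)] complex_eq_iff graph_Re graph_Im height_ends frame_def z)
  qed
  have "Re (graph (momentum_at \<gamma>) 1) = x1" using D(12) by (simp add: gr A_def inv01_1[OF hp(1)] frame_def z)
  then show "F (momentum_at \<gamma>) = (x1 - x0) / h" using hpos by (simp add: graph_Re F_def field_simps)
  show "graph_curve (momentum_at \<gamma>) (inv01 (height_param \<gamma>)) = \<gamma>"
  proof (rule extensionalityI[of _ "{0..1}"])
    show "graph_curve (momentum_at \<gamma>) (inv01 (height_param \<gamma>)) \<in> extensional {0..1}" by (simp add: graph_curve_def)
    show "\<gamma> \<in> extensional {0..1}" by (rule D(1))
    fix t :: real assume t: "t \<in> {0..1}"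
    show "graph_curve (momentum_at \<gamma>) (inv01 (height_param \<gamma>)) t = \<gamma> t"
      using t gr[OF diffeo01_in[OF hp(1) t]]
      by (simp add: graph_curve_def inv01_inv01[OF hp(1) t] A_def inv01_left[OF hp(1) t])
  qed
qed

text \<open>In the two coordinates of an upward curve, the momentum is moved within the level set of the
  prescribed horizontal displacement, and the timing is moved to the identity.\<close>

lemma contractible_up_class:
  assumes all: "\<And>\<gamma>. \<gamma> \<in> slow_curves q \<Longrightarrow> \<gamma> \<in> up_class q"
    and ne: "\<gamma>0 \<in> up_class q"
  shows "contractible_space (subtopology (curve_topology (Suc (Suc q)) (ereal k1) (ereal k2) (frame (z0, \<theta>0)) (frame (z1, \<theta>1))) (up_class q))"
proof -
  let ?Q0 = "momentum_at \<gamma>0"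
  note Q0 = up_class_data[OF ne]
  obtain N :: "real \<Rightarrow> (real \<Rightarrow> real) \<Rightarrow> real \<Rightarrow> real" and q1
  where N: "\<And>s Q. s \<in> {0..1} \<Longrightarrow> cone Q \<Longrightarrow> F Q = F ?Q0 \<Longrightarrow> cone (N s Q) \<and> F (N s Q) = F ?Q0"
    "\<And>Q. cone Q \<Longrightarrow> F Q = F ?Q0 \<Longrightarrow> N 0 Q = Q" "\<And>Q. cone Q \<Longrightarrow> F Q = F ?Q0 \<Longrightarrow> N 1 Q = q1"
    "\<And>k (\<F> :: (real \<times> (real \<Rightarrow> complex)) filter) s s0 Qs Q. (s \<longlongrightarrow> s0) \<F> \<Longrightarrow> s0 \<in> {0..1} \<Longrightarrow> cone Q \<Longrightarrow> F Q = F ?Q0 \<Longrightarrow>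
       \<forall>\<^sub>F i in \<F>. s i \<in> {0..1} \<and> cone (Qs i) \<and> F (Qs i) = F ?Q0 \<Longrightarrow>
       Ck_tendsto k \<F> Qs Q \<Longrightarrow> Ck_tendsto k \<F> (\<lambda>i. N (s i) (Qs i)) (N s0 Q)"
    "\<And>k s Q. Ck k Q \<Longrightarrow> Ck k (N s Q)"
  proof (rule level_contraction[OF Q0(1), where 'i = "real \<times> (real \<Rightarrow> complex)"], goal_cases)
    case (1 N q1)
    show ?thesis by (rule 1(1)[of N q1]) (fact 1)+
  qed
  define TT where "TT = (\<lambda>s \<gamma> t. (1 - s) * inv01 (height_param \<gamma>) t + s * t)"
  define H where "H = (\<lambda>s \<gamma>. graph_curve (N s (momentum_at \<gamma>)) (TT s \<gamma>))"
  have lev: "cone (momentum_at \<gamma>)" "F (momentum_at \<gamma>) = F ?Q0" if "\<gamma> \<in> up_class q" for \<gamma>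
    using up_class_data(1,2)[OF that] Q0(2) by auto
  have dT: "diffeo01 (TT s \<gamma>)" if "s \<in> {0..1}" "\<gamma> \<in> up_class q" for s \<gamma>
    unfolding TT_def by (intro diffeo01_convex diffeo01_inv01 height_param_diffeo[OF that(2)] diffeo01_ident that)
  have HC: "H s \<gamma> \<in> up_class q" if "s \<in> {0..1}" "\<gamma> \<in> up_class q" for s \<gamma>
    unfolding H_def
  proof (rule all[OF graph_curve_in_curve_space])
    show "cone (N s (momentum_at \<gamma>))" "F (N s (momentum_at \<gamma>)) = (x1 - x0) / h"
      using N(1)[OF that(1) lev[OF that(2)]] Q0(2) by auto
    show "Ck (Suc q) (N s (momentum_at \<gamma>))" by (rule N(5)[OF up_class_data(3)[OF that(2)]])
    show "diffeo01 (TT s \<gamma>)" by (rule dT[OF that])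
    show "Ck (Suc (Suc q)) (TT s \<gamma>)"
      unfolding TT_def by (intro Ck_affine up_class_data(4)[OF that(2)] Ck_ident)
  qed
  show ?thesis
  proof (rule contractible_curve_subspace[where H = H and \<eta> = "graph_curve q1 (\<lambda>t. t)"])
    show "up_class q \<subseteq> slow_curves q"
      by (auto simp: up_class_def)
    fix \<gamma> assume \<gamma>: "\<gamma> \<in> up_class q"
    show "H 0 \<gamma> = \<gamma>" using up_class_data(5)[OF \<gamma>] N(2)[OF lev[OF \<gamma>]] by (simp add: H_def TT_def)
    show "H 1 \<gamma> = graph_curve q1 (\<lambda>t. t)" using N(3)[OF lev[OF \<gamma>]] by (simp add: H_def TT_def)
    fix s :: real assume s: "s \<in> {0..1}"
    show "H s \<gamma> \<in> up_class q" by (rule HC[OF s \<gamma>])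
    fix \<F> assume \<F>: "(fst \<longlongrightarrow> s) \<F>" "\<forall>\<^sub>F i in \<F>. fst i \<in> {0..1} \<and> snd i \<in> up_class q" "Ck_tendsto (Suc (Suc q)) \<F> snd \<gamma>"
    have ev: "\<forall>\<^sub>F i in \<F>. snd i \<in> up_class q" using \<F>(2) by eventually_elim blast
    note U = Ck_tendsto_up_class[OF \<gamma> ev \<F>(3)]
    show "Ck_tendsto (Suc (Suc q)) \<F> (\<lambda>i. H (fst i) (snd i)) (H s \<gamma>)"
      unfolding H_def
    proof (rule Ck_tendsto_graph_curve)
      have "\<forall>\<^sub>F i in \<F>. fst i \<in> {0..1} \<and> cone (momentum_at (snd i)) \<and> F (momentum_at (snd i)) = F ?Q0"
        using \<F>(2) by eventually_elim (use lev in blast)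
      then show "Ck_tendsto (Suc q) \<F> (\<lambda>i. N (fst i) (momentum_at (snd i))) (N s (momentum_at \<gamma>))"
        using N(4)[OF \<F>(1) s lev[OF \<gamma>] _ U(2)] by blast
      show "cone (N s (momentum_at \<gamma>))" using N(1)[OF s lev[OF \<gamma>]] by blast
      show "Ck_tendsto (Suc (Suc q)) \<F> (\<lambda>i. TT (fst i) (snd i)) (TT s \<gamma>)"
        unfolding TT_def by (intro Ck_tendsto_affine \<F>(1) U(1) Ck_tendsto_ident)
      show "diffeo01 (TT s \<gamma>)" by (rule dT[OF s \<gamma>])
      show "\<forall>\<^sub>F i in \<F>. diffeo01 (TT (fst i) (snd i))" using \<F>(2) by eventually_elim (use dT in blast)
    qed
  qed
qed

end

lemma contractible_upward:
  assumes k: "- 1 \<le> k1" "k1 < k2" "k2 \<le> 1" and r: "r = Suc (Suc q)"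
    and up: "sin \<theta>1 > 0" and z: "Im z1 > 0"
  shows "contractible_space (curve_topology r (ereal k1) (ereal k2) (frame (z0, \<theta>0)) (frame (z1, \<theta>1)))"
    (is "contractible_space ?X")
proof (cases "topspace ?X = {}")
  case True
  then show ?thesis by (intro contractible_space_subset_singleton[of _ undefined]) simp
next
  case False
  then obtain \<gamma>0 where \<gamma>0: "\<gamma>0 \<in> curve_space r (ereal k1) (ereal k2) (frame (z0, \<theta>0)) (frame (z1, \<theta>1))" by auto
  note D = curve_spaceD[OF \<gamma>0 r]
  have au: "Im (deriv01 \<gamma> t) > 0" if "\<gamma> \<in> curve_space r (ereal k1) (ereal k2) (frame (z0, \<theta>0)) (frame (z1, \<theta>1))" "t \<in> {0..1}" for \<gamma> t
    by (rule always_up[OF that(1) r k(1,3) up z that(2)])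
  have z0: "Im z0 > 0" using D(7)[of 0] D(11) by (simp add: frame_def)
  have sin0: "sin \<theta>0 > 0"
    using au[OF \<gamma>0, of 0] direction_frame(2)[OF \<gamma>0 r, of 0] by (simp add: angle_0 zero_less_mult_iff)
  have "Im (\<gamma>0 0) < Im (\<gamma>0 1)"
    by (rule has_deriv01_pos_strict_mono[OF bounded_linear.has_deriv01[OF bounded_linear_Im D(5)]]) (use au[OF \<gamma>0] in auto)
  then have "Im z0 < Im z1" using D(11,12) by (simp add: frame_def)
  then have lt: "inverse (Im z1) < inverse (Im z0)" using z0 by simp
  interpret height_graph "Re z0" "Re z1" "inverse (Im z0)" "inverse (Im z1)" \<theta>0 \<theta>1 k1 k2 z0 z1
    "inverse (Im z0) - inverse (Im z1)" "- ((inverse (Im z0) - inverse (Im z1)) * k2)" "- ((inverse (Im z0) - inverse (Im z1)) * k1)"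
    "inverse (Im z0) * cos \<theta>0" "inverse (Im z1) * cos \<theta>1" "inverse (Im z1) - \<bar>inverse (Im z1) * cos \<theta>1\<bar>"
    using lt z sin0 up k by unfold_locales simp_all
  have all: "\<gamma> \<in> up_class q" if "\<gamma> \<in> curve_space (Suc (Suc q)) (ereal k1) (ereal k2) (frame (z0, \<theta>0)) (frame (z1, \<theta>1))" for \<gamma>
    using au that unfolding up_class_def r by blast
  have eq: "up_class q = curve_space r (ereal k1) (ereal k2) (frame (z0, \<theta>0)) (frame (z1, \<theta>1))"
    using all unfolding r by (auto simp: up_class_def)
  show ?thesis
    using contractible_up_class[OF all all[OF \<gamma>0[unfolded r]]] subtopology_topspace[of ?X]
    unfolding eq unfolding r by simp
qed

section \<open>Moving a boundary point to infinity\<close>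

text \<open>For \<open>\<tau> = 0\<close> the isometry \<open>z \<mapsto> 1/(\<xi> - z)\<close> sends the boundary point \<open>\<xi>\<close> to infinity. The translation by
  \<open>\<tau>\<close> makes the family closed under inverses: the inverse is \<open>z \<mapsto> \<xi> + 1/(0 - z)\<close>.\<close>

definition invert_curve :: "real \<Rightarrow> real \<Rightarrow> (real \<Rightarrow> complex) \<Rightarrow> real \<Rightarrow> complex" where
  "invert_curve \<xi> \<tau> \<gamma> = restrict (\<lambda>t. of_real \<tau> + inverse (of_real \<xi> - \<gamma> t)) {0..1}"

definition invert_vector :: "real \<Rightarrow> real \<Rightarrow> complex \<times> complex \<Rightarrow> complex \<times> complex" where
  "invert_vector \<xi> \<tau> u = (of_real \<tau> + inverse (of_real \<xi> - fst u), snd u / (of_real \<xi> - fst u)\<^sup>2)"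

lemma Im_inverse_real_diff: "Im (inverse (of_real \<xi> - z)) = Im z / (cmod (of_real \<xi> - z))\<^sup>2"
  by (simp add: cmod_power2)

lemma invert_vector_in:
  assumes "u \<in> unit_tangent_bundle" shows "invert_vector \<xi> \<tau> u \<in> unit_tangent_bundle"
proof -
  have u: "Im (fst u) > 0" "cmod (snd u) = Im (fst u)"
    using assms by (auto simp: unit_tangent_bundle_def hyperbolic_plane_def hyp_norm_eq split: prod.splits)
  define w where "w = of_real \<xi> - fst u"
  have w: "cmod w > 0" using u(1) by (auto simp: w_def complex_eq_iff)
  have I: "Im (of_real \<tau> + inverse w) = Im (fst u) / (cmod w)\<^sup>2"
    unfolding w_def using Im_inverse_real_diff[of \<xi> "fst u"] by simp
  have p: "Im (of_real \<tau> + inverse w) > 0" unfolding I using u(1) w by simp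
  have "hyp_norm (of_real \<tau> + inverse w) (snd u / w\<^sup>2) = 1"
    unfolding hyp_norm_eq[OF p] I using u w by (simp add: norm_divide norm_power)
  then show ?thesis
    using p unfolding invert_vector_def w_def[symmetric] unit_tangent_bundle_def hyperbolic_plane_def by simp
qed

lemma invert_vector_invert:
  assumes "Im (fst u) > 0" shows "invert_vector 0 \<xi> (invert_vector \<xi> 0 u) = u"
proof -
  define w where "w = of_real \<xi> - fst u"
  have "w \<noteq> 0" using assms by (auto simp: w_def complex_eq_iff)
  moreover have "fst u = of_real \<xi> - w" by (simp add: w_def)
  ultimately show ?thesis
    unfolding invert_vector_def w_def[symmetric] by (simp add: prod_eq_iff power2_eq_square field_simps)
qed

lemma invert_curve_in_curve_space:
  assumes \<gamma>: "\<gamma> \<in> curve_space r \<kappa>1 \<kappa>2 u v" and r: "r = Suc (Suc q)"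
  shows "invert_curve \<xi> \<tau> \<gamma> \<in> curve_space r \<kappa>1 \<kappa>2 (invert_vector \<xi> \<tau> u) (invert_vector \<xi> \<tau> v)"
proof -
  note D = curve_spaceD[OF \<gamma> r]
  define f where "f = invert_curve \<xi> \<tau> \<gamma>"
  define w where "w = (\<lambda>t. of_real \<xi> - \<gamma> t)"
  define g1 where "g1 = deriv01 \<gamma>"
  define g2 where "g2 = deriv01 g1"
  define f1 where "f1 = (\<lambda>t. g1 t * (inverse (w t) * inverse (w t)))"
  define f2 where "f2 = (\<lambda>t. (g2 t + 2 * g1 t * g1 t * inverse (w t)) * (inverse (w t) * inverse (w t)))"
  have nz: "w t \<noteq> 0" "cmod (w t) > 0" if "t \<in> {0..1}" for t using D(7)[OF that] by (auto simp: w_def complex_eq_iff)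
  have dw: "has_deriv01 w (\<lambda>t. - g1 t)"
    unfolding w_def diff_conv_add_uminus g1_def
    using has_deriv01_add[OF has_deriv01_const bounded_linear.has_deriv01[OF bounded_linear_minus[OF bounded_linear_ident] D(5)], of "of_real \<xi>"]
    by simp
  note di = has_deriv01_inverse[OF dw nz(1)]
  have df: "has_deriv01 f f1"
    by (rule has_deriv01_cong[OF has_deriv01_add[OF has_deriv01_const di, of "of_real \<tau>"]])
      (auto simp: f_def f1_def invert_curve_def w_def)
  have d2: "has_deriv01 g1 g2" using D(6) by (simp add: g1_def g2_def)
  have df2: "has_deriv01 f1 f2"
    unfolding f1_def by (rule has_deriv01_cong[OF bounded_bilinear.has_deriv01[OF bounded_bilinear_mult d2
          bounded_bilinear.has_deriv01[OF bounded_bilinear_mult di di]]]) (auto simp: f2_def algebra_simps)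
  have If: "Im (f t) = Im (\<gamma> t) / (cmod (w t))\<^sup>2" if "t \<in> {0..1}" for t
    using that Im_inverse_real_diff[of \<xi> "\<gamma> t"] by (simp add: f_def invert_curve_def w_def)
  have K: "half_plane_curvature (f t) (f1 t) (f2 t) = half_plane_curvature (\<gamma> t) (g1 t) (g2 t)"
    if t: "t \<in> {0..1}" for t
  proof -
    define y where "y = Im (\<gamma> t)"
    define N where "N = (cmod (w t))\<^sup>2"
    define a where "a = g1 t * inverse (w t)"
    have N: "N > 0" using nz(2)[OF t] by (simp add: N_def)
    have g: "g1 t \<noteq> 0" using D(8)[OF t] by (simp add: g1_def)
    have q: "f2 t / f1 t = g2 t / g1 t + 2 * a"
      using g nz(1)[OF t] by (simp add: a_def f1_def f2_def field_simps)
    have "of_real N = w t * cnj (w t)" unfolding N_def by (rule complex_norm_square)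
    moreover have "cnj (w t) = w t + 2 * y * \<i>" by (simp add: w_def y_def complex_eq_iff)
    ultimately have "of_real N * f1 t = g1 t + 2 * y * \<i> * a"
      using nz(1)[OF t] by (simp add: a_def f1_def field_simps)
    then have "N * Re (f1 t) = Re (g1 t + 2 * y * \<i> * a)"
      by (metis Re_complex_of_real Im_complex_of_real times_complex.sel(1) mult_zero_left diff_zero)
    then have R: "Re (f1 t) = (Re (g1 t) - 2 * y * Im a) / N"
      using N by (simp add: eq_divide_eq mult.commute)
    have m: "cmod (f1 t) = cmod (g1 t) / N"
      by (simp add: f1_def norm_mult norm_inverse N_def power2_eq_square divide_inverse)
    define J where "J = Im (g2 t / g1 t)"
    have J: "Im (g2 t / g1 t + 2 * a) = J + 2 * Im a" by (simp add: J_def)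
    show ?thesis
      unfolding half_plane_curvature_def q m R J If[OF t] N_def[symmetric] y_def[symmetric] J_def[symmetric] using N g by (simp add: field_simps)
  qed
  have "f \<in> curve_space r \<kappa>1 \<kappa>2 (invert_vector \<xi> \<tau> u) (invert_vector \<xi> \<tau> v)"
  proof (rule curve_spaceI[OF df df2 r])
    have "Ck_tendsto r (top::unit filter) (\<lambda>_ t. of_real \<tau> + inverse (of_real \<xi> - \<gamma> t)) (\<lambda>t. of_real \<tau> + inverse (of_real \<xi> - \<gamma> t))"
      using D(2) nz(1) unfolding Ck_iff_tendsto w_def
      by (intro Ck_tendsto_add Ck_tendsto_inverse Ck_tendsto_diff Ck_tendsto_const tendsto_const) auto
    then show "Ck r f" unfolding Ck_iff_tendsto
      by (rule Ck_tendsto_cong) (auto simp: f_def invert_curve_def)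
    show "f \<in> extensional {0..1}" by (simp add: f_def invert_curve_def)
    have ep: "Im (f t) *\<^sub>R f1 t = cmod (f1 t) *\<^sub>R snd (invert_vector \<xi> \<tau> x)"
      if t: "t \<in> {0..1}" and x: "\<gamma> t = fst x" "Im (\<gamma> t) *\<^sub>R g1 t = cmod (g1 t) *\<^sub>R snd x" for t x
    proof -
      have "Im (f t) *\<^sub>R f1 t = (1 / (cmod (w t))\<^sup>2) *\<^sub>R ((Im (\<gamma> t) *\<^sub>R g1 t) * (inverse (w t) * inverse (w t)))"
        by (simp add: f1_def If[OF t])
      also have "\<dots> = cmod (f1 t) *\<^sub>R snd (invert_vector \<xi> \<tau> x)"
        unfolding x(2) using x(1)
        by (simp add: f1_def invert_vector_def w_def norm_mult norm_inverse power2_eq_square divide_inverse)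
      finally show ?thesis .
    qed
    show "f 0 = fst (invert_vector \<xi> \<tau> u)" "f 1 = fst (invert_vector \<xi> \<tau> v)"
      using D(11,12) by (auto simp: f_def invert_curve_def invert_vector_def)
    show "Im (f 0) *\<^sub>R f1 0 = cmod (f1 0) *\<^sub>R snd (invert_vector \<xi> \<tau> u)"
      by (rule ep) (use D(11,13) in \<open>auto simp: g1_def\<close>)
    show "Im (f 1) *\<^sub>R f1 1 = cmod (f1 1) *\<^sub>R snd (invert_vector \<xi> \<tau> v)"
      by (rule ep) (use D(12,14) in \<open>auto simp: g1_def\<close>)
    fix t :: real assume t: "t \<in> {0..1}"
    show "Im (f t) > 0" unfolding If[OF t] using D(7)[OF t] nz(2)[OF t] by simp
    show "f1 t \<noteq> 0" using D(8)[OF t] nz(1)[OF t] by (simp add: f1_def g1_def)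
    show "\<kappa>1 < ereal (half_plane_curvature (f t) (f1 t) (f2 t))"
      unfolding K[OF t] using D(9)[OF t] by (simp only: g1_def g2_def)
    show "ereal (half_plane_curvature (f t) (f1 t) (f2 t)) < \<kappa>2"
      unfolding K[OF t] using D(10)[OF t] by (simp only: g1_def g2_def)
  qed
  then show ?thesis by (simp add: f_def)
qed

lemma continuous_map_invert_curve:
  assumes r: "r = Suc (Suc q)"
  shows "continuous_map (curve_topology r \<kappa>1 \<kappa>2 u v)
    (curve_topology r \<kappa>1 \<kappa>2 (invert_vector \<xi> \<tau> u) (invert_vector \<xi> \<tau> v)) (invert_curve \<xi> \<tau>)"
    (is "continuous_map ?X ?Y _")
  unfolding continuous_map_atin
proof
  fix \<gamma> assume "\<gamma> \<in> topspace ?X"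
  then have \<gamma>: "\<gamma> \<in> curve_space r \<kappa>1 \<kappa>2 u v" by simp
  let ?F = "atin ?X \<gamma>"
  have "limitin ?X (\<lambda>x. x) \<gamma> ?F"
    using continuous_map_id[of ?X] \<gamma> unfolding continuous_map_atin id_def by simp
  then have ev: "\<forall>\<^sub>F x in ?F. x \<in> curve_space r \<kappa>1 \<kappa>2 u v" and c: "Ck_tendsto r ?F (\<lambda>x. x) \<gamma>"
    unfolding limitin_curve_topology by blast+
  have nz: "of_real \<xi> - \<gamma> t \<noteq> 0" if "t \<in> {0..1}" for t
    using curve_spaceD(7)[OF \<gamma> r that] by (auto simp: complex_eq_iff)
  have "Ck_tendsto r ?F (\<lambda>x t. of_real \<tau> + inverse (of_real \<xi> - x t)) (\<lambda>t. of_real \<tau> + inverse (of_real \<xi> - \<gamma> t))"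
    by (intro Ck_tendsto_add Ck_tendsto_inverse Ck_tendsto_diff Ck_tendsto_const tendsto_const c nz)
  then have "Ck_tendsto r ?F (invert_curve \<xi> \<tau>) (invert_curve \<xi> \<tau> \<gamma>)"
    by (rule Ck_tendsto_cong) (auto simp: invert_curve_def)
  moreover have "\<forall>\<^sub>F x in ?F. invert_curve \<xi> \<tau> x \<in> curve_space r \<kappa>1 \<kappa>2 (invert_vector \<xi> \<tau> u) (invert_vector \<xi> \<tau> v)"
    using ev by eventually_elim (rule invert_curve_in_curve_space[OF _ r])
  ultimately show "limitin ?Y (invert_curve \<xi> \<tau>) (invert_curve \<xi> \<tau> \<gamma>) ?F"
    using invert_curve_in_curve_space[OF \<gamma> r] unfolding limitin_curve_topology by blast
qed

lemma homeomorphic_invert_curve: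
  assumes r: "r = Suc (Suc q)" and uv: "Im (fst u) > 0" "Im (fst v) > 0"
  shows "curve_topology r \<kappa>1 \<kappa>2 u v homeomorphic_space
    curve_topology r \<kappa>1 \<kappa>2 (invert_vector \<xi> 0 u) (invert_vector \<xi> 0 v)" (is "?X homeomorphic_space ?Y")
proof -
  have 1: "continuous_map ?Y ?X (invert_curve 0 \<xi>)"
    using continuous_map_invert_curve[OF r, of \<kappa>1 \<kappa>2 "invert_vector \<xi> 0 u" "invert_vector \<xi> 0 v" 0 \<xi>]
    unfolding invert_vector_invert[OF uv(1)] invert_vector_invert[OF uv(2)] .
  have 2: "invert_curve 0 \<xi> (invert_curve \<xi> 0 \<gamma>) = \<gamma>" if "\<gamma> \<in> topspace ?X" for \<gamma>
  proof (rule extensionalityI[of _ "{0..1}"])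
    have \<gamma>: "\<gamma> \<in> curve_space r \<kappa>1 \<kappa>2 u v" using that by simp
    show "\<gamma> \<in> extensional {0..1}" by (rule curve_spaceD(1)[OF \<gamma> r])
    show "invert_curve 0 \<xi> (invert_curve \<xi> 0 \<gamma>) \<in> extensional {0..1}" by (simp add: invert_curve_def)
  qed (simp add: invert_curve_def)
  have 3: "invert_curve \<xi> 0 (invert_curve 0 \<xi> \<gamma>) = \<gamma>" if "\<gamma> \<in> topspace ?Y" for \<gamma>
  proof (rule extensionalityI[of _ "{0..1}"])
    have \<gamma>: "\<gamma> \<in> curve_space r \<kappa>1 \<kappa>2 (invert_vector \<xi> 0 u) (invert_vector \<xi> 0 v)" using that by simp
    show "\<gamma> \<in> extensional {0..1}" by (rule curve_spaceD(1)[OF \<gamma> r])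
    show "invert_curve \<xi> 0 (invert_curve 0 \<xi> \<gamma>) \<in> extensional {0..1}" by (simp add: invert_curve_def)
  qed (simp add: invert_curve_def)
  have "homeomorphic_maps ?X ?Y (invert_curve \<xi> 0) (invert_curve 0 \<xi>)"
    unfolding homeomorphic_maps_def using continuous_map_invert_curve[OF r] 1 2 3 by blast
  then show ?thesis unfolding homeomorphic_space_def by blast
qed

lemma contractible_small_curvature:
  assumes k: "- 1 \<le> k1" "k1 < k2" "k2 \<le> 1" and r: "r = Suc (Suc q)"
    and u: "u \<in> unit_tangent_bundle" and v: "v \<in> unit_tangent_bundle"
  shows "contractible_space (curve_topology r (ereal k1) (ereal k2) u v)"
proof -
  have up: "contractible_space (curve_topology r (ereal k1) (ereal k2) u v)"
    if uv: "u \<in> unit_tangent_bundle" "v \<in> unit_tangent_bundle" and "Im (snd v) > 0" for u v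
  proof -
    obtain \<theta>0 where 0: "u = frame (fst u, \<theta>0)" using frame_surj[OF uv(1)] by blast
    obtain \<theta>1 where 1: "v = frame (fst v, \<theta>1)" "Im (fst v) > 0" using frame_surj[OF uv(2)] by blast
    have "Im (snd v) = Im (fst v) * sin \<theta>1" by (subst 1(1)) (simp add: frame_def)
    then have "sin \<theta>1 > 0" using \<open>Im (snd v) > 0\<close> 1(2) by (simp add: zero_less_mult_iff)
    from contractible_upward[OF k r this 1(2), of "fst u" \<theta>0] show ?thesis
      using 0 1(1) by metis
  qed
  have ui: "Im (fst u) > 0" and vi: "Im (fst v) > 0" and vn: "cmod (snd v) = Im (fst v)"
    using u v by (auto simp: unit_tangent_bundle_def hyperbolic_plane_def hyp_norm_eq split: prod.splits)
  show ?thesis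
  proof (cases "Im (snd v) > 0")
    case True
    then show ?thesis by (rule up[OF u v])
  next
    case False
    \<comment> \<open>A point of the boundary such that, once it is at infinity, the final vector points upwards. For a downward vector the foot of its base point is such a point; for a horizontal vector take the point ahead in direction \<open>- \<pi>/4\<close> or \<open>- 3\<pi>/4\<close>.\<close>
    define \<xi> where "\<xi> = (if Im (snd v) < 0 then Re (fst v) else Re (fst v) + Re (snd v))"
    have "Im (snd (invert_vector \<xi> 0 v)) > 0"
    proof (cases "Im (snd v) < 0")
      case True
      have "(of_real \<xi> - fst v)\<^sup>2 = - of_real ((Im (fst v))\<^sup>2)"
        using True by (simp add: \<xi>_def complex_eq_iff power2_eq_square)
      then have "snd (invert_vector \<xi> 0 v) = of_real (- inverse ((Im (fst v))\<^sup>2)) * snd v"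
        by (simp add: invert_vector_def divide_inverse)
      moreover have "Im (of_real c * x) = c * Im x" for c x by simp
      ultimately have "Im (snd (invert_vector \<xi> 0 v)) = - inverse ((Im (fst v))\<^sup>2) * Im (snd v)" by metis
      also have "\<dots> > 0" by (rule mult_neg_neg) (use True vi in auto)
      finally show ?thesis .
    next
      case F: False
      then have i0: "Im (snd v) = 0" using False by simp
      define a where "a = Re (snd v)"
      define y where "y = Im (fst v)"
      have a: "snd v = of_real a" using i0 by (simp add: a_def complex_eq_iff)
      have "\<bar>a\<bar> = y" using vn by (simp add: a y_def)
      then have "a * a = y * y" by (metis abs_mult_self_eq)
      then have y: "y > 0" "a * a = y * y" using vi by (auto simp: y_def)
      have "(of_real \<xi> - fst v)\<^sup>2 = - (2 * a * y) * \<i>"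
        using F y(2) by (simp add: \<xi>_def complex_eq_iff power2_eq_square a_def y_def)
      then have "snd (invert_vector \<xi> 0 v) = of_real a / (- (2 * a * y) * \<i>)" by (simp add: invert_vector_def a)
      also have "\<dots> = of_real (1 / (2 * y)) * \<i>"
      proof -
        have "a \<noteq> 0" using y by auto
        then have "- (2 * a * y) * \<i> \<noteq> 0" using y(1) by simp
        then show ?thesis using y(1) by (subst nonzero_divide_eq_eq) (auto simp: complex_eq_iff)
      qed
      finally show ?thesis using y(1) by simp
    qed
    then have "contractible_space (curve_topology r (ereal k1) (ereal k2) (invert_vector \<xi> 0 u) (invert_vector \<xi> 0 v))"
      by (rule up[OF invert_vector_in[OF u] invert_vector_in[OF v]])
    then show ?thesis
      using homeomorphic_space_contractibility[OF homeomorphic_invert_curve[OF r ui vi]] by blast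
  qed
qed

section \<open>Conclusion\<close>

lemma cis_add_eq_iff: "cis (a + b) = cis c \<longleftrightarrow> (\<exists>n::int. b = c - a + 2 * pi * n)"
proof -
  have "cis (a + b) = cis c \<longleftrightarrow> sin (a + b) = sin c \<and> cos (a + b) = cos c" by (auto simp: complex_eq_iff)
  also have "\<dots> \<longleftrightarrow> (\<exists>n::int. a + b = c + 2 * pi * n)" by (rule sin_cos_eq_iff)
  also have "\<dots> \<longleftrightarrow> (\<exists>n::int. b = c - a + 2 * pi * n)" by (auto simp: algebra_simps)
  finally show ?thesis .
qed

lemma infinite_turnings:
  assumes "\<sigma> = 1 \<or> \<sigma> = (- 1 :: real)"
  shows "infinite {\<Omega>. cis (a + \<Omega>) = cis c \<and> \<sigma> * \<Omega> > B}"
proof -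
  obtain m :: nat where m: "2 * pi * real m > B - \<sigma> * (c - a)"
    using reals_Archimedean2[of "(B - \<sigma> * (c - a)) / (2 * pi)"] by (auto simp: pos_divide_less_eq mult.commute)
  define f where "f = (\<lambda>n::nat. c - a + \<sigma> * (2 * pi * real (n + m)))"
  have "inj f" using assms by (auto simp: f_def inj_on_def)
  then have "infinite (range f)" by (rule range_inj_infinite)
  moreover have "range f \<subseteq> {\<Omega>. cis (a + \<Omega>) = cis c \<and> \<sigma> * \<Omega> > B}"
  proof clarsimp
    fix n
    have "cis (a + f n) = cis c"
      unfolding cis_add_eq_iff
      using assms by (auto simp: f_def intro: exI[of _ "int (n + m)"] exI[of _ "- int (n + m)"])
    moreover have "\<sigma> * f n = \<sigma> * (c - a) + 2 * pi * real (n + m)" using assms by (auto simp: f_def)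
    moreover have "2 * pi * real m \<le> 2 * pi * real (n + m)" by simp
    ultimately show "cis (a + f n) = cis c \<and> B < \<sigma> * f n" using m by linarith
  qed
  ultimately show ?thesis using infinite_super by blast
qed

text \<open>A contractible space is connected, and a connected set of reals with two points is uncountable, whereas the
  possible turnings are countably many.\<close>

lemma turning_constant:
  assumes con: "contractible_space (curve_topology r \<kappa>1 \<kappa>2 u v)" and r: "r = Suc (Suc q)"
    and A: "\<And>\<gamma>. \<gamma> \<in> curve_space r \<kappa>1 \<kappa>2 u v \<Longrightarrow> cis (a + turning \<gamma>) = cis c"
    and \<gamma>: "\<gamma> \<in> curve_space r \<kappa>1 \<kappa>2 u v" "\<eta> \<in> curve_space r \<kappa>1 \<kappa>2 u v"
  shows "turning \<gamma> = turning \<eta>"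
proof (rule ccontr)
  let ?X = "curve_topology r \<kappa>1 \<kappa>2 u v"
  assume ne: "turning \<gamma> \<noteq> turning \<eta>"
  have "continuous_map ?X euclidean turning"
    unfolding continuous_map_atin
  proof
    fix \<gamma> assume "\<gamma> \<in> topspace ?X"
    then have \<gamma>: "\<gamma> \<in> curve_space r \<kappa>1 \<kappa>2 u v" by simp
    have "limitin ?X (\<lambda>x. x) \<gamma> (atin ?X \<gamma>)"
      using continuous_map_id[of ?X] \<gamma> unfolding continuous_map_atin id_def by simp
    then have c: "Ck_tendsto r (atin ?X \<gamma>) (\<lambda>x. x) \<gamma>" unfolding limitin_curve_topology by blast
    from C0_tendsto_at[OF Ck_tendsto_C0[OF Ck_tendsto_integral[OF Ck_tendsto_turn_rate[OF r \<gamma> c]]], of 1]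
    show "limitin euclidean turning (turning \<gamma>) (atin ?X \<gamma>)"
      by (simp add: turning_def[abs_def])
  qed
  moreover have "connected_space ?X" by (rule contractible_imp_connected_space[OF con])
  ultimately have "connectedin euclidean (turning ` topspace ?X)"
    using connectedin_continuous_map_image connectedin_topspace by blast
  then have "connected (turning ` curve_space r \<kappa>1 \<kappa>2 u v)" by simp
  then have "uncountable (turning ` curve_space r \<kappa>1 \<kappa>2 u v)"
    using \<gamma> ne by (intro connected_uncountable[of _ "turning \<gamma>" "turning \<eta>"]) auto
  moreover have "turning ` curve_space r \<kappa>1 \<kappa>2 u v \<subseteq> range (\<lambda>n::int. c - a + 2 * pi * n)"
    using A unfolding cis_add_eq_iff by blast
  then have "countable (turning ` curve_space r \<kappa>1 \<kappa>2 u v)" by (rule countable_subset) simp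
  ultimately show False by simp
qed

lemma ereal_interval_within:
  assumes "\<kappa>1 < \<kappa>2" "{\<kappa>1<..<\<kappa>2} \<subseteq> {- 1..1::ereal}"
  obtains k1 k2 where "\<kappa>1 = ereal k1" "\<kappa>2 = ereal k2" "- 1 \<le> k1" "k1 < k2" "k2 \<le> 1"
proof -
  have 1: "- 1 \<le> \<kappa>1"
  proof (rule ccontr)
    assume "\<not> - 1 \<le> \<kappa>1"
    then have "\<kappa>1 < - 1" by (simp only: not_le)
    then obtain x where "\<kappa>1 < x" "x < min \<kappa>2 (- 1)" using dense[of \<kappa>1 "min \<kappa>2 (- 1)"] assms(1) by auto
    then show False using assms(2) by fastforce
  qed
  have 2: "\<kappa>2 \<le> 1"
  proof (rule ccontr)
    assume "\<not> \<kappa>2 \<le> 1"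
    then have "1 < \<kappa>2" by (simp only: not_le)
    then obtain x where "max \<kappa>1 1 < x" "x < \<kappa>2" using dense[of "max \<kappa>1 1" \<kappa>2] assms(1) by auto
    then show False using assms(2) by fastforce
  qed
  show ?thesis
    using that 1 2 assms(1) by (cases \<kappa>1; cases \<kappa>2) (auto simp: one_ereal_def)
qed

lemma ereal_interval_outside:
  assumes "\<kappa>1 < \<kappa>2" "{\<kappa>1<..<\<kappa>2} \<inter> {- 1..1::ereal} = {}"
  shows "1 \<le> \<kappa>1 \<or> \<kappa>2 \<le> - 1"
proof (rule ccontr)
  assume "\<not> ?thesis"
  then have "\<kappa>1 < 1" "- 1 < \<kappa>2" unfolding de_Morgan_disj not_le by blast+
  moreover have "(- 1::ereal) < 1" by (simp add: one_ereal_def)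
  ultimately obtain x where "max \<kappa>1 (- 1) < x" "x < min \<kappa>2 1"
    using dense[of "max \<kappa>1 (- 1)" "min \<kappa>2 1"] assms(1) by auto
  then have "x \<in> {\<kappa>1<..<\<kappa>2} \<inter> {- 1..1}" by auto
  then show False using assms(2) by blast
qed

text \<open>From \<open>y \<theta>'/\<bar>\<gamma>'\<bar> = \<kappa> - cos \<theta>\<close>.\<close>

lemma turn_rate_sign:
  assumes \<gamma>: "\<gamma> \<in> curve_space r \<kappa>1 \<kappa>2 u v" and r: "r = Suc (Suc q)"
    and \<sigma>: "\<sigma> = 1 \<and> 1 \<le> \<kappa>1 \<or> \<sigma> = (- 1 :: real) \<and> \<kappa>2 \<le> - 1" and t: "t \<in> {0..1}"
  shows "\<sigma> * turn_rate \<gamma> t > 0"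
proof -
  note D = curve_spaceD[OF \<gamma> r]
  define n where "n = cmod (deriv01 \<gamma> t)"
  define x where "x = Re (deriv01 \<gamma> t)"
  define k where "k = (x + Im (\<gamma> t) * turn_rate \<gamma> t) / n"
  have n: "n > 0" "\<bar>x\<bar> \<le> n" using D(8)[OF t] abs_Re_le_cmod by (auto simp: n_def x_def)
  have k: "\<kappa>1 < ereal k" "ereal k < \<kappa>2" using D(9,10)[OF t] by (auto simp: k_def turn_rate_def half_plane_curvature_def n_def x_def)
  have kn: "k * n = x + Im (\<gamma> t) * turn_rate \<gamma> t" using n by (simp add: k_def)
  from \<sigma> have "Im (\<gamma> t) * (\<sigma> * turn_rate \<gamma> t) > 0"
  proof
    assume s: "\<sigma> = 1 \<and> 1 \<le> \<kappa>1"
    then have "ereal 1 < ereal k" using k(1) unfolding one_ereal_def by (meson le_less_trans)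
    then have "1 * n < k * n" using n by (intro mult_strict_right_mono) auto
    then show ?thesis using s kn n by simp
  next
    assume s: "\<sigma> = - 1 \<and> \<kappa>2 \<le> - 1"
    then have "ereal k < ereal (- 1)" using k(2) less_le_trans by (fastforce simp: one_ereal_def)
    then have "k * n < - 1 * n" using n by (intro mult_strict_right_mono) auto
    then show ?thesis using s kn n by simp
  qed
  then show ?thesis using D(7)[OF t] by (simp add: zero_less_mult_iff)
qed

lemma turning_sign:
  assumes \<gamma>: "\<gamma> \<in> curve_space r \<kappa>1 \<kappa>2 u v" and r: "r = Suc (Suc q)"
    and \<sigma>: "\<sigma> = 1 \<and> 1 \<le> \<kappa>1 \<or> \<sigma> = (- 1 :: real) \<and> \<kappa>2 \<le> - 1"
  shows "\<sigma> * turning \<gamma> > 0"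
proof -
  have "integral {0..1} (\<lambda>t. \<sigma> * turn_rate \<gamma> t) > 0"
    by (rule integral_pos01) (intro continuous_intros Ck_continuous[OF turn_rate_Ck[OF r \<gamma>]], rule turn_rate_sign[OF \<gamma> r \<sigma>])
  then show ?thesis by (simp add: turning_def)
qed

theorem mainTheorem1:
  fixes r :: nat and \<kappa>1 \<kappa>2 :: ereal and u v :: "complex \<times> complex"
    and E :: "'e::real_normed_vector set" and pr :: "'e \<Rightarrow> complex \<times> complex" and u' :: 'e
  assumes "r \<ge> 2"
    and "\<kappa>1 < \<kappa>2"
    and "u \<in> unit_tangent_bundle" and "v \<in> unit_tangent_bundle"
    and "universal_cover E pr unit_tangent_bundle"
    and "u' \<in> E" and "pr u' = u"
  defines "X \<equiv> curve_topology r \<kappa>1 \<kappa>2 u v"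
    and "fibre \<equiv> {w \<in> E. pr w = v}"
    and "CS \<equiv> canonical_subspace r \<kappa>1 \<kappa>2 u v E pr u'"
  shows "({\<kappa>1<..<\<kappa>2} \<subseteq> {-1..1} \<longrightarrow>
            (\<forall>w1\<in>fibre. \<forall>w2\<in>fibre. CS w1 \<noteq> {} \<and> CS w2 \<noteq> {} \<longrightarrow> w1 = w2) \<and>
            (\<forall>w\<in>fibre. CS w \<noteq> {} \<longrightarrow> contractible_space (subtopology X (CS w))) \<and>
            (topspace X = {} \<or> contractible_space X))
       \<and> ({\<kappa>1<..<\<kappa>2} \<inter> {-1..1} = {} \<longrightarrow>
            infinite {w \<in> fibre. CS w = {}} \<and>
            infinite {w \<in> fibre. CS w \<noteq> {}} \<and>
            (\<forall>w\<in>fibre. CS w \<noteq> {} \<longrightarrow> contractible_space (subtopology X (CS w))))"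
proof -
  obtain q where r: "r = Suc (Suc q)" using assms(1) by (metis add_2_eq_Suc le_Suc_ex)
  define z0 where "z0 = fst u"
  define z1 where "z1 = fst v"
  obtain \<theta>0 where u: "u = frame (z0, \<theta>0)" and z0: "Im z0 > 0" using frame_surj[OF assms(3)] unfolding z0_def by blast
  obtain \<theta>1 where v: "v = frame (z1, \<theta>1)" and z1: "Im z1 > 0" using frame_surj[OF assms(4)] unfolding z1_def by blast
  define A where "A = {\<Omega>. cis (\<theta>0 + \<Omega>) = cis \<theta>1}"
  obtain W where W: "inj_on W A" "W ` A \<subseteq> fibre"
    "\<And>\<gamma>. \<gamma> \<in> curve_space r \<kappa>1 \<kappa>2 u v \<Longrightarrow> turning \<gamma> \<in> A \<and> lift_endpoint E pr u' \<gamma> = W (turning \<gamma>)"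
    unfolding fibre_def u v A_def
  proof (rule lift_endpoint_turning[OF assms(5,6) assms(7)[unfolded u] z0 z1 assms(1), of \<theta>1], goal_cases)
    case (1 W)
    show ?thesis by (rule 1(1)[of W]) (fact 1)+
  qed
  have CS: "CS w = {\<gamma> \<in> curve_space r \<kappa>1 \<kappa>2 u v. W (turning \<gamma>) = w}" for w
    unfolding CS_def canonical_subspace_def using W(3) by auto
  have CS_W: "CS (W \<Omega>) = {\<gamma> \<in> curve_space r \<kappa>1 \<kappa>2 u v. turning \<gamma> = \<Omega>}" if "\<Omega> \<in> A" for \<Omega>
    unfolding CS using W(1,3) that by (auto dest: inj_onD)
  have CS_ne: "\<exists>\<Omega>\<in>A. w = W \<Omega>" if "CS w \<noteq> {}" for w
    using that W(3) unfolding CS by blast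
  show ?thesis
  proof (intro conjI impI)
    assume "{\<kappa>1<..<\<kappa>2} \<subseteq> {-1..1}"
    then obtain k1 k2 where k: "\<kappa>1 = ereal k1" "\<kappa>2 = ereal k2" "- 1 \<le> k1" "k1 < k2" "k2 \<le> 1"
      using ereal_interval_within[OF assms(2)] by blast
    have con: "contractible_space X"
      unfolding X_def k(1,2) by (rule contractible_small_curvature[OF k(3-5) r assms(3,4)])
    then show "topspace X = {} \<or> contractible_space X" by blast
    have const: "turning \<gamma> = turning \<eta>" if "\<gamma> \<in> curve_space r \<kappa>1 \<kappa>2 u v" "\<eta> \<in> curve_space r \<kappa>1 \<kappa>2 u v" for \<gamma> \<eta>
      by (rule turning_constant[OF con[unfolded X_def] r _ that, of \<theta>0 \<theta>1])
        (use W(3) in \<open>simp add: A_def\<close>)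
    show "\<forall>w1\<in>fibre. \<forall>w2\<in>fibre. CS w1 \<noteq> {} \<and> CS w2 \<noteq> {} \<longrightarrow> w1 = w2"
    proof (intro ballI impI, elim conjE)
      fix w1 w2 assume "CS w1 \<noteq> {}" "CS w2 \<noteq> {}"
      then obtain \<gamma> \<eta> where "\<gamma> \<in> CS w1" "\<eta> \<in> CS w2" by blast
      then show "w1 = w2" using const[of \<gamma> \<eta>] by (simp add: CS)
    qed
    show "\<forall>w\<in>fibre. CS w \<noteq> {} \<longrightarrow> contractible_space (subtopology X (CS w))"
    proof (intro ballI impI)
      fix w assume "CS w \<noteq> {}"
      then obtain \<gamma> where "\<gamma> \<in> CS w" by blast
      then have \<gamma>: "\<gamma> \<in> curve_space r \<kappa>1 \<kappa>2 u v" "W (turning \<gamma>) = w" by (simp_all add: CS)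
      have "W (turning \<eta>) = w" if "\<eta> \<in> curve_space r \<kappa>1 \<kappa>2 u v" for \<eta>
        using const[OF that \<gamma>(1)] \<gamma>(2) by simp
      then have "CS w = topspace X" unfolding CS X_def topspace_curve_topology by blast
      then show "contractible_space (subtopology X (CS w))" using con by simp
    qed
  next
    assume dis: "{\<kappa>1<..<\<kappa>2} \<inter> {-1..1} = {}"
    define \<sigma> :: real where "\<sigma> = (if 1 \<le> \<kappa>1 then 1 else - 1)"
    have \<sigma>: "\<sigma> = 1 \<and> 1 \<le> \<kappa>1 \<or> \<sigma> = - 1 \<and> \<kappa>2 \<le> - 1"
      using ereal_interval_outside[OF assms(2) dis] by (auto simp: \<sigma>_def)
    then have \<sigma>1: "\<sigma> = 1 \<or> \<sigma> = - 1" "- \<sigma> = 1 \<or> - \<sigma> = - 1" by auto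
    have ts: "\<sigma> * turning \<gamma> > 0" if "\<gamma> \<in> curve_space r \<kappa>1 \<kappa>2 u v" for \<gamma> by (rule turning_sign[OF that r \<sigma>])
    obtain k where k: "\<kappa>1 < ereal k" "ereal k < \<kappa>2" using ereal_dense2[OF assms(2)] by blast
    have \<sigma>k: "\<sigma> * k > 1"
      using \<sigma>
    proof
      assume s: "\<sigma> = 1 \<and> 1 \<le> \<kappa>1"
      then have "ereal 1 < ereal k" using k(1) unfolding one_ereal_def by (meson le_less_trans)
      then show ?thesis using s by simp
    next
      assume s: "\<sigma> = - 1 \<and> \<kappa>2 \<le> - 1"
      then have "ereal k < ereal (- 1)" using k(2) less_le_trans by (fastforce simp: one_ereal_def)
      then show ?thesis using s by simp
    qed
    have k1: "\<bar>k\<bar> > 1" using \<sigma>k \<sigma>1(1) by auto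
    obtain B where B: "\<And>\<Omega>. cis (\<theta>0 + \<Omega>) = cis \<theta>1 \<Longrightarrow> \<Omega> * k > 0 \<Longrightarrow> \<bar>\<Omega>\<bar> \<ge> B \<Longrightarrow>
        \<exists>\<rho>. admissible q \<kappa>1 \<kappa>2 z0 \<theta>0 \<Omega> z1 \<rho>"
      using exists_admissible[OF k k1 z0 z1] by blast
    show "infinite {w \<in> fibre. CS w \<noteq> {}}"
    proof -
      let ?S = "{\<Omega>. cis (\<theta>0 + \<Omega>) = cis \<theta>1 \<and> \<sigma> * \<Omega> > max 0 B}"
      have SA: "?S \<subseteq> A" by (auto simp: A_def)
      have "infinite (W ` ?S)"
        using infinite_turnings[OF \<sigma>1(1)] finite_imageD inj_on_subset[OF W(1) SA] by blast
      moreover have "W ` ?S \<subseteq> {w \<in> fibre. CS w \<noteq> {}}"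
      proof
        fix w assume "w \<in> W ` ?S"
        then obtain \<Omega> where \<Omega>: "w = W \<Omega>" "cis (\<theta>0 + \<Omega>) = cis \<theta>1" "\<sigma> * \<Omega> > 0" "\<sigma> * \<Omega> > B" by auto
        have "0 < \<sigma> * k" using \<sigma>k by linarith
        then have "(\<sigma> * \<Omega>) * (\<sigma> * k) > 0" by (rule mult_pos_pos[OF \<Omega>(3)])
        then have "\<Omega> * k > 0" using \<sigma>1(1) by auto
        moreover have "\<bar>\<Omega>\<bar> \<ge> B" using \<Omega>(3,4) \<sigma>1(1) by auto
        ultimately obtain \<rho> where \<rho>: "admissible q \<kappa>1 \<kappa>2 z0 \<theta>0 \<Omega> z1 \<rho>" using B \<Omega>(2) by blast
        have "angle_curve z0 \<theta>0 \<Omega> \<rho> (\<lambda>p. 1) \<in> CS (W \<Omega>)"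
          using angle_curve_admissible[OF \<rho> Ck_const _ \<Omega>(2) r] \<Omega>(2) by (subst CS_W) (auto simp: A_def u v)
        moreover have "W \<Omega> \<in> fibre" using W(2) \<Omega>(2) by (auto simp: A_def)
        ultimately show "w \<in> {w \<in> fibre. CS w \<noteq> {}}" using \<Omega>(1) by blast
      qed
      ultimately show ?thesis using infinite_super by blast
    qed
    show "infinite {w \<in> fibre. CS w = {}}"
    proof -
      let ?S = "{\<Omega>. cis (\<theta>0 + \<Omega>) = cis \<theta>1 \<and> - \<sigma> * \<Omega> > 0}"
      have SA: "?S \<subseteq> A" by (auto simp: A_def)
      have "infinite (W ` ?S)"
        using infinite_turnings[OF \<sigma>1(2)] finite_imageD inj_on_subset[OF W(1) SA] by blast
      moreover have "W ` ?S \<subseteq> {w \<in> fibre. CS w = {}}"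
      proof
        fix w assume "w \<in> W ` ?S"
        then obtain \<Omega> where \<Omega>: "w = W \<Omega>" "\<Omega> \<in> A" "\<sigma> * \<Omega> < 0" using SA by auto
        have "CS w = {}" unfolding \<Omega>(1) CS_W[OF \<Omega>(2)] using ts \<Omega>(3) by fastforce
        then show "w \<in> {w \<in> fibre. CS w = {}}" using W(2) \<Omega> by blast
      qed
      ultimately show ?thesis using infinite_super by blast
    qed
    show "\<forall>w\<in>fibre. CS w \<noteq> {} \<longrightarrow> contractible_space (subtopology X (CS w))"
    proof (intro ballI impI)
      fix w assume "CS w \<noteq> {}"
      then obtain \<Omega> where \<Omega>: "\<Omega> \<in> A" "w = W \<Omega>" using CS_ne by blast
      have "turn_rate \<gamma> t / \<Omega> > 0"
        if "\<gamma> \<in> curve_space r \<kappa>1 \<kappa>2 u v" "turning \<gamma> = \<Omega>" "t \<in> {0..1}" for \<gamma> t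
        using turn_rate_sign[OF that(1) r \<sigma> that(3)] ts[OF that(1)] that(2) \<sigma>1(1)
        by (auto simp: zero_less_divide_iff)
      then show "contractible_space (subtopology X (CS w))"
        unfolding \<Omega>(2) CS_W[OF \<Omega>(1)] X_def u v using \<Omega>(1)
        by (intro contractible_turn_class[OF r]) (auto simp: A_def)
    qed
  qed
qed

end
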